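(* Let $\tau\in\mathbb{R}$ with $\tau\neq -1$. For every closed ball $B\subseteq\mathbb{R}^2$ there exist a Borel probability measure $\mu$ on $\mathbb{R}^2$ with support contained in $E_{\ast}(\tau)\cap B$ and a constant $C>0$ such that $$|\widehat{\mu}(\xi)|\le C\,|\xi|^{-2/(1+\tau)}\exp\!\big(\ln|\xi|/\ln\ln|\xi|\big)\quad\text{for all }\xi\in\mathbb{R}^2\text{ with }|\xi|>e.$$
   Context: Identify $\mathbb{R}^2$ with $\mathbb{C}$, so that for $q,x\in\mathbb{R}^2$ the product $qx$ is complex multiplication and $\mathbb{Z}^2$ is the ring of Gaussian integers $\mathbb{Z}+i\mathbb{Z}$. For $x\in\mathbb{R}^2$, $|x|=\max(|x_1|,|x_2|)$. The inner product is $\langle\xi,x\rangle=\xi_1x_1+\xi_2x_2$, and the Fourier transform of a finite Borel measure $\mu$ on $\mathbb{R}^2$ is $\widehat{\mu}(\xi)=\int e^{-2\pi i\langle\xi,x\rangle}\,d\mu(x)$. Define $$E_{\ast}(\tau)=\{x\in\mathbb{R}^2: |qx-r|\le|q|^{-\tau}\text{ for infinitely many }(q,r)\in\mathbb{Z}^2\times\mathbb{Z}^2 \text{ with } q\neq 0\}.$$ *)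

theory Defs
  imports "HOL-Probability.Probability"
begin

text \<open>R^2 is identified with the complex plane. Sup norm |x| = max(|x1|,|x2|).\<close>

definition supnorm :: "complex \<Rightarrow> real" where
  "supnorm x = max \<bar>Re x\<bar> \<bar>Im x\<bar>"

definition gaussian_ints :: "complex set" where
  "gaussian_ints = {z. Re z \<in> \<int> \<and> Im z \<in> \<int>}"

definition E_star :: "real \<Rightarrow> complex set" where
  "E_star \<tau> = {x. infinite {(q, r). q \<in> gaussian_ints \<and> r \<in> gaussian_ints \<and> q \<noteq> 0 \<and>
        supnorm (q * x - r) \<le> supnorm q powr (- \<tau>)}}"

definition fourier_measure :: "complex measure \<Rightarrow> complex \<Rightarrow> complex" where
  "fourier_measure \<mu> \<xi> = (\<integral>x. cis (- 2 * pi * (\<xi> \<bullet> x)) \<partial>\<mu>)"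

definition measure_support :: "complex measure \<Rightarrow> complex set" where
  "measure_support \<mu> = {x. \<forall>e>0. emeasure \<mu> (ball x e) > 0}"

end

theory Submission
  imports Defs
begin

text \<open>For \<open>\<tau> \<le> 0\<close> rounding shows that \<open>E_star \<tau>\<close> is the whole plane, and a smooth compactly
  supported measure does it.  For \<open>\<tau> > 0\<close> we follow Kaufman: starting from a smooth measure, multiply
  repeatedly by densities of the form
  \<open>F x = (\<Sum>q\<in>Q. \<Phi> (q * x)) / card Q\<close>, where \<open>Q\<close> consists of the Gaussian primes of norm
  between \<open>2\<^sup>j\<close> and \<open>2\<^sup>j\<^sup>+\<^sup>1\<close> and \<open>\<Phi>\<close> is a smooth periodic bump supported near the Gaussian
  integers.  The Fourier coefficient of \<open>F\<close> at \<open>l\<close> only involves those \<open>q\<close> whose conjugate divides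
  \<open>l\<close>, and since these \<open>q\<close> are primes there are only \<open>O(ln |l| / j)\<close> of
  them.  Hence the coefficient is at most \<open>|l|\<close> to the power \<open>-2 / (1 + \<tau>)\<close> up to logarithms, which the factor
  \<open>exp (ln |\<xi>| / ln (ln |\<xi>|))\<close> absorbs.  Only infinitely many \<open>j\<close> with
  \<open>card Q \<ge> 2\<^sup>j / (j + 1)\<^sup>2\<close> are needed, and those come from Euler's proof that the
  reciprocals of the prime norms have infinite sum.\<close>

subsection \<open>Gaussian primes\<close>

text \<open>Origin of the exponent: every \<open>q\<close> in shell \<open>j\<close> has modulus at
  most \<open>R = sqrt (2 * 2 ^ j)\<close>, and a bump of width
  \<open>\<delta> = R powr (- \<tau>)\<close> gives \<open>F\<close> coefficients that start to
  decay near modulus \<open>T = R / \<delta> = R powr (1 + \<tau>)\<close>. With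
  \<open>s = 2 / (1 + \<tau>)\<close> one has \<open>T powr s = 2 * 2 ^ j\<close>, which up to
  powers of \<open>j\<close> is matched by \<open>card Q\<close>. So averaging over \<open>Q\<close>
  yields decay of order \<open>s\<close> up to \<open>T\<close>, and the decay of the bump's own
  coefficients takes over beyond. The obstacle is the iteration: the error of a step is proportional
  to a decay constant of the current measure, over which there is no control. The coefficient
  estimate therefore gives away one more logarithm to keep a spare factor \<open>1 / j\<close>, and
  \<open>j\<close> is chosen after the measure, so that the errors can be made summable. Decay of
  finite order takes the place of smoothness. Measures carry order 6: four powers sum over the
  lattice and two transfer the profile from \<open>l\<close> to \<open>\<xi>\<close>. Kernels have
  order 7, one power of which absorbs a logarithm when order 6 is re-established for the next
  measure.\<close>

lemma gaussian_ints_iff: "z \<in> gaussian_ints \<longleftrightarrow> (\<exists>a b::int. z = Complex (of_int a) (of_int b))"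
  unfolding gaussian_ints_def by (auto simp: complex_eq_iff elim!: Ints_cases)

lemma gaussian_ints_0 [simp]: "0 \<in> gaussian_ints"
  and gaussian_ints_1 [simp]: "1 \<in> gaussian_ints"
  by (auto simp: gaussian_ints_def)

lemma gaussian_ints_add [intro]: "a \<in> gaussian_ints \<Longrightarrow> b \<in> gaussian_ints \<Longrightarrow> a + b \<in> gaussian_ints"
  and gaussian_ints_diff [intro]: "a \<in> gaussian_ints \<Longrightarrow> b \<in> gaussian_ints \<Longrightarrow> a - b \<in> gaussian_ints"
  and gaussian_ints_mult [intro]: "a \<in> gaussian_ints \<Longrightarrow> b \<in> gaussian_ints \<Longrightarrow> a * b \<in> gaussian_ints"
  and gaussian_ints_cnj [intro]: "a \<in> gaussian_ints \<Longrightarrow> cnj a \<in> gaussian_ints"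
  by (auto simp: gaussian_ints_def)

text \<open>Natural-number valued so that it can drive inductions and least-element arguments; the
  floor is exact on \<open>gaussian_ints\<close>.\<close>

definition gnorm :: "complex \<Rightarrow> nat" where
  "gnorm z = nat \<lfloor>(cmod z)\<^sup>2\<rfloor>"

lemma of_nat_gnorm: assumes "z \<in> gaussian_ints" shows "real (gnorm z) = (cmod z)\<^sup>2"
proof -
  obtain a b :: int where z: "z = Complex (of_int a) (of_int b)"
    using assms gaussian_ints_iff by blast
  have "(cmod z)\<^sup>2 = of_int (a\<^sup>2 + b\<^sup>2)"
    by (simp add: z cmod_power2)
  moreover have "a\<^sup>2 + b\<^sup>2 \<ge> 0" by simp
  ultimately show ?thesis unfolding gnorm_def
    by (metis floor_of_int of_int_of_nat_eq of_nat_nat)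
qed

lemma gnorm_mult: assumes "a \<in> gaussian_ints" "b \<in> gaussian_ints"
  shows "gnorm (a * b) = gnorm a * gnorm b"
proof -
  have "real (gnorm (a * b)) = real (gnorm a * gnorm b)"
    using assms by (simp add: of_nat_gnorm gaussian_ints_mult norm_mult power_mult_distrib)
  then show ?thesis using of_nat_eq_iff by blast
qed

lemma gnorm_eq_0_iff: "z \<in> gaussian_ints \<Longrightarrow> gnorm z = 0 \<longleftrightarrow> z = 0"
  using of_nat_gnorm[of z] by (metis norm_eq_zero of_nat_0 of_nat_eq_0_iff power2_eq_square mult_eq_0_iff)

lemma gnorm_pos: "z \<in> gaussian_ints \<Longrightarrow> z \<noteq> 0 \<Longrightarrow> gnorm z \<ge> 1"
  using gnorm_eq_0_iff by fastforce

lemma gaussian_norm_ge_1: assumes "z \<in> gaussian_ints" "z \<noteq> 0" shows "cmod z \<ge> 1"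
proof -
  have "(cmod z)\<^sup>2 \<ge> 1\<^sup>2"
    using gnorm_pos[OF assms] of_nat_gnorm[OF assms(1)] by simp
  then show ?thesis using power2_le_imp_le norm_ge_zero by blast
qed

definition gdvd :: "complex \<Rightarrow> complex \<Rightarrow> bool" where
  "gdvd a b \<longleftrightarrow> (\<exists>m\<in>gaussian_ints. b = a * m)"

lemma gaussian_round: "\<exists>m\<in>gaussian_ints. \<bar>Re (z - m)\<bar> \<le> 1/2 \<and> \<bar>Im (z - m)\<bar> \<le> 1/2"
proof -
  have "Complex (of_int (round (Re z))) (of_int (round (Im z))) \<in> gaussian_ints"
    by (auto simp: gaussian_ints_iff)
  moreover have "\<bar>Re z - of_int (round (Re z))\<bar> \<le> 1/2" "\<bar>Im z - of_int (round (Im z))\<bar> \<le> 1/2"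
    using of_int_round_abs_le[of "Re z"] of_int_round_abs_le[of "Im z"] by linarith+
  ultimately show ?thesis by force
qed

text \<open>Rounding both coordinates of \<open>a / b\<close> leaves an error of squared modulus at
  most 1/2, so the Gaussian integers are Euclidean.\<close>

lemma gaussian_division:
  assumes "b \<noteq> 0"
  shows "\<exists>m\<in>gaussian_ints. cmod (a - b * m) < cmod b"
proof -
  obtain m where m: "m \<in> gaussian_ints" "\<bar>Re (a / b - m)\<bar> \<le> 1/2" "\<bar>Im (a / b - m)\<bar> \<le> 1/2"
    using gaussian_round by blast
  have "(cmod (a / b - m))\<^sup>2 \<le> (1/2)\<^sup>2 + (1/2)\<^sup>2"
    unfolding cmod_power2 using m(2,3) by (intro add_mono abs_le_square_iff[THEN iffD1]) auto
  also have "\<dots> < 1\<^sup>2" by (simp add: power2_eq_square)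
  finally have "cmod (a / b - m) < 1" using power2_less_imp_less by fastforce
  moreover have "a - b * m = b * (a / b - m)" using assms by (simp add: algebra_simps)
  ultimately have "cmod (a - b * m) < cmod b"
    using assms by (simp add: norm_mult)
  with m(1) show ?thesis by blast
qed

definition girred :: "complex \<Rightarrow> bool" where
  "girred p \<longleftrightarrow> p \<in> gaussian_ints \<and> gnorm p > 1 \<and>
     (\<forall>a\<in>gaussian_ints. \<forall>b\<in>gaussian_ints. p = a * b \<longrightarrow> gnorm a = 1 \<or> gnorm b = 1)"

lemma gaussian_unit_inverse:
  assumes "u \<in> gaussian_ints" "gnorm u = 1" shows "u * cnj u = 1"
  using assms of_nat_gnorm[of u] by (simp add: complex_norm_square[symmetric])

text \<open>Bezout: a nonzero element \<open>d\<close> of least norm generates the ideal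
  \<open>I\<close> spanned by \<open>p\<close> and \<open>a\<close>. As \<open>d\<close> divides
  \<open>p\<close>, it is an associate of \<open>p\<close>, which then divides \<open>a\<close>, or
  a unit, and then \<open>b\<close> is a multiple of \<open>p\<close>.\<close>

lemma girred_prime:
  assumes p: "girred p" and ab: "a \<in> gaussian_ints" "b \<in> gaussian_ints" and dvd: "gdvd p (a * b)"
  shows "gdvd p a \<or> gdvd p b"
proof -
  have pG: "p \<in> gaussian_ints" and p1: "gnorm p > 1" using p by (auto simp: girred_def)
  then have p0: "p \<noteq> 0" using gnorm_eq_0_iff[OF gaussian_ints_0] by auto
  define I where "I = {u * p + v * a |u v. u \<in> gaussian_ints \<and> v \<in> gaussian_ints}"
  have IG: "I \<subseteq> gaussian_ints"
  proof
    fix x assume "x \<in> I"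
    then obtain u v where "u \<in> gaussian_ints" "v \<in> gaussian_ints" "x = u * p + v * a"
      unfolding I_def by blast
    then show "x \<in> gaussian_ints" using pG ab(1) by (simp add: gaussian_ints_add gaussian_ints_mult)
  qed
  have pI: "p \<in> I" unfolding I_def by (rule CollectI, rule exI[of _ 1], rule exI[of _ 0]) simp
  have aI: "a \<in> I" unfolding I_def by (rule CollectI, rule exI[of _ 0], rule exI[of _ 1]) simp
  have "\<exists>d. d \<in> I \<and> d \<noteq> 0 \<and> (\<forall>e. e \<in> I \<and> e \<noteq> 0 \<longrightarrow> gnorm d \<le> gnorm e)"
    using ex_has_least_nat[of "\<lambda>d. d \<in> I \<and> d \<noteq> 0" p gnorm] pI p0 by blast
  then obtain d where d: "d \<in> I" "d \<noteq> 0" and dmin: "\<And>e. e \<in> I \<Longrightarrow> e \<noteq> 0 \<Longrightarrow> gnorm d \<le> gnorm e"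
    by blast
  have dG: "d \<in> gaussian_ints" using d IG by auto
  have ddvd: "gdvd d e" if e: "e \<in> I" for e
  proof -
    obtain m where m: "m \<in> gaussian_ints" "cmod (e - d * m) < cmod d"
      using gaussian_division[OF d(2)] by blast
    obtain u v where uv: "u \<in> gaussian_ints" "v \<in> gaussian_ints" "d = u * p + v * a"
      using d by (auto simp: I_def)
    obtain u' v' where uv': "u' \<in> gaussian_ints" "v' \<in> gaussian_ints" "e = u' * p + v' * a"
      using e by (auto simp: I_def)
    have "e - d * m = (u' - u * m) * p + (v' - v * m) * a"
      using uv uv' by (simp add: algebra_simps)
    then have eI: "e - d * m \<in> I"
      unfolding I_def using uv uv' m by blast
    have "e - d * m = 0"
    proof (rule ccontr)
      assume "e - d * m \<noteq> 0"
      then have "gnorm d \<le> gnorm (e - d * m)" using dmin eI by blast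
      then have "(cmod d)\<^sup>2 \<le> (cmod (e - d * m))\<^sup>2"
        using of_nat_gnorm[OF dG] of_nat_gnorm[of "e - d * m"] eI IG by (metis of_nat_le_iff subsetD)
      then show False using m(2) by (meson norm_ge_zero not_le power2_le_imp_le)
    qed
    then show ?thesis using m unfolding gdvd_def by auto
  qed
  obtain e where e: "e \<in> gaussian_ints" "p = d * e" using ddvd[OF pI] by (auto simp: gdvd_def)
  then consider "gnorm e = 1" | "gnorm d = 1" using p dG by (auto simp: girred_def)
  then show ?thesis
  proof cases
    case 1
    then have "d = p * cnj e" using gaussian_unit_inverse[OF e(1)] e(2) by (simp add: mult.assoc)
    moreover obtain f where "f \<in> gaussian_ints" "a = d * f" using ddvd[OF aI] by (auto simp: gdvd_def)
    ultimately have "gdvd p a" unfolding gdvd_def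
      using e(1) by (intro bexI[of _ "cnj e * f"]) auto
    then show ?thesis ..
  next
    case 2
    obtain u v where uv: "u \<in> gaussian_ints" "v \<in> gaussian_ints" "d = u * p + v * a"
      using d by (auto simp: I_def)
    obtain m where m: "m \<in> gaussian_ints" "a * b = p * m" using dvd by (auto simp: gdvd_def)
    \<comment> \<open>The unit \<open>d\<close> has inverse \<open>cnj d\<close>; multiplying
      \<open>d = u * p + v * a\<close> by \<open>b\<close> makes both summands multiples of
      \<open>p\<close>.\<close>
    have "b = cnj d * (d * b)" using gaussian_unit_inverse[OF dG 2]
      by (metis mult.assoc mult.commute mult.left_neutral)
    also have "d * b = p * (u * b + v * m)" using uv m by (simp add: algebra_simps)
    finally have "b = p * (cnj d * (u * b + v * m))" by (simp add: algebra_simps)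
    moreover have "cnj d * (u * b + v * m) \<in> gaussian_ints"
      using uv(1,2) m(1) ab dG by (intro gaussian_ints_mult gaussian_ints_add gaussian_ints_cnj)
    ultimately show ?thesis unfolding gdvd_def by blast
  qed
qed

lemma gaussian_units:
  "{u \<in> gaussian_ints. gnorm u = 1} \<subseteq> {1, -1, \<i>, -\<i>}"
proof
  fix u assume u: "u \<in> {u \<in> gaussian_ints. gnorm u = 1}"
  then obtain a b :: int where ab: "u = Complex (of_int a) (of_int b)"
    using gaussian_ints_iff by blast
  have "(cmod u)\<^sup>2 = 1" using u of_nat_gnorm[of u] by auto
  then have "real_of_int (a\<^sup>2 + b\<^sup>2) = 1" by (simp add: ab cmod_power2)
  then have *: "a\<^sup>2 + b\<^sup>2 = 1" by linarith
  then have "a\<^sup>2 \<le> 1" "b\<^sup>2 \<le> 1" using zero_le_power2[of a] zero_le_power2[of b] by linarith+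
  then have "\<bar>a\<bar> \<le> 1" "\<bar>b\<bar> \<le> 1" using abs_le_square_iff[of _ 1] by auto
  then have "a = -1 \<or> a = 0 \<or> a = 1" "b = -1 \<or> b = 0 \<or> b = 1" by linarith+
  with * show "u \<in> {1, -1, \<i>, -\<i>}" by (auto simp: ab complex_eq_iff)
qed

lemma finite_gaussian_units: "finite {u \<in> gaussian_ints. gnorm u = 1}"
  and card_gaussian_units: "card {u \<in> gaussian_ints. gnorm u = 1} \<le> 4"
proof -
  show "finite {u \<in> gaussian_ints. gnorm u = 1}" by (rule finite_subset[OF gaussian_units]) simp
  have "card {u \<in> gaussian_ints. gnorm u = 1} \<le> card {1, -1, \<i>, -\<i>}"
    by (intro card_mono gaussian_units) auto
  also have "\<dots> \<le> 4" by (simp add: card_insert_if)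
  finally show "card {u \<in> gaussian_ints. gnorm u = 1} \<le> 4" .
qed

lemma finite_gnorm_le: "finite {z \<in> gaussian_ints. gnorm z \<le> n}"
proof -
  have "{z \<in> gaussian_ints. gnorm z \<le> n} \<subseteq>
      (\<lambda>(a, b). Complex (of_int a) (of_int b)) ` ({-int n..int n} \<times> {-int n..int n})"
  proof
    fix z assume z: "z \<in> {z \<in> gaussian_ints. gnorm z \<le> n}"
    then obtain a b :: int where ab: "z = Complex (of_int a) (of_int b)"
      using gaussian_ints_iff by blast
    have "(cmod z)\<^sup>2 \<le> n" using z of_nat_gnorm[of z] by (metis (mono_tags) mem_Collect_eq of_nat_le_iff)
    then have "real_of_int (a\<^sup>2 + b\<^sup>2) \<le> of_int (int n)" by (simp add: ab cmod_power2)
    then have *: "a\<^sup>2 + b\<^sup>2 \<le> int n" by (simp only: of_int_le_iff)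
    have "\<bar>a\<bar> \<le> a\<^sup>2" for a :: int
      by (metis abs_ge_zero abs_le_square_iff abs_power2 int_one_le_iff_zero_less linorder_not_less mult_cancel_right1 mult_le_cancel_right1 power2_abs power2_eq_square order_antisym_conv)
    from this[of a] this[of b] * have "\<bar>a\<bar> \<le> int n" "\<bar>b\<bar> \<le> int n"
      using zero_le_power2[of a] zero_le_power2[of b] by linarith+
    then show "z \<in> (\<lambda>(a, b). Complex (of_int a) (of_int b)) ` ({-int n..int n} \<times> {-int n..int n})"
      using ab by (intro image_eqI[of _ _ "(a, b)"]) auto
  qed
  then show ?thesis by (rule finite_subset) auto
qed

text \<open>Splitting off one divisor \<open>q\<close> of \<open>l\<close> removes only the associates of \<open>q\<close>, because \<open>q\<close> is prime.\<close>
lemma card_prime_divisors: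
  assumes x: "x > 1"
    and Q: "\<And>q. q \<in> Q \<Longrightarrow> girred q \<and> x < gnorm q \<and> gnorm q \<le> 2 * x"
    and l: "l \<in> gaussian_ints" "l \<noteq> 0"
  shows "real (card {q \<in> Q. gdvd q l}) * ln (real x) \<le> 4 * ln (real (gnorm l))"
  using l
proof (induction "gnorm l" arbitrary: l rule: less_induct)
  case less
  note l = less.prems
  have finQ: "finite Q"
    by (rule finite_subset[OF _ finite_gnorm_le[of "2 * x"]]) (use Q in \<open>auto simp: girred_def\<close>)
  show ?case
  proof (cases "{q \<in> Q. gdvd q l} = {}")
    case True
    then have "card {q \<in> Q. gdvd q l} = 0" by (simp only: card.empty)
    then show ?thesis using gnorm_pos[OF l] by simp
  next
    case False
    then obtain q m where q: "q \<in> Q" and m: "m \<in> gaussian_ints" "l = q * m"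
      by (auto simp: gdvd_def)
    have qG: "q \<in> gaussian_ints" and qx: "x < gnorm q" "gnorm q \<le> 2 * x"
      using Q[OF q] by (auto simp: girred_def)
    have m0: "m \<noteq> 0" using m l by auto
    have nl: "gnorm l = gnorm q * gnorm m" using gnorm_mult[OF qG m(1)] m(2) by simp
    have gm: "gnorm m \<ge> 1" using gnorm_pos m m0 by blast
    have lt: "gnorm m < gnorm l" using nl qx x gm by simp
    have sub: "{r \<in> Q. gdvd r l} \<subseteq> {r \<in> Q. gdvd r q} \<union> {r \<in> Q. gdvd r m}"
      using girred_prime Q qG m by (auto)
    \<comment> \<open>Both norms lie in \<open>(x, 2 * x]\<close>, so a quotient of norm at least 2
      would push \<open>gnorm q\<close> above \<open>2 * x\<close>. Only the at most four associates
      of \<open>q\<close> remain.\<close>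
    have "{r \<in> Q. gdvd r q} \<subseteq> (\<lambda>u. q * cnj u) ` {u \<in> gaussian_ints. gnorm u = 1}"
    proof
      fix r assume r: "r \<in> {r \<in> Q. gdvd r q}"
      then obtain u where u: "u \<in> gaussian_ints" "q = r * u" by (auto simp: gdvd_def)
      have rx: "r \<in> gaussian_ints" "x < gnorm r" using Q r by (auto simp: girred_def)
      have "gnorm q = gnorm r * gnorm u" using gnorm_mult rx u by auto
      then have "gnorm r * gnorm u \<le> 2 * x" "gnorm u \<noteq> 0" using qx x by (auto intro!: Nat.gr0I)
      have "\<not> gnorm u \<ge> 2"
      proof
        assume "gnorm u \<ge> 2"
        then have "gnorm r * 2 \<le> gnorm r * gnorm u" by simp
        then show False using \<open>gnorm r * gnorm u \<le> 2 * x\<close> rx by linarith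
      qed
      then have u1: "gnorm u = 1" using \<open>gnorm u \<noteq> 0\<close> by linarith
      have "r = q * cnj u" using u gaussian_unit_inverse[OF u(1) u1] by (simp add: mult.assoc)
      then show "r \<in> (\<lambda>u. q * cnj u) ` {u \<in> gaussian_ints. gnorm u = 1}" using u u1 by auto
    qed
    then have "card {r \<in> Q. gdvd r q} \<le> card {u \<in> gaussian_ints. gnorm u = 1}"
      using surj_card_le[OF finite_gaussian_units] by blast
    then have c4: "card {r \<in> Q. gdvd r q} \<le> 4" using card_gaussian_units by linarith
    have "card {r \<in> Q. gdvd r l} \<le> card ({r \<in> Q. gdvd r q} \<union> {r \<in> Q. gdvd r m})"
      using sub finQ by (intro card_mono) auto
    also have "\<dots> \<le> 4 + card {r \<in> Q. gdvd r m}"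
      using card_Un_le[of "{r \<in> Q. gdvd r q}" "{r \<in> Q. gdvd r m}"] c4 by linarith
    finally have "real (card {r \<in> Q. gdvd r l}) * ln x \<le> (4 + real (card {r \<in> Q. gdvd r m})) * ln x"
      using x by (intro mult_right_mono) auto
    also have "\<dots> \<le> 4 * ln (real x) + 4 * ln (real (gnorm m))"
      using less.hyps[OF lt m(1) m0] by (simp add: algebra_simps)
    \<comment> \<open>The four divisors lost in passing from \<open>l\<close> to \<open>m\<close>
      are paid for by \<open>ln (gnorm q)\<close>, which exceeds \<open>ln x\<close>.\<close>
    also have "\<dots> \<le> 4 * ln (real (gnorm q)) + 4 * ln (real (gnorm m))"
      using qx x by simp
    also have "\<dots> = 4 * ln (real (gnorm l))"
      using nl gm qx x by (simp add: ln_mult)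
    finally show ?thesis .
  qed
qed

section \<open>Factorization into Gaussian primes and Euler's product bound\<close>

inductive_set gmonoid :: "complex set \<Rightarrow> complex set" for P where
  unit: "u \<in> gaussian_ints \<Longrightarrow> gnorm u = 1 \<Longrightarrow> u \<in> gmonoid P"
| mult: "p \<in> P \<Longrightarrow> z \<in> gmonoid P \<Longrightarrow> p * z \<in> gmonoid P"

lemma gmonoid_mult:
  assumes "z \<in> gmonoid P" "w \<in> gmonoid P" shows "z * w \<in> gmonoid P"
  using assms
proof (induction z)
  case (unit u)
  show ?case using unit(3)
  proof (induction w)
    case (unit v)
    then show ?case using \<open>u \<in> gaussian_ints\<close> \<open>gnorm u = 1\<close>
      by (intro gmonoid.unit) (auto simp: gnorm_mult)
  next
    case (mult p z)
    then show ?case using gmonoid.mult[of p P "u * z"] by (simp add: algebra_simps)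
  qed
next
  case (mult p z)
  then show ?case using gmonoid.mult[of p P "z * w"] by (simp add: algebra_simps)
qed

text \<open>Induction on the norm: a nonunit that is not irreducible splits into factors of norm at
  least 2, each of strictly smaller norm than the product.\<close>

lemma gaussian_factorization:
  assumes "z \<in> gaussian_ints" "z \<noteq> 0" "gnorm z \<le> X"
  shows "z \<in> gmonoid {p. girred p \<and> gnorm p \<le> X}"
  using assms
proof (induction "gnorm z" arbitrary: z rule: less_induct)
  case less
  have g1: "gnorm z \<ge> 1" using gnorm_pos less by blast
  consider "gnorm z = 1" | "girred z" |
    a b where "gnorm z > 1" "a \<in> gaussian_ints" "b \<in> gaussian_ints" "z = a * b" "gnorm a \<noteq> 1" "gnorm b \<noteq> 1"
    using g1 less.prems(1) unfolding girred_def by force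
  then show ?case
  proof cases
    case 1
    then show ?thesis using less gmonoid.unit by blast
  next
    case 2
    have "z * 1 \<in> gmonoid {p. girred p \<and> gnorm p \<le> X}"
      using 2 less by (intro gmonoid.mult gmonoid.unit) (auto simp: gnorm_def)
    then show ?thesis by simp
  next
    case 3
    have nz: "a \<noteq> 0" "b \<noteq> 0" using less.prems 3 by auto
    have "gnorm a \<ge> 2" "gnorm b \<ge> 2" using gnorm_pos[OF 3(2) nz(1)] gnorm_pos[OF 3(3) nz(2)] 3 by linarith+
    then have "gnorm a < gnorm z" "gnorm b < gnorm z" using gnorm_mult[OF 3(2,3)] 3(4) by auto
    then show ?thesis using less 3 nz gmonoid_mult by auto
  qed
qed

lemma gmonoid_insert:
  assumes "z \<in> gmonoid (insert p P)"
  shows "\<exists>k w. w \<in> gmonoid P \<and> z = p ^ k * w"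
  using assms
proof (induction z)
  case (unit u)
  then show ?case using gmonoid.unit by (intro exI[of _ 0] exI[of _ u]) auto
next
  case (mult q z)
  then obtain k w where kw: "w \<in> gmonoid P" "z = p ^ k * w" by blast
  show ?case
  proof (cases "q = p")
    case True
    then show ?thesis using kw by (intro exI[of _ "Suc k"] exI[of _ w]) auto
  next
    case False
    then have "q * w \<in> gmonoid P" using mult kw gmonoid.mult by blast
    then show ?thesis using kw by (intro exI[of _ k] exI[of _ "q * w"]) (auto simp: algebra_simps)
  qed
qed

text \<open>Adding \<open>p\<close> to \<open>P\<close> multiplies the bound by a geometric series
  in \<open>r = 1 / (cmod p)\<^sup>2\<close>, which is at most \<open>exp (2 * r)\<close> because
  \<open>r\<close> is at most 1/2. The leading 4 counts the units.\<close>

lemma euler_product_bound: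
  assumes "finite P" "\<And>p. p \<in> P \<Longrightarrow> (cmod p)\<^sup>2 \<ge> 2" "finite A" "A \<subseteq> gmonoid P"
  shows "(\<Sum>z\<in>A. 1 / (cmod z)\<^sup>2) \<le> 4 * exp (2 * (\<Sum>p\<in>P. 1 / (cmod p)\<^sup>2))"
  using assms
proof (induction P arbitrary: A rule: finite_induct)
  case empty
  have sub: "A \<subseteq> {u \<in> gaussian_ints. gnorm u = 1}"
  proof
    fix x assume "x \<in> A"
    then have "x \<in> gmonoid {}" using empty(3) by blast
    then show "x \<in> {u \<in> gaussian_ints. gnorm u = 1}" by cases auto
  qed
  then have "(\<Sum>z\<in>A. 1 / (cmod z)\<^sup>2) = (\<Sum>z\<in>A. 1)"
    using of_nat_gnorm by (intro sum.cong) force+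
  also have "\<dots> = real (card A)" by simp
  also have "\<dots> \<le> 4"
    using card_mono[OF finite_gaussian_units sub] card_gaussian_units by linarith
  finally show ?case by simp
next
  case (insert p P)
  define r where "r = 1 / (cmod p)\<^sup>2"
  have p2: "(cmod p)\<^sup>2 \<ge> 2" using insert by auto
  have r: "0 \<le> r" "r \<le> 1/2"
  proof -
    show "0 \<le> r" by (simp add: r_def)
    show "r \<le> 1/2" unfolding r_def by (rule frac_le) (use p2 in simp_all)
  qed
  have "\<forall>z\<in>A. \<exists>v. snd v \<in> gmonoid P \<and> z = p ^ fst v * snd v"
    using gmonoid_insert insert.prems(3) by fastforce
  then obtain v where v: "\<And>z. z \<in> A \<Longrightarrow> snd (v z) \<in> gmonoid P \<and> z = p ^ fst (v z) * snd (v z)"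
    using bchoice[of A "\<lambda>z v. snd v \<in> gmonoid P \<and> z = p ^ fst v * snd v"] by blast
  define k w where "k z = fst (v z)" and "w z = snd (v z)" for z
  have kw: "w z \<in> gmonoid P \<and> z = p ^ k z * w z" if "z \<in> A" for z
    using v[OF that] by (simp add: k_def w_def)
  define K where "K = Suc (Max (k ` A \<union> {0}))"
  have kK: "k z < K" if "z \<in> A" for z
    unfolding K_def less_Suc_eq_le using that insert.prems by (intro Max_ge) auto
  have sub: "A \<subseteq> (\<lambda>(i, v). p ^ i * v) ` ({..<K} \<times> w ` A)"
    using kw kK by (force simp: image_iff)
  have fin: "finite ({..<K} \<times> w ` A)" using insert by auto
  have "(\<Sum>z\<in>A. 1 / (cmod z)\<^sup>2) \<le> (\<Sum>z\<in>(\<lambda>(i, v). p ^ i * v) ` ({..<K} \<times> w ` A). 1 / (cmod z)\<^sup>2)"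
    using sub fin by (intro sum_mono2) auto
  \<comment> \<open>Different pairs may have the same product; as the terms are nonnegative,
    counting such a product repeatedly only enlarges the sum.\<close>
  also have "\<dots> \<le> (\<Sum>(i, v)\<in>{..<K} \<times> w ` A. 1 / (cmod (p ^ i * v))\<^sup>2)"
    using sum_image_le[OF fin, of "\<lambda>z. 1 / (cmod z)\<^sup>2" "\<lambda>(i, v). p ^ i * v"]
    by (auto simp: o_def case_prod_unfold)
  also have "\<dots> = (\<Sum>(i, v)\<in>{..<K} \<times> w ` A. r ^ i * (1 / (cmod v)\<^sup>2))"
    unfolding r_def by (intro sum.cong)
      (auto simp: norm_mult norm_power power_mult_distrib power_one_over power_mult[symmetric] mult.commute)
  also have "\<dots> = (\<Sum>i<K. r ^ i) * (\<Sum>v\<in>w ` A. 1 / (cmod v)\<^sup>2)"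
    by (simp add: sum_product sum.cartesian_product)
  also have "\<dots> \<le> exp (2 * r) * (4 * exp (2 * (\<Sum>p\<in>P. 1 / (cmod p)\<^sup>2)))"
  proof (intro mult_mono)
    have "(\<Sum>i<K. r ^ i) = (1 - r ^ K) / (1 - r)" using r by (simp add: sum_gp_strict)
    also have "\<dots> \<le> 1 / (1 - r)" using r by (simp add: divide_right_mono)
    also have "\<dots> \<le> 1 + 2 * r"
    proof -
      have "1 \<le> (1 + 2 * r) * (1 - r)"
        using mult_nonneg_nonneg[of r "1 - 2 * r"] r by (simp add: algebra_simps)
      then show ?thesis using r by (simp add: field_simps)
    qed
    also have "\<dots> \<le> exp (2 * r)" by (rule exp_ge_add_one_self)
    finally show "(\<Sum>i<K. r ^ i) \<le> exp (2 * r)" .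
    show "(\<Sum>v\<in>w ` A. 1 / (cmod v)\<^sup>2) \<le> 4 * exp (2 * (\<Sum>p\<in>P. 1 / (cmod p)\<^sup>2))"
      using insert.prems kw by (intro insert.IH) auto
  qed (auto intro: sum_nonneg)
  also have "\<dots> = 4 * exp (2 * (\<Sum>p\<in>insert p P. 1 / (cmod p)\<^sup>2))"
    using insert by (simp add: r_def exp_add algebra_simps)
  finally show ?case .
qed

text \<open>In the triangle \<open>0 \<le> b \<le> a\<close>, the row with real part
  \<open>a + 1\<close> has \<open>a + 1\<close> points, each contributing at least
  \<open>1 / (2 * (a + 1) ^ 2)\<close>. The row sums dominate half the harmonic series.\<close>

lemma gaussian_reciprocal_diverges:
  "\<exists>A. finite A \<and> A \<subseteq> gaussian_ints - {0} \<and> (\<Sum>z\<in>A. 1 / (cmod z)\<^sup>2) > B"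
proof -
  obtain n where n: "(\<Sum>k\<le>n. 1 / real (Suc k)) > 2 * B"
  proof (rule ccontr)
    assume "\<not> thesis"
    with that have "\<And>n. (\<Sum>k\<le>n. 1 / real (Suc k)) \<le> 2 * B" by (meson not_le)
    then have "summable (\<lambda>k. 1 / real (Suc k))"
      by (intro bounded_imp_summable[where B = "2 * B"]) auto
    then show False using summable_Suc_iff[of "\<lambda>k. 1 / real k"] not_summable_harmonic[where 'a = real]
      by (simp add: inverse_eq_divide)
  qed
  define S where "S = (SIGMA a:{..n}. {..a})"
  define A where "A = (\<lambda>(a, b). Complex (real (Suc a)) (real b)) ` S"
  have inj: "inj_on (\<lambda>(a, b). Complex (real (Suc a)) (real b)) S" by (auto simp: inj_on_def)
  have "(\<Sum>z\<in>A. 1 / (cmod z)\<^sup>2) = (\<Sum>(a, b)\<in>S. 1 / ((real (Suc a))\<^sup>2 + (real b)\<^sup>2))"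
    unfolding A_def by (subst sum.reindex[OF inj]) (auto simp: cmod_power2 case_prod_unfold)
  also have "\<dots> = (\<Sum>a\<le>n. \<Sum>b\<le>a. 1 / ((real (Suc a))\<^sup>2 + (real b)\<^sup>2))"
    unfolding S_def by (simp add: sum.Sigma)
  also have "\<dots> \<ge> (\<Sum>a\<le>n. \<Sum>b\<le>a. 1 / (2 * (real (Suc a))\<^sup>2))"
  proof (intro sum_mono divide_left_mono)
    fix a b :: nat assume "b \<in> {..a}"
    then have "(real b)\<^sup>2 \<le> (real (Suc a))\<^sup>2" by (intro power_mono) auto
    then show "(real (Suc a))\<^sup>2 + (real b)\<^sup>2 \<le> 2 * (real (Suc a))\<^sup>2" by simp
  qed (auto intro!: mult_pos_pos add_pos_nonneg)
  also have "(\<Sum>a\<le>n. \<Sum>b\<le>a. 1 / (2 * (real (Suc a))\<^sup>2)) = (\<Sum>a\<le>n. 1 / real (Suc a)) / 2"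
    unfolding sum_divide_distrib
  proof (intro sum.cong refl)
    fix a assume "a \<in> {..n}"
    have "real (Suc a) \<noteq> 0" by simp
    then show "(\<Sum>b\<le>a. 1 / (2 * (real (Suc a))\<^sup>2)) = 1 / real (Suc a) / 2"
      by (simp add: power2_eq_square divide_simps del: of_nat_Suc)
  qed
  finally have "(\<Sum>z\<in>A. 1 / (cmod z)\<^sup>2) > B" using n by simp
  moreover have "finite A" unfolding A_def S_def by auto
  moreover have "A \<subseteq> gaussian_ints - {0}"
    by (auto simp: A_def gaussian_ints_def complex_eq_iff)
  ultimately show ?thesis by blast
qed

text \<open>The half-open dyadic shell makes different indices disjoint and lets one member divide
  another only if they are associates. All associates are kept.\<close>

definition gprimes :: "nat \<Rightarrow> complex set" where
  "gprimes j = {q. girred q \<and> 2 ^ j < gnorm q \<and> gnorm q \<le> 2 * 2 ^ j}"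

lemma finite_gprimes: "finite (gprimes j)"
  by (rule finite_subset[OF _ finite_gnorm_le[of "2 * 2 ^ j"]]) (auto simp: gprimes_def girred_def)

text \<open>Otherwise the sum of \<open>1 / N p\<close> over the Gaussian primes would converge, contradicting Euler's product.\<close>
lemma many_gprimes:
  "\<exists>j\<ge>j0. 2 ^ j / (real (Suc j))\<^sup>2 \<le> real (card (gprimes j))"
proof (rule ccontr)
  assume "\<not> ?thesis"
  then have few: "real (card (gprimes j)) < 2 ^ j / (real (Suc j))\<^sup>2" if "j \<ge> j0" for j
    using that by (meson not_le)
  define P0 where "P0 = {z \<in> gaussian_ints. gnorm z \<le> 2 ^ j0}"
  define B where "B = (\<Sum>p\<in>P0. 1 / (cmod p)\<^sup>2) + (\<Sum>j. 1 / (real (Suc j))\<^sup>2)"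
  have finP0: "finite P0" unfolding P0_def by (rule finite_gnorm_le)
  have summ: "summable (\<lambda>j. 1 / (real (Suc j))\<^sup>2)"
    using inverse_squares_sums by (auto simp: sums_iff add.commute)
  \<comment> \<open>Each member contributes at most \<open>1 / 2 ^ j\<close>, so the negated claim
    bounds a whole shell by a term of a convergent series. This is why the loss
    \<open>(j + 1) ^ 2\<close> in the count is affordable.\<close>
  have shell: "(\<Sum>p\<in>gprimes j. 1 / (cmod p)\<^sup>2) \<le> 1 / (real (Suc j))\<^sup>2" if "j \<ge> j0" for j
  proof -
    have "(\<Sum>p\<in>gprimes j. 1 / (cmod p)\<^sup>2) \<le> (\<Sum>p\<in>gprimes j. 1 / 2 ^ j)"
    proof (intro sum_mono divide_left_mono)
      fix p assume "p \<in> gprimes j"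
      then have p: "p \<in> gaussian_ints" "2 ^ j < gnorm p" by (auto simp: gprimes_def girred_def)
      have "real (2 ^ j) \<le> real (gnorm p)" using p by (simp only: of_nat_le_iff less_imp_le)
      then show *: "2 ^ j \<le> (cmod p)\<^sup>2" using of_nat_gnorm[OF p(1)] by simp
      have "(0::real) < 2 ^ j" by simp
      with * have "0 < (cmod p)\<^sup>2" by linarith
      then show "0 < (cmod p)\<^sup>2 * 2 ^ j" by simp
    qed auto
    also have "\<dots> = real (card (gprimes j)) / 2 ^ j" by simp
    also have "\<dots> \<le> (2 ^ j / (real (Suc j))\<^sup>2) / 2 ^ j"
      using few[OF that] by (intro divide_right_mono) auto
    finally show ?thesis by simp
  qed
  have disj: "gprimes i \<inter> gprimes j = {}" if "i \<noteq> j" for i j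
  proof -
    have "gprimes i \<inter> gprimes j = {}" if "i < j" for i j
    proof -
      have "(2::nat) ^ Suc i \<le> 2 ^ j" using that by (intro power_increasing) auto
      then show ?thesis unfolding gprimes_def by auto
    qed
    from this[of i j] this[of j i] that show ?thesis by (metis inf_commute nat_neq_iff)
  qed
  have bound: "(\<Sum>p | girred p \<and> gnorm p \<le> 2 ^ J. 1 / (cmod p)\<^sup>2) \<le> B" for J
  proof -
    have "{p. girred p \<and> gnorm p \<le> 2 ^ J} \<subseteq> P0 \<union> (\<Union>j\<in>{j0..<J}. gprimes j)"
    proof
      fix p assume "p \<in> {p. girred p \<and> gnorm p \<le> 2 ^ J}"
      then have p: "girred p" "gnorm p \<le> 2 ^ J" by auto
      have "p \<in> P0 \<union> (\<Union>j\<in>{j0..<J}. gprimes j)" using p(2)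
      proof (induction J)
        case 0
        then have "gnorm p \<le> 2 ^ j0" using one_le_power[of 2 j0] by (metis numeral_One order_trans one_le_numeral power_0)
        then show ?case using p by (auto simp: P0_def girred_def)
      next
        case (Suc J)
        show ?case
        proof (cases "gnorm p \<le> 2 ^ J \<or> J < j0")
          case True
          then show ?thesis
          proof
            assume "gnorm p \<le> 2 ^ J"
            with Suc.IH show ?thesis by fastforce
          next
            assume "J < j0"
            then have "(2::nat) ^ Suc J \<le> 2 ^ j0" by (intro power_increasing) auto
            then have "gnorm p \<le> 2 ^ j0" using Suc.prems by linarith
            then show ?thesis using p by (auto simp: P0_def girred_def)
          qed
        next
          case False
          then have "p \<in> gprimes J" using p Suc by (auto simp: gprimes_def)
          then show ?thesis using False by (intro UnI2 UN_I[of J]) auto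
        qed
      qed
      then show "p \<in> P0 \<union> (\<Union>j\<in>{j0..<J}. gprimes j)" .
    qed
    then have "(\<Sum>p | girred p \<and> gnorm p \<le> 2 ^ J. 1 / (cmod p)\<^sup>2) \<le>
        (\<Sum>p\<in>P0 \<union> (\<Union>j\<in>{j0..<J}. gprimes j). 1 / (cmod p)\<^sup>2)"
      using finP0 finite_gprimes by (intro sum_mono2) auto
    also have "\<dots> \<le> (\<Sum>p\<in>P0. 1 / (cmod p)\<^sup>2) + (\<Sum>p\<in>(\<Union>j\<in>{j0..<J}. gprimes j). 1 / (cmod p)\<^sup>2)"
      using finP0 finite_gprimes by (subst sum_Un) (auto intro!: sum_nonneg)
    also have "(\<Sum>p\<in>(\<Union>j\<in>{j0..<J}. gprimes j). 1 / (cmod p)\<^sup>2) \<le> (\<Sum>j\<in>{j0..<J}. \<Sum>p\<in>gprimes j. 1 / (cmod p)\<^sup>2)"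
      using finite_gprimes disj by (subst sum.UNION_disjoint) auto
    also have "\<dots> \<le> (\<Sum>j\<in>{j0..<J}. 1 / (real (Suc j))\<^sup>2)"
      by (intro sum_mono shell) auto
    also have "\<dots> \<le> (\<Sum>j. 1 / (real (Suc j))\<^sup>2)"
      by (intro sum_le_suminf summ) auto
    finally show ?thesis unfolding B_def by simp
  qed
  obtain A where A: "finite A" "A \<subseteq> gaussian_ints - {0}" "(\<Sum>z\<in>A. 1 / (cmod z)\<^sup>2) > 4 * exp (2 * B)"
    using gaussian_reciprocal_diverges by blast
  \<comment> \<open>Every norm occurring in \<open>A\<close> is below \<open>2 ^ J\<close>, so the
    factorizations of all members of \<open>A\<close> use only primes covered by
    \<open>bound\<close>.\<close>
  define J where "J = Max (gnorm ` A \<union> {0})"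
  have "gnorm z \<le> 2 ^ J" if "z \<in> A" for z
  proof -
    have "gnorm z \<le> J" unfolding J_def using that A by (intro Max_ge) auto
    also have "J < 2 ^ J" by (rule less_exp)
    finally show ?thesis by simp
  qed
  then have sub: "A \<subseteq> gmonoid {p. girred p \<and> gnorm p \<le> 2 ^ J}"
    using gaussian_factorization A by auto
  have "(\<Sum>z\<in>A. 1 / (cmod z)\<^sup>2) \<le> 4 * exp (2 * (\<Sum>p | girred p \<and> gnorm p \<le> 2 ^ J. 1 / (cmod p)\<^sup>2))"
  proof (intro euler_product_bound sub A)
    show "finite {p. girred p \<and> gnorm p \<le> 2 ^ J}"
      by (rule finite_subset[OF _ finite_gnorm_le[of "2 ^ J"]]) (auto simp: girred_def)
    fix p assume "p \<in> {p. girred p \<and> gnorm p \<le> 2 ^ J}"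
    then have "p \<in> gaussian_ints" "gnorm p \<ge> 2" by (auto simp: girred_def)
    then show "2 \<le> (cmod p)\<^sup>2" using of_nat_gnorm[of p] by (metis numeral_le_real_of_nat_iff)
  qed
  also have "\<dots> \<le> 4 * exp (2 * B)" using bound by simp
  finally show False using A(3) by simp
qed

subsection \<open>Positive periodic kernels\<close>

lemma integral_prod_mult:
  fixes f :: "'a \<Rightarrow> complex" and g :: "'b \<Rightarrow> complex"
  assumes "prob_space M" "prob_space N"
    and [measurable]: "f \<in> borel_measurable M" "g \<in> borel_measurable N"
    and bounded: "\<And>x. cmod (f x) \<le> A" "\<And>y. cmod (g y) \<le> B"
  shows "(\<integral>z. f (fst z) * g (snd z) \<partial>(M \<Otimes>\<^sub>M N)) = (\<integral>x. f x \<partial>M) * (\<integral>y. g y \<partial>N)"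
proof -
  interpret M: prob_space M by fact
  interpret N: prob_space N by fact
  interpret P: pair_prob_space M N by unfold_locales
  have "integrable (M \<Otimes>\<^sub>M N) (\<lambda>z. f (fst z) * g (snd z))"
  proof (rule P.integrable_const_bound[where B = "A * B"])
    show "AE z in M \<Otimes>\<^sub>M N. cmod (f (fst z) * g (snd z)) \<le> A * B"
      using bounded by (auto simp: norm_mult intro!: mult_mono order.trans[OF norm_ge_zero])
  qed auto
  then have "(\<integral>z. f (fst z) * g (snd z) \<partial>(M \<Otimes>\<^sub>M N)) = (\<integral>x. \<integral>y. f x * g y \<partial>N \<partial>M)"
    using P.integral_fst'[of "\<lambda>z. f (fst z) * g (snd z)"] by simp
  also have "\<dots> = (\<integral>x. f x \<partial>M) * (\<integral>y. g y \<partial>N)" by simp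
  finally show ?thesis .
qed

lemma uniform_law:
  assumes a: "a > 0"
  shows "\<exists>\<nu>. real_distribution \<nu> \<and> (AE x in \<nu>. \<bar>x\<bar> \<le> a) \<and> (\<forall>t. char \<nu> t = complex_of_real (sinc (a * t)))"
proof -
  define \<nu> where "\<nu> = uniform_measure lborel {-a..a}"
  have em: "emeasure lborel {-a..a} = ennreal (2 * a)" using a by simp
  have "prob_space \<nu>" unfolding \<nu>_def by (rule prob_space_uniform_measure) (use a em in auto)
  moreover have "sets \<nu> = sets borel" by (simp add: \<nu>_def)
  ultimately have rd: "real_distribution \<nu>"
    by (intro real_distribution.intro) (auto simp: real_distribution_axioms_def \<nu>_def)
  have "AE x in \<nu>. x \<in> {-a..a}" unfolding \<nu>_def by (rule AE_uniform_measureI) auto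
  then have ae: "AE x in \<nu>. \<bar>x\<bar> \<le> a" by eventually_elim auto
  have "char \<nu> t = complex_of_real (sinc (a * t))" for t
  proof (cases "t = 0")
    case True
    then show ?thesis using real_distribution.char_zero[OF rd] by simp
  next
    case False
    have dens: "\<nu> = density lborel (\<lambda>x. ennreal (indicator {-a..a} x / (2 * a)))"
      unfolding \<nu>_def uniform_measure_def em using a
      by (intro density_cong) (auto simp: divide_ennreal[symmetric] ennreal_indicator)
    have "char \<nu> t = (\<integral>x. (indicator {-a..a} x / (2 * a)) *\<^sub>R iexp (t * x) \<partial>lborel)"
      unfolding char_def dens using a by (subst integral_density) auto
    also have "\<dots> = (\<integral>x. (1 / (2 * a)) *\<^sub>R (indicator {-a..a} x *\<^sub>R iexp (t * x)) \<partial>lborel)"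
      by (intro Bochner_Integration.integral_cong) auto
    also have "\<dots> = (1 / (2 * a)) *\<^sub>R (\<integral>x. indicator {-a..a} x *\<^sub>R iexp (t * x) \<partial>lborel)"
      by (rule integral_scaleR_right)
    also have "(\<integral>x. indicator {-a..a} x *\<^sub>R iexp (t * x) \<partial>lborel) = iexp (t * a) / (\<i> * t) - iexp (t * (-a)) / (\<i> * t)"
    proof (rule integral_FTC_atLeastAtMost)
      show "-a \<le> a" using a by simp
      show "continuous_on {-a..a} (\<lambda>x. iexp (t * x))" by (intro continuous_intros)
      show "((\<lambda>x. iexp (t * x) / (\<i> * t)) has_vector_derivative iexp (t * x)) (at x within {-a..a})"
        if "-a \<le> x" "x \<le> a" for x
      proof -
        have "((\<lambda>z. exp (\<i> * (t * z)) / (\<i> * t)) has_field_derivative exp (\<i> * (t * of_real x))) (at (of_real x))"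
          using False by (auto intro!: derivative_eq_intros simp: mult_ac)
        from has_vector_derivative_real_field[OF this] show ?thesis by simp
      qed
    qed
    also have "\<dots> = 2 * complex_of_real (sin (a * t)) / t"
    proof -
      have "iexp (t * a) - iexp (t * (-a)) = cis (t * a) - cis (- (t * a))"
        by (simp add: cis_conv_exp)
      also have "\<dots> = \<i> * (2 * complex_of_real (sin (a * t)))" by (simp add: complex_eq_iff mult.commute)
      finally have "iexp (t * a) / (\<i> * t) - iexp (t * (-a)) / (\<i> * t) = \<i> * (2 * complex_of_real (sin (a * t))) / (\<i> * t)"
        by (simp only: diff_divide_distrib[symmetric])
      then show ?thesis by simp
    qed
    also have "(1 / (2 * a)) *\<^sub>R \<dots> = complex_of_real (sinc (a * t))"
      using False a by (simp add: scaleR_conv_of_real field_simps)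
    finally show ?thesis .
  qed
  with rd ae show ?thesis by blast
qed

text \<open>The law of a sum of \<open>n\<close> independent uniform variables on
  \<open>[-a, a]\<close>: independence turns the characteristic function into an \<open>n\<close>-th
  power, giving decay of order \<open>n\<close>.\<close>

lemma uniform_sum_law:
  assumes a: "a > 0"
  shows "\<exists>\<nu>. real_distribution \<nu> \<and> (AE x in \<nu>. \<bar>x\<bar> \<le> real n * a) \<and>
     (\<forall>t. char \<nu> t = complex_of_real (sinc (a * t) ^ n))"
proof (induction n)
  case 0
  have "real_distribution (return borel (0::real))"
    by (intro real_distribution.intro prob_space_return) (auto simp: real_distribution_axioms_def)
  then show ?case
    by (intro exI[of _ "return borel 0"]) (auto simp: char_def integral_return AE_return)
next
  case (Suc n)
  then obtain \<nu> where \<nu>: "real_distribution \<nu>" "AE x in \<nu>. \<bar>x\<bar> \<le> real n * a"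
    "\<And>t. char \<nu> t = complex_of_real (sinc (a * t) ^ n)" by blast
  obtain U where U: "real_distribution U" "AE x in U. \<bar>x\<bar> \<le> a"
    "\<And>t. char U t = complex_of_real (sinc (a * t))" using uniform_law[OF a] by blast
  interpret \<nu>: real_distribution \<nu> by fact
  interpret U: real_distribution U by fact
  interpret P: pair_prob_space \<nu> U by unfold_locales
  define V where "V = distr (\<nu> \<Otimes>\<^sub>M U) borel (\<lambda>z. fst z + snd z)"
  have m[measurable]: "(\<lambda>z. fst z + snd z) \<in> borel_measurable (\<nu> \<Otimes>\<^sub>M U)" by measurable
  have "prob_space V" unfolding V_def by (rule P.prob_space_distr) measurable
  then have rd: "real_distribution V"
    by (intro real_distribution.intro) (auto simp: real_distribution_axioms_def V_def)
  have "AE x in \<nu>. AE y in U. \<bar>x + y\<bar> \<le> real (Suc n) * a"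
    using \<nu>(2)
  proof eventually_elim
    fix x assume "\<bar>x\<bar> \<le> real n * a"
    then show "AE y in U. \<bar>x + y\<bar> \<le> real (Suc n) * a"
      using U(2) by (auto simp: algebra_simps elim!: eventually_mono)
  qed
  then have "AE z in \<nu> \<Otimes>\<^sub>M U. \<bar>fst z + snd z\<bar> \<le> real (Suc n) * a"
  proof (intro P.AE_pair_measure)
    have "{z \<in> space (\<nu> \<Otimes>\<^sub>M U). \<bar>fst z + snd z\<bar> \<le> real (Suc n) * a} =
        (\<lambda>z. fst z + snd z) -` {- (real (Suc n) * a)..real (Suc n) * a} \<inter> space (\<nu> \<Otimes>\<^sub>M U)"
      by (auto simp: abs_le_iff)
    also have "\<dots> \<in> sets (\<nu> \<Otimes>\<^sub>M U)" by (rule measurable_sets[OF m]) simp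
    finally show "{z \<in> space (\<nu> \<Otimes>\<^sub>M U). \<bar>fst z + snd z\<bar> \<le> real (Suc n) * a} \<in> sets (\<nu> \<Otimes>\<^sub>M U)" .
  qed simp
  then have ae: "AE x in V. \<bar>x\<bar> \<le> real (Suc n) * a"
    unfolding V_def by (subst AE_distr_iff) auto
  have "char V t = complex_of_real (sinc (a * t) ^ Suc n)" for t
  proof -
    have "char V t = (\<integral>z. iexp (t * (fst z + snd z)) \<partial>(\<nu> \<Otimes>\<^sub>M U))"
      unfolding char_def V_def by (subst integral_distr) auto
    also have "\<dots> = (\<integral>z. iexp (t * fst z) * iexp (t * snd z) \<partial>(\<nu> \<Otimes>\<^sub>M U))"
      by (simp add: field_simps exp_add)
    also have "\<dots> = char \<nu> t * char U t"
      unfolding char_def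
      by (rule integral_prod_mult[where A = 1 and B = 1, OF \<nu>.prob_space_axioms U.prob_space_axioms]) simp_all
    finally show ?thesis by (simp add: \<nu>(3) U(3) mult.commute)
  qed
  with rd ae show ?case by blast
qed

lemma abs_sinc_le: "\<bar>sinc y\<bar> \<le> 2 / (1 + \<bar>y\<bar>)"
proof (cases "y = 0")
  case False
  have "\<bar>sin y\<bar> \<le> \<bar>y\<bar>" "\<bar>sin y\<bar> \<le> 1" by (auto simp: abs_sin_x_le_abs_x)
  then have "\<bar>sin y\<bar> * (1 + \<bar>y\<bar>) \<le> 2 * \<bar>y\<bar>"
    using mult_right_mono[of "\<bar>sin y\<bar>" 1 "\<bar>y\<bar>"] by (simp add: algebra_simps)
  then have "\<bar>sin y\<bar> \<le> 2 * \<bar>y\<bar> / (1 + \<bar>y\<bar>)"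
    by (subst pos_le_divide_eq) auto
  then have "\<bar>sin y\<bar> / \<bar>y\<bar> \<le> 2 * \<bar>y\<bar> / (1 + \<bar>y\<bar>) / \<bar>y\<bar>"
    by (rule divide_right_mono) simp
  then show ?thesis using False by simp
qed auto

lemma smooth_law:
  assumes \<delta>: "\<delta> > 0" and n: "n > 0"
  shows "\<exists>\<nu> \<phi>. real_distribution \<nu> \<and> (AE x in \<nu>. \<bar>x\<bar> \<le> \<delta>) \<and> (\<forall>t. char \<nu> t = complex_of_real (\<phi> t)) \<and>
    (\<forall>t. \<bar>\<phi> t\<bar> \<le> (2 * real n / (1 + \<delta> * \<bar>t\<bar>)) ^ n)"
proof -
  \<comment> \<open>Each of the \<open>n\<close> summands gets width \<open>\<delta> / n\<close>, so
    that their sum stays within \<open>\<delta>\<close>.\<close>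
  define a where "a = \<delta> / n"
  have a: "a > 0" using \<delta> n by (simp add: a_def)
  obtain \<nu> where \<nu>: "real_distribution \<nu>" "AE x in \<nu>. \<bar>x\<bar> \<le> real n * a"
    "\<forall>t. char \<nu> t = complex_of_real (sinc (a * t) ^ n)" using uniform_sum_law[OF a] by blast
  have na: "real n * a = \<delta>" using n by (simp add: a_def)
  have "\<bar>sinc (a * t) ^ n\<bar> \<le> (2 * real n / (1 + \<delta> * \<bar>t\<bar>)) ^ n" for t
  proof -
    have "\<bar>sinc (a * t) ^ n\<bar> = \<bar>sinc (a * t)\<bar> ^ n" by (rule power_abs)
    also have "\<dots> \<le> (2 * real n / (1 + \<delta> * \<bar>t\<bar>)) ^ n"
    proof (rule power_mono)
      have "1 + \<delta> * \<bar>t\<bar> \<le> real n * (1 + \<bar>a * t\<bar>)"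
        using n a na[symmetric] by (simp add: abs_mult algebra_simps)
      then have "2 / (1 + \<bar>a * t\<bar>) \<le> 2 * real n / (1 + \<delta> * \<bar>t\<bar>)"
        using \<delta> by (simp add: divide_simps add_pos_nonneg)
      then show "\<bar>sinc (a * t)\<bar> \<le> 2 * real n / (1 + \<delta> * \<bar>t\<bar>)" using abs_sinc_le order_trans by blast
    qed simp
    finally show ?thesis .
  qed
  with \<nu> na show ?thesis by (intro exI[of _ \<nu>] exI[of _ "\<lambda>t. sinc (a * t) ^ n"]) auto
qed

text \<open>Real part of the geometric series \<open>z / (1 - z)\<close> at
  \<open>z = r * cis x\<close>. Doubling and adding 1 gives the Poisson kernel.\<close>

lemma poisson_kernel_sums:
  assumes "0 \<le> r" "r < 1"
  shows "(\<lambda>n. r ^ Suc n * cos (real (Suc n) * x)) sums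
           (((1 - r\<^sup>2) / (1 - 2 * r * cos x + r\<^sup>2) - 1) / 2)"
proof -
  define z where "z = complex_of_real r * cis x"
  have nz: "cmod z < 1" using assms by (simp add: z_def norm_mult)
  have "(\<lambda>n. z * z ^ n) sums (z * (1 / (1 - z)))"
    by (intro sums_mult geometric_sums nz)
  then have "(\<lambda>n. Re (z * z ^ n)) sums Re (z * (1 / (1 - z)))" by (rule sums_Re)
  moreover have "Re (z * z ^ n) = r ^ Suc n * cos (real (Suc n) * x)" for n
  proof -
    have "z * z ^ n = z ^ Suc n" by simp
    also have "\<dots> = complex_of_real (r ^ Suc n) * cis x ^ Suc n"
      by (simp only: z_def power_mult_distrib of_real_power)
    also have "cis x ^ Suc n = cis (real (Suc n) * x)" by (rule Complex.DeMoivre)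
    finally have "z * z ^ n = complex_of_real (r ^ Suc n) * cis (real (Suc n) * x)" .
    then show ?thesis by simp
  qed
  moreover have "Re (z * (1 / (1 - z))) = ((1 - r\<^sup>2) / (1 - 2 * r * cos x + r\<^sup>2) - 1) / 2"
  proof -
    have den: "(1 - r * cos x)\<^sup>2 + (r * sin x)\<^sup>2 = 1 - 2 * r * cos x + r\<^sup>2"
      using sin_cos_squared_add[of x] by (simp add: power_mult_distrib power2_diff algebra_simps flip: distrib_left)
    have pos: "1 - 2 * r * cos x + r\<^sup>2 \<noteq> 0"
    proof
      assume "1 - 2 * r * cos x + r\<^sup>2 = 0"
      then have "1 - r * cos x = 0" using den by (metis sum_power2_eq_zero_iff)
      moreover have "r * cos x \<le> r" using assms by (simp add: mult_left_le)
      ultimately show False using assms by linarith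
    qed
    have "Re (z * (1 / (1 - z))) = (r * cos x * (1 - r * cos x) - r * sin x * (r * sin x)) / ((1 - r * cos x)\<^sup>2 + (r * sin x)\<^sup>2)"
      by (simp add: z_def Re_divide power2_eq_square algebra_simps)
    also have "r * cos x * (1 - r * cos x) - r * sin x * (r * sin x) = r * cos x - r\<^sup>2"
      using sin_cos_squared_add[of x] by (simp add: power2_eq_square algebra_simps flip: distrib_left)
    finally have a: "Re (z * (1 / (1 - z))) = (r * cos x - r\<^sup>2) / (1 - 2 * r * cos x + r\<^sup>2)"
      unfolding den .
    have b: "(1 - r\<^sup>2) / (1 - 2 * r * cos x + r\<^sup>2) - 1 = 2 * ((r * cos x - r\<^sup>2) / (1 - 2 * r * cos x + r\<^sup>2))"
      unfolding times_divide_eq_right divide_diff_eq_iff[OF pos]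
      by (rule arg_cong2[where f = "(/)"]) (simp_all add: algebra_simps)
    show ?thesis unfolding a b by (rule nonzero_mult_div_cancel_left[symmetric]) simp
  qed
  ultimately show ?thesis by (simp only:)
qed

text \<open>A real value of the characteristic function makes the sine moment vanish, so averaging
  over shifts just multiplies the cosine by \<open>p\<close>.\<close>

lemma integral_cos_shift:
  assumes \<nu>: "real_distribution \<nu>" and char: "char \<nu> t = complex_of_real p"
  shows "(\<integral>s. cos (t * (x - s)) \<partial>\<nu>) = p * cos (t * x)"
proof -
  interpret real_distribution \<nu> by fact
  have i: "integrable \<nu> (\<lambda>s. iexp (t * s))" by (intro integrable_iexp) auto
  have ic: "integrable \<nu> (\<lambda>s. cos (t * s))" and isn: "integrable \<nu> (\<lambda>s. sin (t * s))"
    using integrable_Re[OF i] integrable_Im[OF i] by (simp_all add: Re_exp Im_exp)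
  have c: "(\<integral>s. cos (t * s) \<partial>\<nu>) = p"
    using integral_Re[OF i] char by (simp add: char_def Re_exp)
  have s: "(\<integral>s. sin (t * s) \<partial>\<nu>) = 0"
    using integral_Im[OF i] char by (simp add: char_def Im_exp)
  have "(\<integral>s. cos (t * (x - s)) \<partial>\<nu>) = (\<integral>s. cos (t * x) * cos (t * s) + sin (t * x) * sin (t * s) \<partial>\<nu>)"
    by (simp add: right_diff_distrib cos_diff)
  also have "\<dots> = cos (t * x) * p + sin (t * x) * 0"
    using ic isn c s by (subst Bochner_Integration.integral_add) auto
  finally show ?thesis by simp
qed

text \<open>The Abel means of the Fourier series of \<open>\<nu>\<close> are averages of the Poisson kernel, which is positive
  and concentrates at the integers; no Fourier inversion is needed.\<close>
lemma periodization_nonneg_support: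
  fixes \<phi> :: "real \<Rightarrow> real"
  assumes \<nu>: "real_distribution \<nu>" and supp: "AE s in \<nu>. \<bar>s\<bar> \<le> \<delta>"
    and char: "\<And>t. char \<nu> t = complex_of_real (\<phi> t)"
    and summ: "summable (\<lambda>n. \<bar>\<phi> (2 * pi * real (Suc n))\<bar>)"
  defines "S \<equiv> \<lambda>t. 1 + 2 * (\<Sum>n. \<phi> (2 * pi * real (Suc n)) * cos (2 * pi * real (Suc n) * t))"
  shows "S t \<ge> 0" and "(\<And>k::int. \<bar>t - of_int k\<bar> > \<delta>) \<Longrightarrow> S t = 0"
proof -
  interpret real_distribution \<nu> by fact
  define b where "b n = \<phi> (2 * pi * real (Suc n)) * cos (2 * pi * real (Suc n) * t)" for n
  have bb: "\<bar>b n\<bar> \<le> \<bar>\<phi> (2 * pi * real (Suc n))\<bar>" for n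
    by (simp add: b_def abs_mult mult_left_le)
  define P where "P r x = (1 - r\<^sup>2) / (1 - 2 * r * cos x + r\<^sup>2)" for r x :: real
  have Pn: "P r x \<ge> 0" if "0 \<le> r" "r < 1" for r x
  proof -
    have "r\<^sup>2 \<le> 1" using that by (simp add: power_le_one)
    moreover have "2 * r * cos x \<le> 2 * r * 1" using that by (intro mult_left_mono) auto
    then have "1 - 2 * r * cos x + r\<^sup>2 \<ge> (1 - r)\<^sup>2" by (simp add: power2_diff)
    then have "1 - 2 * r * cos x + r\<^sup>2 \<ge> 0" using zero_le_power2[of "1 - r"] by linarith
    ultimately show ?thesis unfolding P_def by simp
  qed
  \<comment> \<open>For \<open>r < 1\<close> the geometric factor permits exchanging sum and
    integral, and the Poisson kernel appears under the integral.\<close>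
  have abel: "1 + 2 * (\<Sum>n. r ^ Suc n * b n) = (\<integral>s. P r (2 * pi * (t - s)) \<partial>\<nu>)" if r: "0 \<le> r" "r < 1" for r
  proof -
    define f where "f n s = r ^ Suc n * cos (2 * pi * real (Suc n) * (t - s))" for n s
    have fint: "integrable \<nu> (f n)" for n
      unfolding f_def by (rule integrable_const_bound[where B = "r ^ Suc n"]) (use r in \<open>auto simp: abs_mult mult_left_le\<close>)
    have fb: "\<bar>f n s\<bar> \<le> r ^ Suc n" for n s using r by (auto simp: f_def abs_mult mult_left_le)
    have geo: "summable (\<lambda>n. r ^ Suc n)" using r by (subst summable_Suc_iff) (auto intro: summable_geometric)
    have "(\<integral>s. \<bar>f n s\<bar> \<partial>\<nu>) \<le> r ^ Suc n" for n
      using integral_le_const[of "\<lambda>s. \<bar>f n s\<bar>" "r ^ Suc n"] fint[of n] fb by auto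
    then have sm: "summable (\<lambda>n. \<integral>s. norm (f n s) \<partial>\<nu>)"
      by (intro summable_comparison_test[OF _ geo]) auto
    have "f n s = r ^ Suc n * cos (real (Suc n) * (2 * pi * (t - s)))" for n s
      unfolding f_def by (simp only: mult_ac)
    then have fs: "(\<lambda>n. f n s) sums ((P r (2 * pi * (t - s)) - 1) / 2)" for s
      using poisson_kernel_sums[OF r, of "2 * pi * (t - s)"] by (simp only: P_def)
    have fsum: "(\<Sum>n. f n s) = (P r (2 * pi * (t - s)) - 1) / 2" for s
      using fs sums_unique by metis
    have "(\<Sum>n. r ^ Suc n * b n) = (\<Sum>n. \<integral>s. f n s \<partial>\<nu>)"
      using integral_cos_shift[OF \<nu> char] by (simp add: f_def b_def)
    also have "\<dots> = (\<integral>s. (\<Sum>n. f n s) \<partial>\<nu>)"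
    proof (rule integral_suminf[symmetric, OF fint _ sm])
      show "AE s in \<nu>. summable (\<lambda>n. norm (f n s))"
        using fb by (intro AE_I2 summable_comparison_test[OF _ geo]) auto
    qed
    also have "\<dots> = (\<integral>s. (P r (2 * pi * (t - s)) - 1) / 2 \<partial>\<nu>)" by (simp add: fsum)
    finally have eq: "(\<Sum>n. r ^ Suc n * b n) = (\<integral>s. (P r (2 * pi * (t - s)) - 1) / 2 \<partial>\<nu>)" .
    have "integrable \<nu> (\<lambda>s. \<Sum>n. f n s)"
      by (rule integrable_suminf[OF fint _ sm]) (use fb in \<open>intro AE_I2 summable_comparison_test[OF _ geo], auto\<close>)
    then have "integrable \<nu> (\<lambda>s. 1 + 2 * ((P r (2 * pi * (t - s)) - 1) / 2))"
      unfolding fsum by (intro Bochner_Integration.integrable_add integrable_mult_right) auto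
    then have "integrable \<nu> (\<lambda>s. P r (2 * pi * (t - s)))" by (simp add: field_simps)
    then have "(\<integral>s. (P r (2 * pi * (t - s)) - 1) / 2 \<partial>\<nu>) = ((\<integral>s. P r (2 * pi * (t - s)) \<partial>\<nu>) - 1) / 2"
      using prob_space by (simp add: Bochner_Integration.integral_diff)
    with eq show ?thesis by simp
  qed
  define A where "A r = 1 + 2 * (\<Sum>n. r ^ Suc n * b n)" for r :: real
  \<comment> \<open>Absolute summability of the coefficients makes the Abel means continuous up to
    \<open>r = 1\<close>, where they equal \<open>S t\<close>.\<close>
  have "uniform_limit {0..1} (\<lambda>N r. \<Sum>n<N. r ^ Suc n * b n) (\<lambda>r. \<Sum>n. r ^ Suc n * b n) sequentially"
  proof (rule Weierstrass_m_test[OF _ summ])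
    fix n and r :: real assume "r \<in> {0..1}"
    then have "\<bar>r ^ Suc n\<bar> \<le> 1" by (simp add: power_le_one abs_mult mult_le_one)
    then have "\<bar>r ^ Suc n\<bar> * \<bar>b n\<bar> \<le> 1 * \<bar>\<phi> (2 * pi * real (Suc n))\<bar>" using bb by (intro mult_mono) auto
    then show "norm (r ^ Suc n * b n) \<le> \<bar>\<phi> (2 * pi * real (Suc n))\<bar>" by (simp add: abs_mult)
  qed
  then have "continuous_on {0..1} (\<lambda>r::real. \<Sum>n. r ^ Suc n * b n)"
    by (rule uniform_limit_theorem[rotated]) (auto intro!: always_eventually continuous_intros)
  then have "continuous_on {0..1} A" unfolding A_def by (intro continuous_intros)
  \<comment> \<open>Starting at 1/2 guarantees \<open>2 * r m \<ge> 1\<close>, which the lower bound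
    for the Poisson denominator uses below.\<close>
  define r where "r m = 1 - 1 / real (m + 2)" for m :: nat
  have r: "1/2 \<le> r m" "r m < 1" for m unfolding r_def by (auto simp: field_simps)
  have rlim: "r \<longlonglongrightarrow> 1"
  proof -
    have "(\<lambda>m. 1 - 1 / real (m + 2)) \<longlonglongrightarrow> 1 - 0"
      by (intro tendsto_diff tendsto_const LIMSEQ_ignore_initial_segment[OF lim_1_over_n])
    then show ?thesis by (simp add: r_def[abs_def])
  qed
  have r01: "r m \<in> {0..1}" for m using r[of m] by auto
  have Alim: "(\<lambda>m. A (r m)) \<longlonglongrightarrow> A 1"
    by (rule continuous_on_tendsto_compose[OF \<open>continuous_on {0..1} A\<close> rlim])
      (use r01 in \<open>simp_all add: always_eventually\<close>)
  have A1: "A 1 = S t" unfolding A_def S_def b_def by simp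
  have Ar: "A (r m) = (\<integral>s. P (r m) (2 * pi * (t - s)) \<partial>\<nu>)" for m
    unfolding A_def using r[of m] by (intro abel) auto
  have "A (r m) \<ge> 0" for m unfolding Ar using r[of m] Pn by (intro Bochner_Integration.integral_nonneg) auto
  then show nonneg: "S t \<ge> 0" using Alim unfolding A1[symmetric] by (intro LIMSEQ_le_const) auto
  assume far: "\<And>k::int. \<bar>t - of_int k\<bar> > \<delta>"
  \<comment> \<open>How far \<open>t\<close> lies beyond the \<open>\<delta>\<close>-neighbourhood
    of the integers: for \<open>\<bar>s\<bar> \<le> \<delta>\<close> the point \<open>t - s\<close>
    keeps distance at least \<open>e\<close> from every integer.\<close>
  define e where "e = \<bar>t - of_int (round t)\<bar> - \<delta>"
  have e0: "e > 0" using far[of "round t"] by (simp add: e_def)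
  have "\<delta> \<ge> 0"
  proof (rule ccontr)
    assume "\<not> \<delta> \<ge> 0"
    have "AE s in \<nu>. False" using supp by eventually_elim (use \<open>\<not> \<delta> \<ge> 0\<close> in auto)
    then show False by simp
  qed
  then have e1: "e \<le> 1/2" using of_int_round_abs_le[of t] by (simp add: e_def abs_minus_commute)
  have cosle: "cos (2 * pi * (t - s)) \<le> cos (2 * pi * e)" if s: "\<bar>s\<bar> \<le> \<delta>" for s
  proof -
    define k where "k = round (t - s)"
    define v where "v = \<bar>t - s - of_int k\<bar>"
    have v1: "v \<le> 1/2" using of_int_round_abs_le[of "t - s"] by (simp add: k_def v_def abs_minus_commute)
    have "\<bar>t - of_int (round t)\<bar> \<le> \<bar>t - of_int k\<bar>" by (rule round_diff_minimal)
    then have v2: "e \<le> v" using s by (simp add: v_def e_def)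
    have "cos (2 * pi * (t - s)) = cos (2 * pi * (t - s) - 2 * pi * of_int k)"
      by (simp add: cos_diff)
    also have "\<dots> = cos (\<bar>2 * pi * (t - s - of_int k)\<bar>)" by (simp add: algebra_simps)
    also have "\<dots> = cos (2 * pi * v)" by (simp add: v_def abs_mult)
    also have "\<dots> \<le> cos (2 * pi * e)"
      using v1 v2 e0 by (intro cos_monotone_0_pi_le) auto
    finally show ?thesis .
  qed
  define \<eta> where "\<eta> = 1 - cos (2 * pi * e)"
  have "cos (2 * pi * e) < cos 0" using e0 e1 by (intro cos_monotone_0_pi) auto
  then have \<eta>: "\<eta> > 0" by (simp add: \<eta>_def)
  have upper: "A (r m) \<le> (1 - (r m)\<^sup>2) / \<eta>" for m
  proof -
    have r2: "(r m)\<^sup>2 \<le> 1" using r[of m] by (simp add: power_le_one)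
    have "P (r m) (2 * pi * (t - s)) \<le> (1 - (r m)\<^sup>2) / \<eta>" if s: "\<bar>s\<bar> \<le> \<delta>" for s
    proof -
      have "2 * r m * cos (2 * pi * (t - s)) \<le> 2 * r m * (1 - \<eta>)"
        using cosle[OF s] r[of m] by (intro mult_left_mono) (auto simp: \<eta>_def)
      moreover have "2 * r m * \<eta> \<ge> 1 * \<eta>" using r[of m] \<eta> by (intro mult_right_mono) auto
      moreover have "0 \<le> (1 - r m)\<^sup>2" by simp
      \<comment> \<open>The denominator is \<open>(1 - r m)\<^sup>2 + 2 * r m * (1 - cos)\<close>,
        bounded below by \<open>\<eta>\<close>, while the numerator \<open>1 - (r m)\<^sup>2\<close>
        tends to 0.\<close>
      ultimately have "1 - 2 * r m * cos (2 * pi * (t - s)) + (r m)\<^sup>2 \<ge> \<eta>"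
        by (simp add: power2_diff algebra_simps)
      then show ?thesis unfolding P_def using \<eta> r2 by (intro divide_left_mono) auto
    qed
    then have "AE s in \<nu>. P (r m) (2 * pi * (t - s)) \<le> (1 - (r m)\<^sup>2) / \<eta>"
      using supp by (auto elim: AE_mp)
    moreover have "0 \<le> (1 - (r m)\<^sup>2) / \<eta>" using r2 \<eta> by simp
    ultimately have "(\<integral>s. P (r m) (2 * pi * (t - s)) \<partial>\<nu>) \<le> (\<integral>s. (1 - (r m)\<^sup>2) / \<eta> \<partial>\<nu>)"
      by (intro integral_mono_AE') auto
    then show ?thesis unfolding Ar using prob_space by simp
  qed
  have "(\<lambda>m. (1 - (r m)\<^sup>2) / \<eta>) \<longlonglongrightarrow> (1 - 1\<^sup>2) / \<eta>"
    using \<eta> by (intro tendsto_intros rlim) auto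
  then have "A 1 \<le> (1 - 1\<^sup>2) / \<eta>" using Alim upper by (intro LIMSEQ_le) auto
  then show "S t = 0" using nonneg A1 by simp
qed

text \<open>Periodization of \<open>smooth_law\<close>: the coefficient at \<open>k\<close> is the
  characteristic function at \<open>2 * pi * k\<close>, and \<open>n \<ge> 2\<close> makes the
  series absolutely convergent. One \<open>B\<close> bounds the kernel and all its partial sums, as
  dominated convergence will require.\<close>

lemma kernel_1d:
  assumes \<delta>: "\<delta> > 0" and n: "n \<ge> 2"
  shows "\<exists>(S :: real \<Rightarrow> real) (c :: int \<Rightarrow> real) B. S \<in> borel_measurable borel \<and> (\<forall>t. 0 \<le> S t \<and> S t \<le> B) \<and>
    (\<forall>t. S t \<noteq> 0 \<longrightarrow> (\<exists>k::int. \<bar>t - of_int k\<bar> \<le> \<delta>)) \<and>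
    c 0 = 1 \<and> (\<forall>k. \<bar>c k\<bar> \<le> 1 \<and> \<bar>c k\<bar> \<le> (2 * real n / (1 + \<delta> * \<bar>of_int k\<bar>)) ^ n) \<and>
    (\<forall>N t. cmod (\<Sum>k\<in>{-int N..int N}. of_real (c k) * cis (2 * pi * of_int k * t)) \<le> B) \<and>
    (\<forall>t. (\<lambda>N. \<Sum>k\<in>{-int N..int N}. of_real (c k) * cis (2 * pi * of_int k * t)) \<longlonglongrightarrow> complex_of_real (S t))"
proof -
  obtain \<nu> \<phi> where \<nu>: "real_distribution \<nu>" "AE x in \<nu>. \<bar>x\<bar> \<le> \<delta>"
    and char: "\<And>t. char \<nu> t = complex_of_real (\<phi> t)"
    and decay: "\<And>t. \<bar>\<phi> t\<bar> \<le> (2 * real n / (1 + \<delta> * \<bar>t\<bar>)) ^ n"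
    using smooth_law[OF \<delta>, of n] n by auto
  interpret real_distribution \<nu> by fact
  define c where "c k = \<phi> (2 * pi * of_int k)" for k :: int
  have c0: "c 0 = 1" using char[of 0] by (simp add: c_def char_zero)
  \<comment> \<open>Evaluated at shift 0, both sides reduce to the cosine moment, which is even in
    \<open>t\<close>.\<close>
  have even: "\<phi> (- t) = \<phi> t" for t
    using integral_cos_shift[OF \<nu>(1) char, of t 0] integral_cos_shift[OF \<nu>(1) char, of "-t" 0] by simp
  then have ceven: "c (- k) = c k" for k by (simp add: c_def)
  have c1: "\<bar>c k\<bar> \<le> 1" for k using cmod_char_le_1[of "2 * pi * of_int k"] by (simp add: char c_def)
  have cdecay: "\<bar>c k\<bar> \<le> (2 * real n / (1 + \<delta> * \<bar>of_int k\<bar>)) ^ n" for k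
  proof -
    have "1 * \<bar>real_of_int k\<bar> \<le> \<bar>2 * pi * of_int k\<bar>"
      unfolding abs_mult using pi_gt3 by (intro mult_right_mono) auto
    then have "\<delta> * \<bar>real_of_int k\<bar> \<le> \<delta> * \<bar>2 * pi * of_int k\<bar>" using \<delta> by (intro mult_left_mono) auto
    then have "(2 * real n / (1 + \<delta> * \<bar>2 * pi * of_int k\<bar>)) ^ n \<le> (2 * real n / (1 + \<delta> * \<bar>of_int k\<bar>)) ^ n"
      using \<delta> by (intro power_mono divide_left_mono mult_pos_pos add_pos_nonneg) auto
    then show ?thesis using decay[of "2 * pi * of_int k"] by (simp add: c_def)
  qed
  have summ: "summable (\<lambda>m. \<bar>\<phi> (2 * pi * real (Suc m))\<bar>)"
  proof (rule summable_comparison_test)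
    define A where "A = (2 * real n / \<delta>) ^ n"
    show "summable (\<lambda>m. A * (1 / (real (Suc m))\<^sup>2))"
      using inverse_squares_sums by (intro summable_mult) (auto simp: sums_iff add.commute)
    show "\<exists>M. \<forall>m\<ge>M. norm \<bar>\<phi> (2 * pi * real (Suc m))\<bar> \<le> A * (1 / (real (Suc m))\<^sup>2)"
    proof (intro exI[of _ 0] allI impI)
      fix m
      have "\<bar>c (int (Suc m))\<bar> \<le> (2 * real n / (1 + \<delta> * real (Suc m))) ^ n"
        using cdecay[of "int (Suc m)"] by simp
      also have "\<dots> \<le> (2 * real n / (\<delta> * real (Suc m))) ^ n"
        using \<delta> by (intro power_mono divide_left_mono mult_pos_pos add_pos_nonneg) auto
      also have "\<dots> = A * (1 / real (Suc m)) ^ n"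
        unfolding A_def by (simp add: power_divide power_mult_distrib)
      also have "\<dots> \<le> A * (1 / real (Suc m)) ^ 2"
        using \<delta> n by (intro mult_left_mono power_decreasing) (auto simp: A_def)
      finally show "norm \<bar>\<phi> (2 * pi * real (Suc m))\<bar> \<le> A * (1 / (real (Suc m))\<^sup>2)"
        by (simp add: c_def power_one_over)
    qed
  qed
  define S where "S t = 1 + 2 * (\<Sum>m. \<phi> (2 * pi * real (Suc m)) * cos (2 * pi * real (Suc m) * t))" for t
  define B where "B = 1 + 2 * (\<Sum>m. \<bar>\<phi> (2 * pi * real (Suc m))\<bar>)"
  have S0: "S t \<ge> 0" for t unfolding S_def by (rule periodization_nonneg_support[OF \<nu> char summ])
  have Ssupp: "\<exists>k::int. \<bar>t - of_int k\<bar> \<le> \<delta>" if "S t \<noteq> 0" for t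
    using that periodization_nonneg_support(2)[OF \<nu> char summ] unfolding S_def by (meson not_le)
  have Smeas: "S \<in> borel_measurable borel" unfolding S_def by measurable
  have tb: "norm (\<phi> (2 * pi * real (Suc m)) * cos (2 * pi * real (Suc m) * t)) \<le> \<bar>\<phi> (2 * pi * real (Suc m))\<bar>" for m t
    by (simp add: abs_mult mult_left_le)
  have tsumm: "summable (\<lambda>m. \<phi> (2 * pi * real (Suc m)) * cos (2 * pi * real (Suc m) * t))" for t
    using tb by (intro summable_comparison_test[OF _ summ]) blast
  define R where "R N t = 1 + 2 * (\<Sum>m<N. \<phi> (2 * pi * real (Suc m)) * cos (2 * pi * real (Suc m) * t))" for N t
  have part: "(\<Sum>k\<in>{-int N..int N}. of_real (c k) * cis (2 * pi * of_int k * t)) = complex_of_real (R N t)" for N t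
  proof (induction N)
    case 0
    then show ?case by (simp add: R_def c0)
  next
    case (Suc N)
    have "{-int (Suc N)..int (Suc N)} = insert (int (Suc N)) (insert (- int (Suc N)) {-int N..int N})" by auto
    then have "(\<Sum>k\<in>{-int (Suc N)..int (Suc N)}. of_real (c k) * cis (2 * pi * of_int k * t)) =
        of_real (c (int (Suc N))) * cis (2 * pi * of_int (int (Suc N)) * t) +
        (of_real (c (- int (Suc N))) * cis (2 * pi * of_int (- int (Suc N)) * t) +
         (\<Sum>k\<in>{-int N..int N}. of_real (c k) * cis (2 * pi * of_int k * t)))"
      by (simp del: of_nat_Suc)
    also have "\<dots> = complex_of_real (R (Suc N) t)"
    proof -
      define x where "x = 2 * pi * real (Suc N) * t"
      have e: "2 * pi * of_int (int (Suc N)) * t = x" "2 * pi * of_int (- int (Suc N)) * t = - x"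
        by (simp_all only: x_def of_int_minus of_int_of_nat_eq mult_minus_left mult_minus_right)
      have r: "R (Suc N) t = R N t + 2 * (c (int (Suc N)) * cos x)"
        unfolding R_def c_def x_def sum.lessThan_Suc by (simp only: of_int_of_nat_eq distrib_left add.assoc)
      show ?thesis
        unfolding Suc.IH ceven e r by (simp add: complex_eq_iff del: of_nat_Suc)
    qed
    finally show ?case .
  qed
  have Rb: "\<bar>R N t\<bar> \<le> B" for N t
  proof -
    have "\<bar>\<Sum>m<N. \<phi> (2 * pi * real (Suc m)) * cos (2 * pi * real (Suc m) * t)\<bar> \<le> (\<Sum>m<N. \<bar>\<phi> (2 * pi * real (Suc m))\<bar>)"
      using tb by (intro sum_norm_le[of _ "\<lambda>m. \<phi> (2 * pi * real (Suc m)) * cos (2 * pi * real (Suc m) * t)", unfolded real_norm_def]) auto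
    also have "\<dots> \<le> (\<Sum>m. \<bar>\<phi> (2 * pi * real (Suc m))\<bar>)" by (intro sum_le_suminf summ) auto
    finally show ?thesis unfolding R_def B_def by linarith
  qed
  have Rlim: "(\<lambda>N. R N t) \<longlonglongrightarrow> S t" for t
    unfolding R_def S_def by (intro tendsto_intros summable_LIMSEQ tsumm)
  have SB: "S t \<le> B" for t
    using abs_le_D1[OF Rb] by (intro LIMSEQ_le_const2[OF Rlim]) auto
  show ?thesis
    using S0 SB Ssupp Smeas c0 c1 cdecay Rb Rlim
    by (intro exI[of _ S] exI[of _ c] exI[of _ B]) (auto simp: part intro!: tendsto_of_real)
qed

text \<open>Square partial sums, so that a two-dimensional sum factors into one-dimensional ones and
  boundedness and convergence are inherited.\<close>

definition gbox :: "nat \<Rightarrow> complex set" where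
  "gbox N = (\<lambda>(a, b). Complex (of_int a) (of_int b)) ` ({-int N..int N} \<times> {-int N..int N})"

lemma finite_gbox [simp]: "finite (gbox N)"
  and zero_in_gbox [simp]: "0 \<in> gbox N"
  and gbox_gaussian: "gbox N \<subseteq> gaussian_ints"
proof -
  show "0 \<in> gbox N" unfolding gbox_def by (rule image_eqI[of _ _ "(0, 0)"]) (auto simp: complex_eq_iff)
qed (auto simp: gbox_def gaussian_ints_iff)

text \<open>Product of two copies of \<open>kernel_1d\<close> in the real and imaginary parts, which
  fits the sup norm in the support condition.\<close>

lemma kernel_2d:
  assumes \<delta>: "\<delta> > 0" and n: "n \<ge> 2"
  shows "\<exists>(\<Phi> :: complex \<Rightarrow> real) (w :: complex \<Rightarrow> real) B. \<Phi> \<in> borel_measurable borel \<and> (\<forall>y. 0 \<le> \<Phi> y \<and> \<Phi> y \<le> B) \<and>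
    (\<forall>y. \<Phi> y \<noteq> 0 \<longrightarrow> (\<exists>r\<in>gaussian_ints. supnorm (y - r) \<le> \<delta>)) \<and>
    w 0 = 1 \<and> (\<forall>k\<in>gaussian_ints. \<bar>w k\<bar> \<le> (4 * real n / (1 + \<delta> * cmod k)) ^ n) \<and>
    (\<forall>N y. cmod (\<Sum>k\<in>gbox N. of_real (w k) * cis (2 * pi * (k \<bullet> y))) \<le> B) \<and>
    (\<forall>y. (\<lambda>N. \<Sum>k\<in>gbox N. of_real (w k) * cis (2 * pi * (k \<bullet> y))) \<longlonglongrightarrow> complex_of_real (\<Phi> y))"
proof -
  obtain S :: "real \<Rightarrow> real" and c :: "int \<Rightarrow> real" and B where
    Sm[measurable]: "S \<in> borel_measurable borel" and S0: "\<And>t. 0 \<le> S t" and SB: "\<And>t. S t \<le> B"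
    and Ss: "\<And>t. S t \<noteq> 0 \<Longrightarrow> \<exists>k::int. \<bar>t - of_int k\<bar> \<le> \<delta>"
    and c0: "c 0 = 1" and c1: "\<And>k. \<bar>c k\<bar> \<le> 1" and cd: "\<And>k. \<bar>c k\<bar> \<le> (2 * real n / (1 + \<delta> * \<bar>of_int k\<bar>)) ^ n"
    and Tb: "\<And>N t. cmod (\<Sum>k\<in>{-int N..int N}. of_real (c k) * cis (2 * pi * of_int k * t)) \<le> B"
    and Tl: "\<And>t. (\<lambda>N. \<Sum>k\<in>{-int N..int N}. of_real (c k) * cis (2 * pi * of_int k * t)) \<longlonglongrightarrow> complex_of_real (S t)"
    using kernel_1d[OF assms] by blast
  define T where "T N t = (\<Sum>k\<in>{-int N..int N}. complex_of_real (c k) * cis (2 * pi * of_int k * t))" for N t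
  define \<Phi> where "\<Phi> y = S (Re y) * S (Im y)" for y
  define w where "w k = c \<lfloor>Re k\<rfloor> * c \<lfloor>Im k\<rfloor>" for k
  have B0: "B \<ge> 0" using S0[of 0] SB[of 0] by linarith
  have part: "(\<Sum>k\<in>gbox N. of_real (w k) * cis (2 * pi * (k \<bullet> y))) = T N (Re y) * T N (Im y)" for N y
  proof -
    have "(\<Sum>k\<in>gbox N. of_real (w k) * cis (2 * pi * (k \<bullet> y))) =
        (\<Sum>(a, b)\<in>{-int N..int N} \<times> {-int N..int N}. (of_real (c a) * cis (2 * pi * of_int a * Re y)) *
           (of_real (c b) * cis (2 * pi * of_int b * Im y)))"
      unfolding gbox_def
      by (subst sum.reindex) (auto simp: inj_on_def w_def inner_complex_def cis_mult algebra_simps intro!: sum.cong)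
    also have "\<dots> = T N (Re y) * T N (Im y)"
      unfolding T_def by (simp add: sum_product sum.cartesian_product)
    finally show ?thesis .
  qed
  have "\<Phi> \<in> borel_measurable borel" unfolding \<Phi>_def by measurable
  moreover have "0 \<le> \<Phi> y \<and> \<Phi> y \<le> B * B" for y
    unfolding \<Phi>_def using S0 SB B0 by (auto intro!: mult_mono)
  moreover have "\<exists>r\<in>gaussian_ints. supnorm (y - r) \<le> \<delta>" if "\<Phi> y \<noteq> 0" for y
  proof -
    have "S (Re y) \<noteq> 0" "S (Im y) \<noteq> 0" using that by (auto simp: \<Phi>_def)
    then obtain a b :: int where "\<bar>Re y - of_int a\<bar> \<le> \<delta>" "\<bar>Im y - of_int b\<bar> \<le> \<delta>" using Ss by blast
    then show ?thesis
      by (intro bexI[of _ "Complex (of_int a) (of_int b)"]) (auto simp: supnorm_def gaussian_ints_iff)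
  qed
  moreover have "w 0 = 1" by (simp add: w_def c0)
  moreover have "\<bar>w k\<bar> \<le> (4 * real n / (1 + \<delta> * cmod k)) ^ n" if kG: "k \<in> gaussian_ints" for k
  proof -
    obtain a b :: int where k: "k = Complex (of_int a) (of_int b)" using kG[unfolded gaussian_ints_iff] by blast
    \<comment> \<open>Only the decay in the larger coordinate is used; the other factor is at most
      1. Since \<open>cmod k\<close> is at most twice that coordinate, \<open>2 * n\<close> becomes
      \<open>4 * n\<close>.\<close>
    define m where "m = (if \<bar>a\<bar> \<ge> \<bar>b\<bar> then a else b)"
    have m: "\<bar>a\<bar> \<le> \<bar>m\<bar>" "\<bar>b\<bar> \<le> \<bar>m\<bar>" by (auto simp: m_def)
    have "cmod k \<le> \<bar>Re k\<bar> + \<bar>Im k\<bar>" by (rule cmod_le)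
    also have "\<dots> \<le> 2 * \<bar>of_int m\<bar>" using m by (simp add: k flip: of_int_abs)
    finally have km: "cmod k \<le> 2 * \<bar>of_int m\<bar>" .
    have "\<bar>w k\<bar> = \<bar>c a\<bar> * \<bar>c b\<bar>" by (simp add: w_def k abs_mult)
    also have "\<dots> \<le> \<bar>c m\<bar>"
      unfolding m_def using c1[of a] c1[of b] by (auto simp: mult_left_le mult_left_le_one_le)
    also have "\<dots> \<le> (2 * real n / (1 + \<delta> * \<bar>of_int m\<bar>)) ^ n" by (rule cd)
    also have "\<dots> \<le> (4 * real n / (1 + \<delta> * cmod k)) ^ n"
    proof (rule power_mono)
      have "\<delta> * cmod k \<le> \<delta> * (2 * \<bar>of_int m\<bar>)" using km \<delta> by (intro mult_left_mono) auto
      then have "1 + \<delta> * cmod k \<le> 2 * (1 + \<delta> * \<bar>of_int m\<bar>)" by simp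
      then have "4 * real n / (2 * (1 + \<delta> * \<bar>of_int m\<bar>)) \<le> 4 * real n / (1 + \<delta> * cmod k)"
        using \<delta> by (intro divide_left_mono mult_pos_pos add_pos_nonneg) auto
      moreover have "4 * real n / (2 * z) = 2 * real n / z" for z :: real by simp
      ultimately show "2 * real n / (1 + \<delta> * \<bar>of_int m\<bar>) \<le> 4 * real n / (1 + \<delta> * cmod k)" by (simp only:)
    qed (use \<delta> in auto)
    finally show ?thesis .
  qed
  moreover have "cmod (\<Sum>k\<in>gbox N. of_real (w k) * cis (2 * pi * (k \<bullet> y))) \<le> B * B" for N y
    unfolding part norm_mult T_def using Tb B0 by (intro mult_mono) auto
  moreover have "(\<lambda>N. \<Sum>k\<in>gbox N. of_real (w k) * cis (2 * pi * (k \<bullet> y))) \<longlonglongrightarrow> complex_of_real (\<Phi> y)" for y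
    unfolding part \<Phi>_def of_real_mult T_def by (intro tendsto_mult Tl)
  ultimately show ?thesis by blast
qed

section \<open>Lattice sums bounded uniformly in the centre\<close>

lemma int_sum_bound:
  "\<exists>C\<ge>0. \<forall>t::real. \<forall>B::int set. finite B \<longrightarrow> (\<Sum>k\<in>B. 1 / (1 + \<bar>t - of_int k\<bar>)\<^sup>2) \<le> C"
proof -
  define Z where "Z = (\<Sum>j. 1 / (real (Suc j))\<^sup>2)"
  have summ: "summable (\<lambda>j. 1 / (real (Suc j))\<^sup>2)"
    using inverse_squares_sums by (auto simp: sums_iff add.commute)
  have Z0: "Z \<ge> 0" unfolding Z_def by (intro suminf_nonneg summ) auto
  have sq: "(\<Sum>k\<in>B. 1 / (1 + \<bar>real_of_int k\<bar>)\<^sup>2) \<le> Z" if "finite B" "B \<subseteq> f ` UNIV" "inj f" "\<And>i. \<bar>f i\<bar> = int i"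
    for B and f :: "nat \<Rightarrow> int"
  proof -
    have fin: "finite (f -` B)" using that by (intro finite_vimageI) auto
    have "B = f ` (f -` B)" using that by auto
    then have "(\<Sum>k\<in>B. 1 / (1 + \<bar>real_of_int k\<bar>)\<^sup>2) = (\<Sum>k\<in>f ` (f -` B). 1 / (1 + \<bar>real_of_int k\<bar>)\<^sup>2)" by simp
    also have "\<dots> = (\<Sum>i\<in>f -` B. 1 / (1 + \<bar>real_of_int (f i)\<bar>)\<^sup>2)"
      by (subst sum.reindex) (use that in \<open>auto simp: inj_on_def inj_def\<close>)
    also have "\<dots> = (\<Sum>i\<in>f -` B. 1 / (real (Suc i))\<^sup>2)"
      using that(4) by (intro sum.cong) (auto simp flip: of_int_abs)
    also have "\<dots> \<le> Z" unfolding Z_def by (intro sum_le_suminf summ fin) auto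
    finally show ?thesis .
  qed
  have base: "(\<Sum>k\<in>B. 1 / (1 + \<bar>real_of_int k\<bar>)\<^sup>2) \<le> 2 * Z" if B: "finite B" for B
  proof -
    have "(\<Sum>k\<in>B. 1 / (1 + \<bar>real_of_int k\<bar>)\<^sup>2) =
       (\<Sum>k\<in>{k\<in>B. k \<ge> 0}. 1 / (1 + \<bar>real_of_int k\<bar>)\<^sup>2) + (\<Sum>k\<in>{k\<in>B. k < 0}. 1 / (1 + \<bar>real_of_int k\<bar>)\<^sup>2)"
      using B by (subst sum.union_disjoint[symmetric]) (auto intro!: sum.cong)
    also have "(\<Sum>k\<in>{k\<in>B. k \<ge> 0}. 1 / (1 + \<bar>real_of_int k\<bar>)\<^sup>2) \<le> Z"
      using B by (intro sq[of _ int]) (auto simp: inj_def image_iff intro: nonneg_int_cases)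
    also have "(\<Sum>k\<in>{k\<in>B. k < 0}. 1 / (1 + \<bar>real_of_int k\<bar>)\<^sup>2) \<le> Z"
    proof (intro sq[of _ "\<lambda>i. - int i"])
      have "k \<in> range (\<lambda>i. - int i)" if "k < 0" for k
        using that by (intro image_eqI[of _ _ "nat (- k)"]) auto
      then show "{k \<in> B. k < 0} \<subseteq> range (\<lambda>i. - int i)" by blast
    qed (use B in \<open>auto simp: inj_def\<close>)
    finally show ?thesis by simp
  qed
  have "(\<Sum>k\<in>B. 1 / (1 + \<bar>t - of_int k\<bar>)\<^sup>2) \<le> 8 * Z" if B: "finite B" for t :: real and B :: "int set"
  proof -
    define m where "m = \<lfloor>t\<rfloor>"
    have "(\<Sum>k\<in>B. 1 / (1 + \<bar>t - of_int k\<bar>)\<^sup>2) \<le> (\<Sum>k\<in>B. 4 * (1 / (1 + \<bar>real_of_int (k - m)\<bar>)\<^sup>2))"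
    proof (rule sum_mono)
      fix k
      \<comment> \<open>Replacing \<open>t\<close> by its floor changes distances by at most 1,
        hence \<open>1 + distance\<close> by at most a factor 2 and the summand by at most a factor
        4.\<close>
      have km: "\<bar>real_of_int (k - m)\<bar> \<le> \<bar>t - of_int k\<bar> + 1" unfolding m_def of_int_diff by linarith
      have "(1 + a) / 2 \<le> 1 + b" if "a \<le> b + 1" "0 \<le> b" for a b :: real using that by simp
      from this[OF km] have "(1 + \<bar>real_of_int (k - m)\<bar>) / 2 \<le> 1 + \<bar>t - of_int k\<bar>" by simp
      then have "((1 + \<bar>real_of_int (k - m)\<bar>) / 2)\<^sup>2 \<le> (1 + \<bar>t - of_int k\<bar>)\<^sup>2" by (intro power_mono) auto
      then have "1 / (1 + \<bar>t - of_int k\<bar>)\<^sup>2 \<le> 1 / ((1 + \<bar>real_of_int (k - m)\<bar>) / 2)\<^sup>2"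
        by (intro divide_left_mono mult_pos_pos zero_less_power) auto
      then show "1 / (1 + \<bar>t - of_int k\<bar>)\<^sup>2 \<le> 4 * (1 / (1 + \<bar>real_of_int (k - m)\<bar>)\<^sup>2)"
        by (simp add: power_divide)
    qed
    also have "\<dots> = 4 * (\<Sum>k\<in>B. 1 / (1 + \<bar>real_of_int (k - m)\<bar>)\<^sup>2)" by (rule sum_distrib_left[symmetric])
    also have "(\<Sum>k\<in>B. 1 / (1 + \<bar>real_of_int (k - m)\<bar>)\<^sup>2) = (\<Sum>k\<in>(\<lambda>k. k - m) ` B. 1 / (1 + \<bar>real_of_int k\<bar>)\<^sup>2)"
      by (subst sum.reindex) (auto simp: inj_on_def)
    also have "\<dots> \<le> 2 * Z" using B by (intro base) auto
    finally show ?thesis by simp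
  qed
  then show ?thesis using Z0 by (intro exI[of _ "8 * Z"]) auto
qed

lemma gaussian_floor: "z \<in> gaussian_ints \<Longrightarrow> Complex (of_int \<lfloor>Re z\<rfloor>) (of_int \<lfloor>Im z\<rfloor>) = z"
  by (auto simp: gaussian_ints_def complex_eq_iff)

text \<open>The fourth power dominates the product of squares in the two coordinates; after
  enlarging \<open>A\<close> to the product of its projections the sum factors.\<close>

lemma lattice_sum_bound:
  "\<exists>C\<ge>0. \<forall>\<xi>. \<forall>A\<subseteq>gaussian_ints. finite A \<longrightarrow> (\<Sum>l\<in>A. 1 / (1 + cmod (\<xi> - l)) ^ 4) \<le> C"
proof -
  obtain C where C: "C \<ge> 0" "\<And>t B. finite B \<Longrightarrow> (\<Sum>k\<in>B. 1 / (1 + \<bar>t - real_of_int k\<bar>)\<^sup>2) \<le> C"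
    using int_sum_bound by blast
  have "(\<Sum>l\<in>A. 1 / (1 + cmod (\<xi> - l)) ^ 4) \<le> C * C" if A: "A \<subseteq> gaussian_ints" "finite A" for \<xi> A
  proof -
    define f where "f l = (\<lfloor>Re l\<rfloor>, \<lfloor>Im l\<rfloor>)" for l
    define U V where "U = (\<lambda>l. \<lfloor>Re l\<rfloor>) ` A" and "V = (\<lambda>l. \<lfloor>Im l\<rfloor>) ` A"
    have inj: "inj_on f A"
      using A(1) by (intro inj_on_inverseI[of _ "\<lambda>(a, b). Complex (of_int a) (of_int b)"])
        (auto simp: f_def gaussian_floor)
    have "(\<Sum>l\<in>A. 1 / (1 + cmod (\<xi> - l)) ^ 4) \<le>
        (\<Sum>l\<in>A. 1 / (1 + \<bar>Re \<xi> - of_int \<lfloor>Re l\<rfloor>\<bar>)\<^sup>2 * (1 / (1 + \<bar>Im \<xi> - of_int \<lfloor>Im l\<rfloor>\<bar>)\<^sup>2))"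
    proof (rule sum_mono)
      fix l assume "l \<in> A"
      then have l: "of_int \<lfloor>Re l\<rfloor> = Re l" "of_int \<lfloor>Im l\<rfloor> = Im l"
        using gaussian_floor[of l] A(1) by (metis complex.sel subsetD)+
      have "(1 + \<bar>Re \<xi> - Re l\<bar>)\<^sup>2 * (1 + \<bar>Im \<xi> - Im l\<bar>)\<^sup>2 \<le> (1 + cmod (\<xi> - l))\<^sup>2 * (1 + cmod (\<xi> - l))\<^sup>2"
        using abs_Re_le_cmod[of "\<xi> - l"] abs_Im_le_cmod[of "\<xi> - l"]
        by (intro mult_mono power_mono) auto
      also have "\<dots> = (1 + cmod (\<xi> - l)) ^ 4" by (simp flip: power_add)
      finally have "1 / (1 + cmod (\<xi> - l)) ^ 4 \<le> 1 / ((1 + \<bar>Re \<xi> - Re l\<bar>)\<^sup>2 * (1 + \<bar>Im \<xi> - Im l\<bar>)\<^sup>2)"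
        by (intro divide_left_mono mult_pos_pos zero_less_power add_pos_nonneg) auto
      then show "1 / (1 + cmod (\<xi> - l)) ^ 4 \<le>
          1 / (1 + \<bar>Re \<xi> - of_int \<lfloor>Re l\<rfloor>\<bar>)\<^sup>2 * (1 / (1 + \<bar>Im \<xi> - of_int \<lfloor>Im l\<rfloor>\<bar>)\<^sup>2)"
        by (simp add: l)
    qed
    also have "\<dots> = (\<Sum>(a, b)\<in>f ` A. 1 / (1 + \<bar>Re \<xi> - of_int a\<bar>)\<^sup>2 * (1 / (1 + \<bar>Im \<xi> - of_int b\<bar>)\<^sup>2))"
      by (subst sum.reindex[OF inj]) (simp add: f_def)
    also have "\<dots> \<le> (\<Sum>(a, b)\<in>U \<times> V. 1 / (1 + \<bar>Re \<xi> - of_int a\<bar>)\<^sup>2 * (1 / (1 + \<bar>Im \<xi> - of_int b\<bar>)\<^sup>2))"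
      using A by (intro sum_mono2) (auto simp: f_def U_def V_def)
    also have "\<dots> = (\<Sum>a\<in>U. 1 / (1 + \<bar>Re \<xi> - of_int a\<bar>)\<^sup>2) * (\<Sum>b\<in>V. 1 / (1 + \<bar>Im \<xi> - of_int b\<bar>)\<^sup>2)"
      by (simp add: sum_product sum.cartesian_product)
    also have "\<dots> \<le> C * C"
      using A C by (intro mult_mono sum_nonneg) (auto simp: U_def V_def)
    finally show ?thesis .
  qed
  then show ?thesis using C by (intro exI[of _ "C * C"]) auto
qed

subsection \<open>Weak limits of measures on a bounded set\<close>

definition binary_digit :: "nat \<Rightarrow> real \<Rightarrow> real" where
  "binary_digit n u = of_int (\<lfloor>2 ^ Suc n * u\<rfloor> mod 2)"

lemma binary_digit_01: "binary_digit n u \<in> {0, 1}"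
  unfolding binary_digit_def using pos_mod_bound[of 2 "\<lfloor>2 ^ Suc n * u\<rfloor>"] pos_mod_sign[of 2 "\<lfloor>2 ^ Suc n * u\<rfloor>"] by force

lemma binary_digit_measurable [measurable]: "binary_digit n \<in> borel_measurable borel"
  unfolding binary_digit_def by measurable

lemma binary_digit_sums:
  assumes "0 \<le> u" "u < 1"
  shows "(\<lambda>n. binary_digit n u / 2 ^ Suc n) sums u"
proof -
  have part: "(\<Sum>n<N. binary_digit n u / 2 ^ Suc n) = of_int \<lfloor>2 ^ N * u\<rfloor> / 2 ^ N" for N
  proof (induction N)
    case 0
    then show ?case using assms by (simp add: floor_eq_iff)
  next
    case (Suc N)
    have "\<lfloor>2 ^ N * u\<rfloor> = \<lfloor>2 ^ Suc N * u\<rfloor> div 2"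
      using floor_divide_real_eq_div[of 2 "2 ^ Suc N * u"] by simp
    then have "\<lfloor>2 ^ Suc N * u\<rfloor> = 2 * \<lfloor>2 ^ N * u\<rfloor> + \<lfloor>2 ^ Suc N * u\<rfloor> mod 2" by simp
    then have "real_of_int \<lfloor>2 ^ Suc N * u\<rfloor> = 2 * of_int \<lfloor>2 ^ N * u\<rfloor> + binary_digit N u"
      unfolding binary_digit_def by (metis of_int_add of_int_mult of_int_numeral)
    then show ?case using Suc by (simp add: field_simps)
  qed
  have lower: "u - 1 / 2 ^ N \<le> of_int \<lfloor>2 ^ N * u\<rfloor> / 2 ^ N" for N
  proof -
    have "2 ^ N * u - 1 \<le> of_int \<lfloor>2 ^ N * u\<rfloor>" by linarith
    then have "(2 ^ N * u - 1) / 2 ^ N \<le> of_int \<lfloor>2 ^ N * u\<rfloor> / 2 ^ N" by (intro divide_right_mono) auto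
    then show ?thesis by (simp add: field_simps)
  qed
  have upper: "of_int \<lfloor>2 ^ N * u\<rfloor> / 2 ^ N \<le> u" for N
  proof -
    have "of_int \<lfloor>2 ^ N * u\<rfloor> / 2 ^ N \<le> 2 ^ N * u / 2 ^ N"
      by (intro divide_right_mono of_int_floor_le) simp
    then show ?thesis by simp
  qed
  have "(\<lambda>N. u - 1 / 2 ^ N) \<longlonglongrightarrow> u - 0"
    by (intro tendsto_intros LIMSEQ_divide_realpow_zero) auto
  then have "(\<lambda>N. of_int \<lfloor>2 ^ N * u\<rfloor> / 2 ^ N) \<longlonglongrightarrow> u"
    using tendsto_sandwich[of "\<lambda>N. u - 1 / 2 ^ N" "\<lambda>N. of_int \<lfloor>2 ^ N * u\<rfloor> / 2 ^ N" sequentially "\<lambda>_. u" u]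
      always_eventually[of _ sequentially] lower upper by simp
  then show ?thesis unfolding sums_def part .
qed

text \<open>The point of the Cantor set with ternary digits \<open>2 * a n\<close>.\<close>

definition ternary :: "(nat \<Rightarrow> real) \<Rightarrow> real" where
  "ternary a = (\<Sum>n. 2 * a n / 3 ^ Suc n)"

lemma
  assumes a: "\<And>n. a n \<in> {0, 1}"
  shows ternary_summable: "summable (\<lambda>n. 2 * a n / 3 ^ Suc n)"
    and ternary_nonneg: "0 \<le> ternary a" and ternary_le_1: "ternary a \<le> 1"
proof -
  have geo: "(\<lambda>n. 2 / 3 * (1/3::real) ^ n) sums (2 / 3 * (1 / (1 - 1/3)))"
    by (intro sums_mult geometric_sums) auto
  have b: "0 \<le> 2 * a n / 3 ^ Suc n" "2 * a n / 3 ^ Suc n \<le> 2 / 3 * (1/3) ^ n" for n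
    using a[of n] by (auto simp: field_simps power_one_over)
  show s: "summable (\<lambda>n. 2 * a n / 3 ^ Suc n)"
  proof (rule summable_comparison_test[OF _ sums_summable[OF geo]], intro exI[of _ 0] allI impI)
    fix n show "norm (2 * a n / 3 ^ Suc n) \<le> 2 / 3 * (1/3) ^ n"
      using b[of n] by (simp only: real_norm_def abs_of_nonneg)
  qed
  show "0 \<le> ternary a" unfolding ternary_def using b by (intro suminf_nonneg s) auto
  have "ternary a \<le> (\<Sum>n. 2 / 3 * (1/3) ^ n)"
    unfolding ternary_def using b by (intro suminf_le s sums_summable[OF geo]) auto
  then show "ternary a \<le> 1" using sums_unique[OF geo] by simp
qed

lemma ternary_shift:
  assumes a: "\<And>n. a n \<in> {0, 1}"
  shows "3 * ternary a = 2 * a 0 + ternary (\<lambda>n. a (Suc n))"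
proof -
  have "ternary a = (\<Sum>n. 2 * a (Suc n) / 3 ^ Suc (Suc n)) + 2 * a 0 / 3"
    unfolding ternary_def using suminf_split_head[OF ternary_summable[of a, OF a]] by simp
  also have "(\<Sum>n. 2 * a (Suc n) / 3 ^ Suc (Suc n)) = (\<Sum>n. (1/3) * (2 * a (Suc n) / 3 ^ Suc n))"
    by (simp add: field_simps)
  also have "\<dots> = (1/3) * ternary (\<lambda>n. a (Suc n))"
    unfolding ternary_def by (intro suminf_mult ternary_summable a)
  finally show ?thesis by simp
qed

text \<open>Schoenberg's auxiliary function, realized as a clipped cosine: even, of period 2, equal
  to 0 on \<open>[0, 1/3]\<close> and to 1 on \<open>[2/3, 1]\<close>.\<close>

definition plateau :: "real \<Rightarrow> real" where
  "plateau t = max 0 (min 1 (1/2 - cos (pi * t)))"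

text \<open>Multiplying by 3 splits off the even integer \<open>2 * a 0\<close>, invisible to a
  function of period 2, and shifts the digits. The leading digit then decides between
  \<open>[0, 1/3]\<close> and \<open>[2/3, 1]\<close>.\<close>

lemma plateau_ternary:
  assumes a: "\<And>n. a n \<in> {0, 1}"
  shows "plateau (3 ^ n * ternary a) = a n"
  using a
proof (induction n arbitrary: a)
  case 0
  have s: "3 * ternary a = 2 * a 0 + ternary (\<lambda>n. a (Suc n))" by (rule ternary_shift[OF 0])
  have t: "0 \<le> ternary (\<lambda>n. a (Suc n))" "ternary (\<lambda>n. a (Suc n)) \<le> 1"
    using ternary_nonneg[of "\<lambda>n. a (Suc n)"] ternary_le_1[of "\<lambda>n. a (Suc n)"] 0 by auto
  consider "a 0 = 0" | "a 0 = 1" using 0 by auto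
  then show ?case
  proof cases
    case 1
    then have "0 \<le> ternary a" "ternary a \<le> 1/3" using s t by auto
    then have "cos (pi * (1/3)) \<le> cos (pi * ternary a)"
      by (intro cos_monotone_0_pi_le) (auto simp: mult_left_mono)
    then show ?thesis using 1 by (simp add: plateau_def cos_60)
  next
    case 2
    then have "2/3 \<le> ternary a" "ternary a \<le> 1" using s t by auto
    then have "cos (pi * ternary a) \<le> cos (pi * (2/3))"
      by (intro cos_monotone_0_pi_le) (auto simp: mult_left_mono)
    moreover have "cos (pi * (2/3)) = - (1/2)" using cos_120 by (simp add: mult.commute)
    ultimately show ?thesis using 2 by (simp add: plateau_def)
  qed
next
  case (Suc n)
  obtain k :: int where k: "a 0 = of_int k" using Suc.prems[of 0] by (metis insertE of_int_0 of_int_1 singletonD)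
  have "cos (pi * (3 ^ Suc n * ternary a)) = cos (pi * (3 ^ n * ternary (\<lambda>n. a (Suc n))))"
  proof -
    have "pi * (3 ^ Suc n * ternary a) = pi * (3 ^ n * (3 * ternary a))" by simp
    also have "\<dots> = pi * (3 ^ n * (2 * of_int k + ternary (\<lambda>n. a (Suc n))))"
      by (simp only: ternary_shift[OF Suc.prems] k)
    also have "\<dots> = pi * (3 ^ n * ternary (\<lambda>n. a (Suc n))) + 2 * pi * of_int (3 ^ n * k)"
      by (simp add: algebra_simps)
    finally show ?thesis
      by (simp only: cos_add cos_int_2pin sin_int_2pin mult_1_right mult_zero_right diff_zero)
  qed
  then show ?case using Suc.IH[of "\<lambda>n. a (Suc n)"] Suc.prems by (simp add: plateau_def)
qed

text \<open>Even-indexed digits of a Cantor point become the binary digits of the real part,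
  odd-indexed ones those of the imaginary part.\<close>

definition schoenberg :: "real \<Rightarrow> complex" where
  "schoenberg t = Complex (\<Sum>n. plateau (3 ^ (2 * n) * t) / 2 ^ Suc n) (\<Sum>n. plateau (3 ^ Suc (2 * n) * t) / 2 ^ Suc n)"

lemma continuous_plateau_series:
  "continuous_on UNIV (\<lambda>t. \<Sum>n. plateau (3 ^ e n * t) / 2 ^ Suc n)"
proof -
  have geo: "summable (\<lambda>n. (1/2::real) ^ Suc n)" by (subst summable_Suc_iff) (auto intro: summable_geometric)
  have "uniform_limit UNIV (\<lambda>N t. \<Sum>n<N. plateau (3 ^ e n * t) / 2 ^ Suc n) (\<lambda>t. \<Sum>n. plateau (3 ^ e n * t) / 2 ^ Suc n) sequentially"
    by (rule Weierstrass_m_test[OF _ geo]) (auto simp: plateau_def power_one_over field_simps)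
  then show ?thesis
    by (rule uniform_limit_theorem[rotated]) (auto intro!: always_eventually continuous_intros simp: plateau_def)
qed

lemma continuous_schoenberg: "continuous_on UNIV schoenberg"
proof -
  have eq: "schoenberg = (\<lambda>t. complex_of_real (\<Sum>n. plateau (3 ^ (2 * n) * t) / 2 ^ Suc n) +
      \<i> * complex_of_real (\<Sum>n. plateau (3 ^ Suc (2 * n) * t) / 2 ^ Suc n))"
    by (simp add: schoenberg_def fun_eq_iff complex_eq_iff)
  show ?thesis unfolding eq by (intro continuous_intros continuous_plateau_series)
qed

text \<open>Digit sequence of a preimage under the curve: \<open>ternary (interleave z)\<close> is a
  measurable right inverse of \<open>schoenberg\<close> on the half-open unit square.\<close>

definition interleave :: "complex \<Rightarrow> nat \<Rightarrow> real" where
  "interleave z n = binary_digit (n div 2) (if even n then Re z else Im z)"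

lemma interleave_01: "interleave z n \<in> {0, 1}"
  unfolding interleave_def by (rule binary_digit_01)

lemma schoenberg_ternary:
  assumes "0 \<le> Re z" "Re z < 1" "0 \<le> Im z" "Im z < 1"
  shows "schoenberg (ternary (interleave z)) = z"
proof -
  have "(\<Sum>n. plateau (3 ^ (2 * n) * ternary (interleave z)) / 2 ^ Suc n) = Re z"
    unfolding plateau_ternary[OF interleave_01] using binary_digit_sums[OF assms(1,2)]
    by (simp add: interleave_def sums_iff)
  moreover have "(\<Sum>n. plateau (3 ^ Suc (2 * n) * ternary (interleave z)) / 2 ^ Suc n) = Im z"
    unfolding plateau_ternary[OF interleave_01] using binary_digit_sums[OF assms(3,4)]
    by (simp add: interleave_def sums_iff)
  ultimately show ?thesis unfolding schoenberg_def by (simp add: complex_eq_iff)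
qed

lemma ternary_interleave_measurable [measurable]: "(\<lambda>z. ternary (interleave z)) \<in> borel_measurable borel"
  unfolding ternary_def interleave_def
  by (intro borel_measurable_suminf) (measurable)

text \<open>A Borel section of Schoenberg's curve carries the measures to \<open>[0,1]\<close>, where Helly's theorem applies;
  composing test functions with the continuous curve brings the limit back.\<close>
lemma weak_limit_bounded:
  fixes l :: "nat \<Rightarrow> complex measure"
  assumes prob: "\<And>n. prob_space (l n)" and sets: "\<And>n. sets (l n) = sets borel"
    and \<rho>: "\<rho> > 0" and supp: "\<And>n. AE x in l n. \<bar>Re (x - c)\<bar> < \<rho> \<and> \<bar>Im (x - c)\<bar> < \<rho>"
  shows "\<exists>r \<mu>. strict_mono (r :: nat \<Rightarrow> nat) \<and> prob_space \<mu> \<and> sets \<mu> = sets borel \<and>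
    (\<forall>(g :: complex \<Rightarrow> complex) B. continuous_on UNIV g \<longrightarrow> (\<forall>x. cmod (g x) \<le> B) \<longrightarrow>
        (\<lambda>n. \<integral>x. g x \<partial>l (r n)) \<longlonglongrightarrow> (\<integral>x. g x \<partial>\<mu>))"
proof -
  \<comment> \<open>The square of half-side \<open>\<rho>\<close> about \<open>c\<close> is rescaled
    to the unit square and lifted to \<open>[0, 1]\<close>; the continuous map \<open>h\<close>
    undoes the lift on that square.\<close>
  define s where "s x = ternary (interleave ((x - c) / (2 * \<rho>) + Complex (1/2) (1/2)))" for x
  define h where "h t = c + 2 * \<rho> * (schoenberg t - Complex (1/2) (1/2))" for t
  have [measurable]: "s \<in> borel_measurable borel" unfolding s_def by measurable
  have hc: "continuous_on UNIV h" unfolding h_def by (intro continuous_intros continuous_schoenberg)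
  have hs: "h (s x) = x" if "\<bar>Re (x - c)\<bar> < \<rho>" "\<bar>Im (x - c)\<bar> < \<rho>" for x
  proof -
    have "schoenberg (s x) = (x - c) / (2 * \<rho>) + Complex (1/2) (1/2)"
      unfolding s_def using that \<rho> by (intro schoenberg_ternary) (auto simp: field_simps abs_less_iff)
    then show ?thesis unfolding h_def using \<rho> by simp
  qed
  have s01: "0 \<le> s x" "s x \<le> 1" for x
    unfolding s_def using ternary_nonneg[OF interleave_01] ternary_le_1[OF interleave_01] by auto
  define k where "k n = distr (l n) borel s" for n
  have sm: "s \<in> measurable (l n) borel" for n
    unfolding measurable_cong_sets[OF sets refl] by measurable
  have rd: "real_distribution (k n)" for n
    unfolding k_def by (intro real_distribution.intro prob_space.prob_space_distr prob sm)
      (auto simp: real_distribution_axioms_def)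
  have "tight k" unfolding tight_def
  proof (intro conjI allI impI)
    fix e :: real assume "e > 0"
    have "measure (k n) {-1<..1} > 1 - e" for n
    proof -
      have "-1 < s x" for x using s01(1)[of x] by linarith
      then have "s -` {-1<..1} = UNIV" using s01(2) by auto
      then have "measure (k n) {-1<..1} = measure (l n) (space (l n))"
        unfolding k_def by (subst measure_distr[OF sm]) auto
      also have "\<dots> = 1" using prob prob_space.prob_space by blast
      finally show ?thesis using \<open>e > 0\<close> by simp
    qed
    then show "\<exists>a b. a < b \<and> (\<forall>n. measure (k n) {a<..b} > 1 - e)"
      by (intro exI[of _ "-1"] exI[of _ 1]) auto
  qed (rule rd)
  then obtain r M where r: "strict_mono r" and M: "real_distribution M"
    and conv: "weak_conv_m (k \<circ> id \<circ> r) M"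
    using tight_imp_convergent_subsubsequence[of k id] by (auto simp: strict_mono_id)
  define \<mu> where "\<mu> = distr M borel h"
  interpret M: real_distribution M by fact
  have hm[measurable]: "h \<in> borel_measurable borel" by (rule borel_measurable_continuous_onI[OF hc])
  have hM: "h \<in> measurable M borel" by measurable
  have "(\<lambda>n. \<integral>x. g x \<partial>l (r n)) \<longlonglongrightarrow> (\<integral>x. g x \<partial>\<mu>)"
    if g: "continuous_on UNIV g" "\<And>x. cmod (g x) \<le> B" for g :: "complex \<Rightarrow> complex" and B
  proof -
    have gm[measurable]: "g \<in> borel_measurable borel" by (rule borel_measurable_continuous_onI[OF g(1)])
    have "continuous_on UNIV (g \<circ> h)"
      by (intro continuous_on_compose hc continuous_on_subset[OF g(1)]) auto
    then have ic: "isCont (\<lambda>t. g (h t)) x" for x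
      by (auto simp: continuous_on_eq_continuous_at o_def)
    have "weak_conv_m (\<lambda>n. k (r n)) M" using conv by (simp add: o_def)
    then have "(\<lambda>n. integral\<^sup>L (k (r n)) (\<lambda>t. g (h t))) \<longlonglongrightarrow> integral\<^sup>L M (\<lambda>t. g (h t))"
      using rd M ic g(2) by (intro weak_conv_imp_integral_bdd_continuous_conv) auto
    moreover have "integral\<^sup>L (k (r n)) (\<lambda>t. g (h t)) = (\<integral>x. g x \<partial>l (r n))" for n
    proof -
      have "integral\<^sup>L (k (r n)) (\<lambda>t. g (h t)) = (\<integral>x. g (h (s x)) \<partial>l (r n))"
        unfolding k_def by (rule integral_distr[OF sm]) measurable
      also have "\<dots> = (\<integral>x. g x \<partial>l (r n))"
      proof (rule integral_cong_AE)
        show "AE x in l (r n). g (h (s x)) = g x"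
          using supp[of "r n"] by eventually_elim (simp add: hs)
      qed (simp_all add: measurable_cong_sets[OF sets refl])
      finally show ?thesis by simp
    qed
    moreover have "integral\<^sup>L M (\<lambda>t. g (h t)) = (\<integral>x. g x \<partial>\<mu>)"
      unfolding \<mu>_def by (rule integral_distr[OF hM gm, symmetric])
    ultimately show ?thesis by simp
  qed
  moreover have "prob_space \<mu>" unfolding \<mu>_def by (rule M.prob_space_distr[OF hM])
  moreover have "sets \<mu> = sets borel" by (simp add: \<mu>_def)
  ultimately show ?thesis using r by blast
qed

text \<open>Around a point outside \<open>A\<close>, a tent function vanishing on \<open>A\<close>
  integrates to 0 against every late \<open>l n\<close>, hence against \<open>\<mu>\<close>, so a
  ball about the point is null.\<close>

lemma AE_weak_limit_closed:
  fixes \<mu> :: "complex measure" and l :: "nat \<Rightarrow> complex measure"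
  assumes \<mu>: "prob_space \<mu>" "sets \<mu> = sets borel"
    and conv: "\<And>g :: complex \<Rightarrow> complex. continuous_on UNIV g \<Longrightarrow> (\<And>x. cmod (g x) \<le> 1) \<Longrightarrow>
        (\<lambda>n. \<integral>x. g x \<partial>l n) \<longlonglongrightarrow> (\<integral>x. g x \<partial>\<mu>)"
    and A: "closed A" "\<And>n. n \<ge> n0 \<Longrightarrow> AE x in l n. x \<in> A"
  shows "measure_support \<mu> \<subseteq> A"
proof
  fix x assume x: "x \<in> measure_support \<mu>"
  interpret prob_space \<mu> by fact
  show "x \<in> A"
  proof (rule ccontr)
    assume "x \<notin> A"
    then obtain e where "e > 0" "ball x e \<subseteq> - A"
      using A(1) open_contains_ball[of "- A"] by (auto simp: closed_def)
    then have e: "e > 0" "ball x e \<inter> A = {}" by auto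
    \<comment> \<open>Capping the radius at 1 keeps the tent within the bound 1 demanded by
      \<open>conv\<close>.\<close>
    define e' where "e' = min e 1"
    define g where "g y = max 0 (e' - dist x y)" for y
    have e': "0 < e'" "e' \<le> 1" "e' \<le> e" using e by (auto simp: e'_def)
    have gb: "0 \<le> g y" "g y \<le> 1" for y using e' by (auto simp: g_def max_def intro: order_trans[OF _ e'(2)])
    have gc: "continuous_on UNIV g" unfolding g_def by (intro continuous_intros)
    have gm: "g \<in> borel_measurable \<mu>"
      unfolding measurable_cong_sets[OF \<mu>(2) refl] by (rule borel_measurable_continuous_onI[OF gc])
    have "(\<lambda>n. \<integral>y. complex_of_real (g y) \<partial>l n) \<longlonglongrightarrow> (\<integral>y. complex_of_real (g y) \<partial>\<mu>)"
      using gb by (intro conv continuous_intros gc) auto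
    moreover have "(\<integral>y. complex_of_real (g y) \<partial>l n) = 0" if "n \<ge> n0" for n
    proof -
      have "AE y in l n. g y = 0"
        using A(2)[OF that]
      proof eventually_elim
        fix y assume "y \<in> A"
        then have "y \<notin> ball x e" using e by auto
        then show "g y = 0" using e' by (auto simp: g_def)
      qed
      then have "AE y in l n. complex_of_real (g y) = 0" by eventually_elim simp
      then show ?thesis by (rule integral_eq_zero_AE)
    qed
    then have "eventually (\<lambda>n. (\<integral>y. complex_of_real (g y) \<partial>l n) = 0) sequentially"
      by (auto simp: eventually_sequentially)
    then have "(\<lambda>n. \<integral>y. complex_of_real (g y) \<partial>l n) \<longlonglongrightarrow> 0" by (rule tendsto_eventually)
    ultimately have "(\<integral>y. complex_of_real (g y) \<partial>\<mu>) = 0" using LIMSEQ_unique by blast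
    then have "(\<integral>y. g y \<partial>\<mu>) = 0" by simp
    moreover have "integrable \<mu> g"
      by (rule integrable_const_bound[where B = 1]) (use gb gm in auto)
    ultimately have "AE y in \<mu>. g y = 0"
      using integral_nonneg_eq_0_iff_AE[of \<mu> g] gb by auto
    then have "AE y in \<mu>. y \<notin> ball x e'" by eventually_elim (use e' in \<open>auto simp: g_def\<close>)
    then have "emeasure \<mu> (ball x e') = 0"
      using AE_iff_measurable[of "ball x e'" \<mu> "\<lambda>y. y \<notin> ball x e'"] \<mu>(2) sets_eq_imp_space_eq[OF \<mu>(2)]
      by (auto simp: ball_def)
    then show False using x e' by (auto simp: measure_support_def)
  qed
qed

subsection \<open>Kaufman's construction\<close>

text \<open>Since \<open>k \<bullet> (q * x) = (cnj q * k) \<bullet> x\<close>, the Fourier series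
  of the bump at \<open>q * x\<close> shifts the transform of \<open>lam\<close> by multiples of
  \<open>cnj q\<close>. Bounded partial sums allow dominated convergence; absolute summation over
  the lattice is deferred to the estimates.\<close>

lemma fourier_kernel_average:
  fixes \<Phi> :: "complex \<Rightarrow> real" and w :: "complex \<Rightarrow> real"
  assumes lam: "prob_space lam" "sets lam = sets borel"
    and \<Phi>m: "\<Phi> \<in> borel_measurable borel" and \<Phi>b: "\<And>y. 0 \<le> \<Phi> y" "\<And>y. \<Phi> y \<le> B"
    and part: "\<And>N y. cmod (\<Sum>k\<in>gbox N. of_real (w k) * cis (2 * pi * (k \<bullet> y))) \<le> B"
    and lim: "\<And>y. (\<lambda>N. \<Sum>k\<in>gbox N. of_real (w k) * cis (2 * pi * (k \<bullet> y))) \<longlonglongrightarrow> complex_of_real (\<Phi> y)"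
  shows "(\<lambda>N. (\<Sum>q\<in>Q. \<Sum>k\<in>gbox N. of_real (w k) * fourier_measure lam (\<xi> - cnj q * k)) / of_nat (card Q))
     \<longlonglongrightarrow> (\<integral>x. of_real ((\<Sum>q\<in>Q. \<Phi> (q * x)) / real (card Q)) * cis (- 2 * pi * (\<xi> \<bullet> x)) \<partial>lam)"
proof -
  interpret prob_space lam by fact
  have meas: "f \<in> borel_measurable lam" if "f \<in> borel_measurable borel" for f :: "complex \<Rightarrow> complex"
    using that unfolding measurable_cong_sets[OF lam(2) refl] .
  have \<Phi>q: "(\<lambda>x. complex_of_real (\<Phi> (q * x))) \<in> borel_measurable lam" for q
  proof (rule meas)
    have [measurable]: "(\<lambda>x. \<Phi> (q * x)) \<in> borel_measurable borel"
      by (rule measurable_compose[OF _ \<Phi>m]) measurable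
    show "(\<lambda>x. complex_of_real (\<Phi> (q * x))) \<in> borel_measurable borel" by measurable
  qed
  have cism: "(\<lambda>x. cis (t * (\<eta> \<bullet> x))) \<in> borel_measurable lam" for t and \<eta> :: complex
    by (intro meas borel_measurable_continuous_onI continuous_intros)
  have cisi: "integrable lam (\<lambda>x. cis (t * (\<eta> \<bullet> x)))" for t and \<eta> :: complex
    by (rule integrable_const_bound[where B = 1]) (use cism in auto)
  have one: "(\<lambda>N. \<Sum>k\<in>gbox N. of_real (w k) * fourier_measure lam (\<xi> - cnj q * k))
      \<longlonglongrightarrow> (\<integral>x. of_real (\<Phi> (q * x)) * cis (- 2 * pi * (\<xi> \<bullet> x)) \<partial>lam)" for q
  proof -
    define s where "s N x = (\<Sum>k\<in>gbox N. of_real (w k) * cis (2 * pi * (k \<bullet> (q * x)))) * cis (- 2 * pi * (\<xi> \<bullet> x))" for N x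
    have phase: "cis (2 * pi * (k \<bullet> (q * x))) * cis (- 2 * pi * (\<xi> \<bullet> x)) = cis (- 2 * pi * ((\<xi> - cnj q * k) \<bullet> x))" for k x
      unfolding cis_mult by (rule arg_cong[where f = cis]) (simp add: inner_complex_def algebra_simps)
    have seq: "s N x = (\<Sum>k\<in>gbox N. of_real (w k) * cis (- 2 * pi * ((\<xi> - cnj q * k) \<bullet> x)))" for N x
      unfolding s_def sum_distrib_right
    proof (rule sum.cong[OF refl])
      fix k
      show "of_real (w k) * cis (2 * pi * (k \<bullet> (q * x))) * cis (- 2 * pi * (\<xi> \<bullet> x)) =
          of_real (w k) * cis (- 2 * pi * ((\<xi> - cnj q * k) \<bullet> x))"
        unfolding mult.assoc[of "complex_of_real (w k)"] phase ..
    qed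
    have "(\<lambda>N. \<integral>x. s N x \<partial>lam) \<longlonglongrightarrow> (\<integral>x. of_real (\<Phi> (q * x)) * cis (- 2 * pi * (\<xi> \<bullet> x)) \<partial>lam)"
    proof (rule integral_dominated_convergence[where w = "\<lambda>_. B"])
      show "(\<lambda>x. of_real (\<Phi> (q * x)) * cis (- 2 * pi * (\<xi> \<bullet> x))) \<in> borel_measurable lam"
        by (intro borel_measurable_times cism \<Phi>q)
      show "s N \<in> borel_measurable lam" for N
        unfolding seq[abs_def] by (intro borel_measurable_sum borel_measurable_times cism) auto
      show "AE x in lam. (\<lambda>N. s N x) \<longlonglongrightarrow> of_real (\<Phi> (q * x)) * cis (- 2 * pi * (\<xi> \<bullet> x))"
        unfolding s_def by (intro AE_I2 tendsto_mult lim tendsto_const)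
      show "AE x in lam. cmod (s N x) \<le> B" for N
        unfolding s_def norm_mult norm_cis mult_1_right by (intro AE_I2 part)
    qed auto
    moreover have "(\<integral>x. s N x \<partial>lam) = (\<Sum>k\<in>gbox N. of_real (w k) * fourier_measure lam (\<xi> - cnj q * k))" for N
    proof -
      have "integrable lam (\<lambda>x. complex_of_real (w k) * cis (- 2 * pi * (\<eta> \<bullet> x)))" for k \<eta>
        by (intro integrable_mult_right cisi)
      then show ?thesis
        unfolding seq fourier_measure_def by (subst Bochner_Integration.integral_sum) simp_all
    qed
    ultimately show ?thesis by simp
  qed
  have int: "integrable lam (\<lambda>x. of_real (\<Phi> (q * x)) * cis (- 2 * pi * (\<xi> \<bullet> x)))" for q
  proof (rule integrable_const_bound[where B = B])
    show "(\<lambda>x. of_real (\<Phi> (q * x)) * cis (- 2 * pi * (\<xi> \<bullet> x))) \<in> borel_measurable lam"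
      by (intro borel_measurable_times cism \<Phi>q)
    show "AE x in lam. cmod (of_real (\<Phi> (q * x)) * cis (- 2 * pi * (\<xi> \<bullet> x))) \<le> B"
      using \<Phi>b by (simp add: norm_mult)
  qed
  have "(\<integral>x. of_real ((\<Sum>q\<in>Q. \<Phi> (q * x)) / real (card Q)) * cis (- 2 * pi * (\<xi> \<bullet> x)) \<partial>lam) =
      (\<integral>x. (\<Sum>q\<in>Q. of_real (\<Phi> (q * x)) * cis (- 2 * pi * (\<xi> \<bullet> x))) / of_nat (card Q) \<partial>lam)"
    by (simp add: sum_distrib_right)
  also have "\<dots> = (\<Sum>q\<in>Q. \<integral>x. of_real (\<Phi> (q * x)) * cis (- 2 * pi * (\<xi> \<bullet> x)) \<partial>lam) / of_nat (card Q)"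
    using int by (subst integral_divide_zero) (simp add: Bochner_Integration.integral_sum)
  finally have eq: "(\<integral>x. of_real ((\<Sum>q\<in>Q. \<Phi> (q * x)) / real (card Q)) * cis (- 2 * pi * (\<xi> \<bullet> x)) \<partial>lam) =
    (\<Sum>q\<in>Q. \<integral>x. of_real (\<Phi> (q * x)) * cis (- 2 * pi * (\<xi> \<bullet> x)) \<partial>lam) / of_nat (card Q)" .
  show ?thesis
  proof (cases "card Q = 0")
    case False
    then show ?thesis unfolding eq by (intro tendsto_divide tendsto_sum one tendsto_const) simp
  qed simp
qed

text \<open>The terms \<open>k = 0\<close> reproduce \<open>f \<xi>\<close> because
  \<open>w 0 = 1\<close>; the others are grouped by \<open>l = cnj q * k\<close>. As
  \<open>T\<close> is the largest possible modulus of \<open>q\<close> divided by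
  \<open>\<delta>\<close>, one has \<open>cmod l / T \<le> \<delta> * cmod k\<close>, so the weight
  is controlled by \<open>l\<close> alone.\<close>

lemma discrepancy_bound:
  fixes w :: "complex \<Rightarrow> real"
  assumes j: "j \<ge> 1" and Qne: "gprimes j \<noteq> {}" and \<delta>: "\<delta> > 0"
    and w0: "w 0 = 1" and w: "\<And>k. k \<in> gaussian_ints \<Longrightarrow> \<bar>w k\<bar> \<le> (A / (1 + \<delta> * cmod k)) ^ n" and A: "A \<ge> 0"
  defines "T \<equiv> sqrt (2 * 2 ^ j) / \<delta>"
  shows "\<exists>L. finite L \<and> L \<subseteq> {l \<in> gaussian_ints. (cmod l)\<^sup>2 > 2 ^ j} \<and>
    cmod ((\<Sum>q\<in>gprimes j. \<Sum>k\<in>gbox N. of_real (w k) * f (\<xi> - cnj q * k)) / of_nat (card (gprimes j)) - f \<xi>)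
    \<le> (\<Sum>l\<in>L. 8 * ln (cmod l) / (ln (2 ^ j) * real (card (gprimes j))) * (A / (1 + cmod l / T)) ^ n * cmod (f (\<xi> - l)))"
proof -
  define Q where "Q = gprimes j"
  have finQ: "finite Q" unfolding Q_def by (rule finite_gprimes)
  have cQ: "card Q > 0" using finQ Qne by (simp add: Q_def card_gt_0_iff)
  have QG: "q \<in> gaussian_ints" and Qirr: "girred q" and Qx: "2 ^ j < gnorm q" "gnorm q \<le> 2 * 2 ^ j" if "q \<in> Q" for q
    using that by (auto simp: Q_def gprimes_def girred_def)
  have Q2: "2 ^ j < (cmod q)\<^sup>2" "(cmod q)\<^sup>2 \<le> 2 * 2 ^ j" if "q \<in> Q" for q
  proof -
    have "real (2 ^ j) < real (gnorm q)" "real (gnorm q) \<le> real (2 * 2 ^ j)"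
      using Qx[OF that] by (simp_all only: of_nat_less_iff of_nat_le_iff)
    then show "2 ^ j < (cmod q)\<^sup>2" "(cmod q)\<^sup>2 \<le> 2 * 2 ^ j" by (simp_all add: of_nat_gnorm[OF QG[OF that]])
  qed
  have Q0: "q \<noteq> 0" if "q \<in> Q" for q
  proof
    assume "q = 0"
    then have "(2::real) ^ j < 0" using Q2(1)[OF that] by simp
    then show False by (simp add: not_less[symmetric])
  qed
  define K where "K = gbox N - {0}"
  have finK: "finite K" by (simp add: K_def)
  have KG: "k \<in> gaussian_ints" "k \<noteq> 0" if "k \<in> K" for k using that gbox_gaussian by (auto simp: K_def)
  define P where "P = Q \<times> K"
  define h where "h = (\<lambda>(q, k). cnj q * k :: complex)"
  define L where "L = h ` P"
  have finP: "finite P" using finQ finK by (simp add: P_def)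
  have LG: "l \<in> gaussian_ints" "(cmod l)\<^sup>2 > 2 ^ j" "l \<noteq> 0" if lL: "l \<in> L" for l
  proof -
    obtain q k where qk: "q \<in> Q" "k \<in> K" "l = cnj q * k" using lL by (auto simp: L_def P_def h_def)
    show "l \<in> gaussian_ints" using qk KG QG by (simp add: gaussian_ints_mult gaussian_ints_cnj)
    show "l \<noteq> 0" using qk KG Q0 by auto
    have "1 \<le> (cmod k)\<^sup>2" using gaussian_norm_ge_1 KG[OF qk(2)] by (simp add: one_le_power)
    then have "(cmod q)\<^sup>2 * 1 \<le> (cmod q)\<^sup>2 * (cmod k)\<^sup>2" by (intro mult_left_mono) auto
    then show "(cmod l)\<^sup>2 > 2 ^ j" using Q2(1)[OF qk(1)] by (simp add: qk(3) norm_mult power_mult_distrib)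
  qed
  define D where "D = (\<Sum>q\<in>Q. \<Sum>k\<in>gbox N. of_real (w k) * f (\<xi> - cnj q * k)) / of_nat (card Q) - f \<xi>"
  have "(\<Sum>k\<in>gbox N. of_real (w k) * f (\<xi> - cnj q * k)) = f \<xi> + (\<Sum>k\<in>K. of_real (w k) * f (\<xi> - cnj q * k))" for q
    unfolding K_def by (subst sum.remove[of _ 0]) (auto simp: w0)
  then have "D = (\<Sum>q\<in>Q. \<Sum>k\<in>K. of_real (w k) * f (\<xi> - cnj q * k)) / of_nat (card Q)"
    unfolding D_def using cQ by (simp add: sum.distrib add_divide_distrib)
  then have "D = (\<Sum>z\<in>P. of_real (w (snd z)) * f (\<xi> - h z)) / of_nat (card Q)"
    unfolding P_def h_def by (simp add: sum.cartesian_product case_prod_unfold)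
  then have "cmod D = cmod (\<Sum>z\<in>P. of_real (w (snd z)) * f (\<xi> - h z)) / card Q"
    by (simp add: norm_divide)
  also have "\<dots> \<le> (\<Sum>z\<in>P. \<bar>w (snd z)\<bar> * cmod (f (\<xi> - h z))) / card Q"
    by (intro divide_right_mono sum_norm_le) (auto simp: norm_mult)
  also have "(\<Sum>z\<in>P. \<bar>w (snd z)\<bar> * cmod (f (\<xi> - h z))) = (\<Sum>l\<in>L. \<Sum>z\<in>{z\<in>P. h z = l}. \<bar>w (snd z)\<bar> * cmod (f (\<xi> - h z)))"
    unfolding L_def by (rule sum.image_gen[OF finP])
  also have "\<dots> \<le> (\<Sum>l\<in>L. 8 * ln (cmod l) / ln (2 ^ j) * ((A / (1 + cmod l / T)) ^ n * cmod (f (\<xi> - l))))"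
  proof (rule sum_mono)
    fix l assume l: "l \<in> L"
    have trm: "\<bar>w (snd z)\<bar> * cmod (f (\<xi> - h z)) \<le> (A / (1 + cmod l / T)) ^ n * cmod (f (\<xi> - l))"
      if z: "z \<in> {z\<in>P. h z = l}" for z
    proof -
      obtain q k where qk: "z = (q, k)" "q \<in> Q" "k \<in> K" "cnj q * k = l" using z by (auto simp: P_def h_def)
      have "cmod q \<le> sqrt (2 * 2 ^ j)" using Q2(2)[OF qk(2)] by (rule real_le_rsqrt)
      then have "cmod l \<le> sqrt (2 * 2 ^ j) * cmod k"
        by (simp add: qk(4)[symmetric] norm_mult mult_right_mono)
      then have "cmod l / T \<le> \<delta> * cmod k" using \<delta> by (simp add: T_def field_simps)
      moreover have "0 \<le> cmod l / T" using \<delta> by (simp add: T_def)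
      ultimately have "(A / (1 + \<delta> * cmod k)) ^ n \<le> (A / (1 + cmod l / T)) ^ n"
        using A by (intro power_mono divide_left_mono mult_pos_pos) auto
      then have "\<bar>w k\<bar> \<le> (A / (1 + cmod l / T)) ^ n" using w[OF KG(1)[OF qk(3)]] by linarith
      then show ?thesis using qk by (simp add: h_def mult_right_mono)
    qed
    \<comment> \<open>Given \<open>l\<close>, the prime \<open>q\<close> determines
      \<open>k\<close>, so the fibre injects into the primes of the shell dividing
      \<open>cnj l\<close>.\<close>
    have "card {z\<in>P. h z = l} \<le> card {q \<in> Q. gdvd q (cnj l)}"
    proof (rule card_inj_on_le[of fst])
      show "inj_on fst {z\<in>P. h z = l}"
        using Q0 by (auto simp: inj_on_def P_def h_def)
      show "fst ` {z\<in>P. h z = l} \<subseteq> {q \<in> Q. gdvd q (cnj l)}"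
        using KG by (auto simp: P_def h_def gdvd_def intro!: bexI[of _ "cnj _"] gaussian_ints_cnj)
    qed (use finQ in auto)
    then have "real (card {z\<in>P. h z = l}) * ln (2 ^ j) \<le> real (card {q \<in> Q. gdvd q (cnj l)}) * ln (2 ^ j)"
      by (intro mult_right_mono) auto
    also have "\<dots> \<le> 4 * ln (real (gnorm (cnj l)))"
    proof -
      have "(1::nat) < 2 ^ j" using j by (intro one_less_power) auto
      from card_prime_divisors[OF this, of Q "cnj l"] show ?thesis
        using Qirr Qx LG[OF l] by (simp add: gaussian_ints_cnj)
    qed
    \<comment> \<open>The norm is the square of the modulus, which doubles the 4.\<close>
    also have "\<dots> = 8 * ln (cmod l)"
      using LG[OF l] by (simp add: of_nat_gnorm gaussian_ints_cnj ln_realpow)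
    finally have "real (card {z\<in>P. h z = l}) * ln (2 ^ j) \<le> 8 * ln (cmod l)" .
    moreover have "ln (2 ^ j) > (0::real)" using j by (simp add: ln_realpow)
    ultimately have c: "real (card {z\<in>P. h z = l}) \<le> 8 * ln (cmod l) / ln (2 ^ j)"
      by (simp add: pos_le_divide_eq)
    have "(\<Sum>z\<in>{z\<in>P. h z = l}. \<bar>w (snd z)\<bar> * cmod (f (\<xi> - h z))) \<le>
        real (card {z\<in>P. h z = l}) * ((A / (1 + cmod l / T)) ^ n * cmod (f (\<xi> - l)))"
      by (rule sum_bounded_above[OF trm])
    also have "\<dots> \<le> 8 * ln (cmod l) / ln (2 ^ j) * ((A / (1 + cmod l / T)) ^ n * cmod (f (\<xi> - l)))"
      using c A \<delta> by (intro mult_right_mono) (auto simp: T_def)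
    finally show "(\<Sum>z\<in>{z\<in>P. h z = l}. \<bar>w (snd z)\<bar> * cmod (f (\<xi> - h z))) \<le> \<dots>" .
  qed
  finally have "cmod D \<le> (\<Sum>l\<in>L. 8 * ln (cmod l) / ln (2 ^ j) * ((A / (1 + cmod l / T)) ^ n * cmod (f (\<xi> - l)))) / card Q"
    by (simp add: divide_right_mono)
  also have "\<dots> = (\<Sum>l\<in>L. 8 * ln (cmod l) / (ln (2 ^ j) * real (card Q)) * (A / (1 + cmod l / T)) ^ n * cmod (f (\<xi> - l)))"
    unfolding sum_divide_distrib by (intro sum.cong refl) (simp add: field_simps)
  finally show ?thesis
    using finP LG unfolding D_def Q_def by (intro exI[of _ L]) (auto simp: L_def)
qed

text \<open>Decay of order \<open>s\<close> with three logarithms: one from the number of prime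
  divisors of a frequency, two from exchanging powers of \<open>j\<close> for \<open>ln\<close> in
  \<open>coefficient_bound\<close>. The summand 1 makes the value at \<open>u = 1\<close> equal to
  1, so that frequency 0 is covered.\<close>

definition profile :: "real \<Rightarrow> real \<Rightarrow> real" where
  "profile s u = u powr (- s) * (1 + ln u) ^ 3"

lemma profile_nonneg: "u \<ge> 1 \<Longrightarrow> 0 \<le> profile s u"
  by (simp add: profile_def)

text \<open>Bounding \<open>ln v\<close> by \<open>(3 / s) * v powr (s / 3)\<close> makes the cube
  cost exactly \<open>v powr s\<close>.\<close>

lemma profile_le:
  assumes "s > 0" "v \<ge> 1" shows "profile s v \<le> (1 + 3 / s) ^ 3"
proof -
  have "ln v \<le> v powr (s / 3) / (s / 3)" using assms by (intro ln_powr_bound) auto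
  moreover have "1 \<le> v powr (s / 3)" using assms by (simp add: ge_one_powr_ge_zero)
  ultimately have "1 + ln v \<le> (1 + 3 / s) * v powr (s / 3)"
    using assms by (simp add: algebra_simps)
  then have "(1 + ln v) ^ 3 \<le> ((1 + 3 / s) * v powr (s / 3)) ^ 3" using assms by (intro power_mono) auto
  also have "\<dots> = (1 + 3 / s) ^ 3 * v powr s"
    using assms by (simp add: power_mult_distrib powr_power)
  finally have "v powr (- s) * (1 + ln v) ^ 3 \<le> v powr (- s) * ((1 + 3 / s) ^ 3 * v powr s)"
    by (intro mult_left_mono) auto
  also have "\<dots> = (1 + 3 / s) ^ 3" using assms by (simp add: powr_minus field_simps)
  finally show ?thesis unfolding profile_def .
qed

text \<open>Near-monotonicity: write \<open>t = (u / 2) * v\<close> with \<open>v \<ge> 1\<close>.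
  The factor \<open>1 + ln\<close> is submultiplicative, and the \<open>v\<close> part is bounded by
  \<open>profile_le\<close>.\<close>

lemma profile_half:
  assumes s: "s > 0" and t: "t \<ge> 1" and u: "u \<ge> 1" and tu: "t \<ge> u / 2"
  shows "ln t ^ 3 * t powr (- s) \<le> 2 powr s * (1 + 3 / s) ^ 3 * profile s u"
proof -
  define v where "v = t / (u / 2)"
  have v: "v \<ge> 1" using tu u by (simp add: v_def field_simps)
  have tv: "t = u / 2 * v" using u by (simp add: v_def)
  have tp: "t powr (- s) = 2 powr s * u powr (- s) * v powr (- s)"
    using u v by (simp add: tv powr_mult powr_divide powr_minus field_simps)
  have "ln t = ln u - ln 2 + ln v" using u v by (simp add: tv ln_mult ln_div)
  also have "\<dots> \<le> ln u + ln v" by simp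
  also have "\<dots> \<le> (1 + ln u) * (1 + ln v)" using u v by (simp add: algebra_simps)
  finally have "ln t ^ 3 \<le> ((1 + ln u) * (1 + ln v)) ^ 3" using t by (intro power_mono) auto
  then have "ln t ^ 3 * t powr (- s) \<le> ((1 + ln u) * (1 + ln v)) ^ 3 * t powr (- s)"
    by (intro mult_right_mono) auto
  also have "\<dots> = ((1 + ln u) * (1 + ln v)) ^ 3 * (2 powr s * u powr (- s) * v powr (- s))"
    unfolding tp ..
  also have "((1 + ln u) * (1 + ln v)) ^ 3 * (2 powr s * u powr (- s) * v powr (- s)) = 2 powr s * profile s v * profile s u"
    unfolding profile_def power_mult_distrib by (simp only: mult_ac)
  also have "\<dots> \<le> 2 powr s * (1 + 3 / s) ^ 3 * profile s u"
    using profile_le[OF s v] u by (intro mult_right_mono mult_left_mono profile_nonneg) auto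
  finally show ?thesis .
qed

text \<open>The two extra powers of decay of the Fourier transform pay for the frequencies \<open>l\<close> much smaller than \<open>\<xi>\<close>.\<close>
lemma profile_convolution:
  assumes s: "0 < s" "s \<le> 2" and l: "cmod l \<ge> 1"
  shows "ln (cmod l) ^ 3 * cmod l powr (- s) / (1 + cmod (\<xi> - l))\<^sup>2 \<le>
    (2 powr s + 4) * (1 + 3 / s) ^ 3 * profile s (max 1 (cmod \<xi>))"
proof -
  define u where "u = max 1 (cmod \<xi>)"
  define M where "M = (1 + 3 / s) ^ 3"
  define d where "d = (1 + cmod (\<xi> - l))\<^sup>2"
  have u: "u \<ge> 1" by (simp add: u_def)
  have M: "M \<ge> 0" using s by (simp add: M_def)
  have d: "d \<ge> 1" unfolding d_def by (simp add: one_le_power)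
  have g0: "0 \<le> ln (cmod l) ^ 3 * cmod l powr (- s)" using l by simp
  have p0: "0 \<le> profile s u" by (rule profile_nonneg[OF u])
  show ?thesis
  proof (cases "cmod l \<ge> u / 2")
    case True
    have "ln (cmod l) ^ 3 * cmod l powr (- s) / d \<le> ln (cmod l) ^ 3 * cmod l powr (- s) / 1"
      using g0 d by (intro divide_left_mono) auto
    also have "\<dots> \<le> 2 powr s * M * profile s u" using profile_half[OF s(1) l u True] by (simp add: M_def)
    also have "\<dots> \<le> (2 powr s + 4) * M * profile s u" using M p0 by (intro mult_right_mono) auto
    finally show ?thesis by (simp add: d_def M_def u_def)
  next
    case False
    then have \<xi>: "u = cmod \<xi>" using l by (auto simp: u_def)
    have "cmod \<xi> \<le> cmod (\<xi> - l) + cmod l" by (metis diff_add_cancel norm_triangle_ineq)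
    then have "u / 2 \<le> 1 + cmod (\<xi> - l)" using False \<xi> by simp
    then have d2: "(u / 2)\<^sup>2 \<le> d" unfolding d_def using u by (intro power_mono) auto
    have "ln (cmod l) ^ 3 * cmod l powr (- s) \<le> profile s (cmod l)"
      unfolding profile_def using l by (simp add: mult.commute power_mono mult_left_mono)
    also have "\<dots> \<le> M" unfolding M_def by (rule profile_le[OF s(1) l])
    finally have "ln (cmod l) ^ 3 * cmod l powr (- s) / d \<le> M / (u / 2)\<^sup>2"
      using d2 u M g0 by (intro frac_le) auto
    also have "\<dots> = 4 * M * u powr (- 2)" using u by (simp add: powr_minus powr_numeral field_simps)
    also have "\<dots> \<le> 4 * M * (u powr (- s) * 1)" using s u M by (intro mult_left_mono) (auto intro: powr_mono)
    also have "\<dots> \<le> 4 * M * profile s u"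
      unfolding profile_def using u M by (intro mult_left_mono) (auto simp: one_le_power)
    also have "\<dots> \<le> (2 powr s + 4) * M * profile s u" using M p0 by (intro mult_right_mono) auto
    finally show ?thesis by (simp add: d_def M_def u_def)
  qed
qed

text \<open>The larger of \<open>cmod l\<close> and \<open>cmod (\<xi> - l)\<close> is at least half
  of \<open>cmod \<xi>\<close> and supplies the sixth power; four powers of the other factor are
  summed over the lattice. This is how decay of order 6 survives a step.\<close>

lemma inverse_power_convolution:
  "\<exists>C\<ge>0. \<forall>\<xi>. \<forall>A\<subseteq>gaussian_ints. finite A \<longrightarrow>
     (\<Sum>l\<in>A. 1 / (1 + cmod l) ^ 6 * (1 / (1 + cmod (\<xi> - l)) ^ 6)) \<le> C / (1 + cmod \<xi>) ^ 6"
proof -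
  obtain C where C: "C \<ge> 0" "\<And>\<xi> A. A \<subseteq> gaussian_ints \<Longrightarrow> finite A \<Longrightarrow> (\<Sum>l\<in>A. 1 / (1 + cmod (\<xi> - l)) ^ 4) \<le> C"
    using lattice_sum_bound by blast
  have le: "1 / (1 + a) ^ 6 * (1 / (1 + b) ^ 6) \<le> 2 ^ 6 / (1 + c) ^ 6 * (1 / (1 + a) ^ 4 + 1 / (1 + b) ^ 4)"
    if "0 \<le> a" "0 \<le> b" "0 \<le> c" "c \<le> a + b" for a b c :: real
  proof -
    have *: "1 / (1 + a) ^ 6 * (1 / (1 + b) ^ 6) \<le> 2 ^ 6 / (1 + c) ^ 6 * (1 / (1 + a) ^ 4 + 1 / (1 + b) ^ 4)"
      if "a \<le> b" "0 \<le> a" "c \<le> a + b" "0 \<le> c" for a b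
    proof -
      have "1 + c \<le> 2 * (1 + b)" using that by simp
      then have "(1 + c) ^ 6 \<le> 2 ^ 6 * (1 + b) ^ 6"
        unfolding power_mult_distrib[symmetric] using that by (intro power_mono) auto
      then have "1 / (1 + b) ^ 6 \<le> 2 ^ 6 / (1 + c) ^ 6"
        using that by (simp add: divide_simps mult.commute)
      moreover have "1 / (1 + a) ^ 6 \<le> 1 / (1 + a) ^ 4"
        using that by (intro divide_left_mono power_increasing) auto
      ultimately have "1 / (1 + a) ^ 6 * (1 / (1 + b) ^ 6) \<le> 1 / (1 + a) ^ 4 * (2 ^ 6 / (1 + c) ^ 6)"
        using that by (intro mult_mono) auto
      also have "\<dots> = 2 ^ 6 / (1 + c) ^ 6 * (1 / (1 + a) ^ 4)" by (rule mult.commute)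
      also have "\<dots> \<le> 2 ^ 6 / (1 + c) ^ 6 * (1 / (1 + a) ^ 4 + 1 / (1 + b) ^ 4)"
        using that by (intro mult_left_mono) auto
      finally show ?thesis .
    qed
    show ?thesis
      using *[of a b] *[of b a] that by (cases "a \<le> b") (auto simp: ac_simps)
  qed
  have "(\<Sum>l\<in>A. 1 / (1 + cmod l) ^ 6 * (1 / (1 + cmod (\<xi> - l)) ^ 6)) \<le> (2 ^ 6 * (2 * C)) / (1 + cmod \<xi>) ^ 6"
    if A: "A \<subseteq> gaussian_ints" "finite A" for A \<xi>
  proof -
    have "(\<Sum>l\<in>A. 1 / (1 + cmod l) ^ 6 * (1 / (1 + cmod (\<xi> - l)) ^ 6)) \<le>
        (\<Sum>l\<in>A. 2 ^ 6 / (1 + cmod \<xi>) ^ 6 * (1 / (1 + cmod (0 - l)) ^ 4 + 1 / (1 + cmod (\<xi> - l)) ^ 4))"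
    proof (rule sum_mono)
      fix l
      have "cmod \<xi> \<le> cmod l + cmod (\<xi> - l)" by (metis add.commute diff_add_cancel norm_triangle_ineq)
      then show "1 / (1 + cmod l) ^ 6 * (1 / (1 + cmod (\<xi> - l)) ^ 6) \<le>
          2 ^ 6 / (1 + cmod \<xi>) ^ 6 * (1 / (1 + cmod (0 - l)) ^ 4 + 1 / (1 + cmod (\<xi> - l)) ^ 4)"
        using le[of "cmod l" "cmod (\<xi> - l)" "cmod \<xi>"] by simp
    qed
    also have "\<dots> = 2 ^ 6 / (1 + cmod \<xi>) ^ 6 * ((\<Sum>l\<in>A. 1 / (1 + cmod (0 - l)) ^ 4) + (\<Sum>l\<in>A. 1 / (1 + cmod (\<xi> - l)) ^ 4))"
      by (simp add: sum_distrib_left sum.distrib distrib_left)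
    also have "\<dots> \<le> 2 ^ 6 / (1 + cmod \<xi>) ^ 6 * (C + C)"
      by (intro mult_left_mono add_mono C(2)[OF A]) simp
    finally show ?thesis by (simp only: mult_2 times_divide_eq_left)
  qed
  then show ?thesis using C(1) by (intro exI[of _ "2 ^ 6 * (2 * C)"]) auto
qed

text \<open>Where the exponent arises: \<open>T = R powr (1 + \<tau>)\<close> gives
  \<open>T powr s = 2 * 2 ^ j\<close>, so the gain \<open>1 / N\<close> and the decay beyond
  \<open>T\<close> combine into \<open>t powr (- s)\<close>. The factor \<open>1 / j\<close> is the
  reserve that will outweigh constants fixed before \<open>j\<close>.\<close>

lemma coefficient_bound:
  assumes \<tau>: "\<tau> > 0" and j: "j \<ge> 1" and N: "2 ^ j / (real (Suc j))\<^sup>2 \<le> N" and t: "t\<^sup>2 > 2 ^ j" "t > 0"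
  defines "s \<equiv> 2 / (1 + \<tau>)" and "\<delta> \<equiv> sqrt (2 * 2 ^ j) powr (- \<tau>)"
  shows "8 * ln t / (ln (2 ^ j) * N) * (28 / (1 + t / (sqrt (2 * 2 ^ j) / \<delta>))) ^ 7 \<le>
    864 * 28 ^ 7 / real j * (ln t ^ 3 * t powr (- s))"
proof -
  define X :: real where "X = 2 ^ j"
  define R where "R = sqrt (2 * X)"
  define T where "T = R / \<delta>"
  have X: "X \<ge> 2" unfolding X_def using j power_increasing[of 1 j "2::real"] by simp
  have R: "R > 0" "R\<^sup>2 = 2 * X" using X by (auto simp: R_def)
  have s: "0 < s" "s \<le> 2" using \<tau> by (auto simp: s_def field_simps)
  have TR: "T = R powr (1 + \<tau>)"
  proof -
    have "\<delta> = R powr (- \<tau>)" by (simp only: \<delta>_def R_def X_def)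
    then show ?thesis using R(1) by (simp add: T_def powr_minus powr_add divide_inverse)
  qed
  have T: "T > 0" using R by (simp add: TR)
  have "(1 + \<tau>) * s = 2" using \<tau> by (simp add: s_def field_simps)
  then have "T powr s = R powr 2" by (simp only: TR powr_powr)
  then have Ts: "T powr s = 2 * X" using R by simp
  have lnX: "ln X = real j * ln 2" by (simp add: X_def ln_realpow)
  have t1: "t > 1"
  proof -
    have "1\<^sup>2 < t\<^sup>2" using t(1) X by (simp add: X_def)
    then show ?thesis using t(2) by (intro power_less_imp_less_base[of 1 2 t]) auto
  qed
  \<comment> \<open>All frequencies satisfy \<open>t\<^sup>2 > 2 ^ j\<close>, so
    \<open>j \<le> 3 * ln t\<close>; powers of \<open>j\<close> may be turned into logarithms of
    \<open>t\<close>.\<close>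
  have "ln X < ln (t\<^sup>2)" using t X by (subst ln_less_cancel_iff) (auto simp: X_def)
  then have "real j * ln 2 < 2 * ln t" using t by (simp add: lnX ln_realpow)
  moreover have "real j * (2 / 3) \<le> real j * ln 2" using ln2_ge_two_thirds by (intro mult_left_mono) auto
  ultimately have jt: "real j \<le> 3 * ln t" by simp
  have lnpos: "0 < ln t" using t1 by simp
  have Npos: "N > 0" using N by (rule less_le_trans[rotated]) simp
  have "real (Suc j) \<le> 2 * real j" using j by simp
  then have "(real (Suc j))\<^sup>2 \<le> (2 * real j)\<^sup>2" by (intro power_mono) auto
  then have "X \<le> N * (2 * real j)\<^sup>2"
    using N Npos by (simp add: X_def[symmetric] pos_divide_le_eq) (meson less_imp_le mult_left_mono order_trans)
  then have XN: "X \<le> 4 * (real j * real j) * N" by (simp add: power2_eq_square mult_ac)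
  have "real j * (2 / 3) * X \<le> ln X * (4 * (real j * real j) * N)"
    unfolding lnX using ln2_ge_two_thirds XN X j by (intro mult_mono) auto
  then have "X \<le> 6 * real j * (ln X * N)" using j by (simp add: mult_ac)
  \<comment> \<open>The surviving \<open>j\<close> is written as \<open>j * j / j\<close>: the
    numerator becomes two logarithms and \<open>1 / j\<close> is kept.\<close>
  also have "\<dots> = 6 * (real j * real j) / real j * (ln X * N)" using j by simp
  also have "\<dots> \<le> 6 * ((3 * ln t) * (3 * ln t)) / real j * (ln X * N)"
    using jt lnX Npos by (intro mult_right_mono divide_right_mono mult_left_mono mult_mono) auto
  finally have "X \<le> 54 * (ln t)\<^sup>2 / real j * (ln X * N)" by (simp add: power2_eq_square)
  moreover have lnXN: "0 < ln X * N" using lnX j Npos by simp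
  ultimately have a: "1 / (ln X * N) \<le> 54 * (ln t)\<^sup>2 / real j / X"
    using X j by (simp add: divide_simps mult_ac)
  define y where "y = t / T"
  have y: "y > 0" using T t by (simp add: y_def)
  have "t powr s / (2 * X) = y powr s" using t T by (simp add: y_def powr_divide Ts)
  also have "\<dots> \<le> (1 + y) powr s" using y s by (intro powr_mono2) auto
  \<comment> \<open>The kernel's order 7 exceeds \<open>s\<close>, which is at most 2, so its decay
    covers small and large \<open>t / T\<close> alike.\<close>
  also have "\<dots> \<le> (1 + y) powr 7" using y s by (intro powr_mono) auto
  also have "\<dots> = (1 + y) ^ 7" using y by simp
  finally have "t powr s / (2 * X) \<le> (1 + y) ^ 7" .
  then have "28 ^ 7 / (1 + y) ^ 7 \<le> 28 ^ 7 / (t powr s / (2 * X))"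
    using y t X by (intro divide_left_mono mult_pos_pos divide_pos_pos) auto
  then have b: "(28 / (1 + y)) ^ 7 \<le> 28 ^ 7 * (2 * X * t powr (- s))"
    by (simp add: power_divide powr_minus_divide)
  have "8 * ln t / (ln X * N) * (28 / (1 + y)) ^ 7 = 8 * ln t * (1 / (ln X * N)) * (28 / (1 + y)) ^ 7"
    by simp
  also have "\<dots> \<le> 8 * ln t * (54 * (ln t)\<^sup>2 / real j / X) * (28 ^ 7 * (2 * X * t powr (- s)))"
    using a b lnpos lnXN y X by (intro mult_mono mult_left_mono) auto
  also have "\<dots> = 864 * 28 ^ 7 / real j * (ln t ^ 3 * t powr (- s))"
    using X by (simp add: power2_eq_square power3_eq_cube field_simps)
  finally show ?thesis unfolding y_def T_def R_def X_def .
qed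

text \<open>A qualitative companion whose constant may depend on \<open>j\<close>: it serves to give
  the next measure decay of order 6. One of the seven powers pays for
  \<open>ln t \<le> 1 + t\<close>.\<close>

lemma coefficient_decay:
  fixes N T t :: real
  assumes j: "j \<ge> 1" and N: "N > 0" and T: "T \<ge> 1" and t: "t \<ge> 1"
  shows "8 * ln t / (ln (2 ^ j) * N) * (28 / (1 + t / T)) ^ 7 \<le> 8 * (28 * T) ^ 7 / (ln (2 ^ j) * N) * (1 / (1 + t) ^ 6)"
proof -
  have l: "ln (2 ^ j) * N > 0" using j N by (simp add: ln_realpow)
  have "(1 + t) / T \<le> 1 + t / T" using T by (simp add: add_divide_distrib)
  then have "28 / (1 + t / T) \<le> 28 / ((1 + t) / T)"
    using T t by (intro divide_left_mono mult_pos_pos add_pos_nonneg) auto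
  then have "(28 / (1 + t / T)) ^ 7 \<le> (28 * T / (1 + t)) ^ 7"
    using T t by (intro power_mono) auto
  moreover have "ln t \<le> 1 + t" using ln_le_minus_one[of t] t by simp
  ultimately have "8 * ln t / (ln (2 ^ j) * N) * (28 / (1 + t / T)) ^ 7 \<le> 8 * (1 + t) / (ln (2 ^ j) * N) * (28 * T / (1 + t)) ^ 7"
    using t T l by (intro mult_mono divide_right_mono) auto
  also have "\<dots> = 8 * (28 * T) ^ 7 / (ln (2 ^ j) * N) * ((1 + t) / (1 + t) ^ 7)"
    by (simp add: power_divide)
  also have "(1 + t) / (1 + t) ^ 7 = 1 / (1 + t) ^ 6"
    using t by (simp add: power_Suc[of _ 6, simplified] del: power_Suc)
  finally show ?thesis .
qed

text \<open>The tolerance uses the largest modulus in the shell, so one bump serves every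
  \<open>q\<close>. For \<open>\<tau> \<ge> 0\<close> it is at most the tolerance of
  \<open>E_star\<close>, since \<open>supnorm q\<close> does not exceed that modulus.\<close>

definition approx_set :: "real \<Rightarrow> nat \<Rightarrow> complex set" where
  "approx_set \<tau> j = {x. \<exists>q\<in>gprimes j. \<exists>r\<in>gaussian_ints. supnorm (q * x - r) \<le> sqrt (2 * 2 ^ j) powr (- \<tau>)}"

text \<open>The reals within \<open>\<delta>\<close> of an integer form a sum of a closed and a
  compact set, hence are closed; the set is a finite union of intersections of preimages.\<close>

lemma closed_approx_set: "closed (approx_set \<tau> j)"
proof -
  define \<delta> where "\<delta> = sqrt (2 * 2 ^ j) powr (- \<tau>)"
  define Z where "Z = (\<Union>x\<in>(\<int> :: real set). \<Union>y\<in>{-\<delta>..\<delta>}. {x + y})"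
  have "closed Z" unfolding Z_def by (rule closed_compact_sums) auto
  have Z: "t \<in> Z \<longleftrightarrow> (\<exists>a\<in>\<int>. \<bar>t - a\<bar> \<le> \<delta>)" for t
  proof
    assume "t \<in> Z"
    then show "\<exists>a\<in>\<int>. \<bar>t - a\<bar> \<le> \<delta>" unfolding Z_def by (force simp: abs_le_iff)
  next
    assume "\<exists>a\<in>\<int>. \<bar>t - a\<bar> \<le> \<delta>"
    then obtain a where a: "a \<in> \<int>" "\<bar>t - a\<bar> \<le> \<delta>" by blast
    then have "t = a + (t - a)" "t - a \<in> {-\<delta>..\<delta>}" by (auto simp: abs_le_iff)
    with a(1) show "t \<in> Z" unfolding Z_def by blast
  qed
  have "(\<exists>r\<in>gaussian_ints. supnorm (y - r) \<le> \<delta>) \<longleftrightarrow> Re y \<in> Z \<and> Im y \<in> Z" for y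
  proof
    assume "Re y \<in> Z \<and> Im y \<in> Z"
    then obtain a b where "a \<in> \<int>" "\<bar>Re y - a\<bar> \<le> \<delta>" "b \<in> \<int>" "\<bar>Im y - b\<bar> \<le> \<delta>" using Z by blast
    then show "\<exists>r\<in>gaussian_ints. supnorm (y - r) \<le> \<delta>"
      by (intro bexI[of _ "Complex a b"]) (auto simp: supnorm_def gaussian_ints_def)
  qed (auto simp: Z supnorm_def gaussian_ints_def)
  then have "approx_set \<tau> j = (\<Union>q\<in>gprimes j. {x. Re (q * x) \<in> Z} \<inter> {x. Im (q * x) \<in> Z})"
    unfolding approx_set_def \<delta>_def[symmetric] by auto
  moreover have "closed ({x. Re (q * x) \<in> Z} \<inter> {x. Im (q * x) \<in> Z})" for q
  proof (rule closed_Int)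
    show "closed {x. Re (q * x) \<in> Z}"
      using continuous_closed_vimage[OF \<open>closed Z\<close>, of "\<lambda>x. Re (q * x)"] by (simp add: vimage_def continuous_intros)
    show "closed {x. Im (q * x) \<in> Z}"
      using continuous_closed_vimage[OF \<open>closed Z\<close>, of "\<lambda>x. Im (q * x)"] by (simp add: vimage_def continuous_intros)
  qed
  ultimately show ?thesis using finite_gprimes by (auto intro!: closed_UN)
qed

lemma supnorm_le_cmod: "supnorm z \<le> cmod z"
  by (simp add: supnorm_def abs_Re_le_cmod abs_Im_le_cmod)

text \<open>Shell \<open>j\<close> supplies a solution with \<open>gnorm q > 2 ^ j > j\<close>;
  finitely many solutions would bound these norms.\<close>

lemma E_star_approx_sets:
  assumes \<tau>: "\<tau> \<ge> 0" and x: "\<And>m. \<exists>j\<ge>m. x \<in> approx_set \<tau> j"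
  shows "x \<in> E_star \<tau>"
  unfolding E_star_def
proof (rule CollectI, rule notI)
  define P where "P = {(q, r). q \<in> gaussian_ints \<and> r \<in> gaussian_ints \<and> q \<noteq> 0 \<and> supnorm (q * x - r) \<le> supnorm q powr (- \<tau>)}"
  assume "finite {(q, r). q \<in> gaussian_ints \<and> r \<in> gaussian_ints \<and> q \<noteq> 0 \<and> supnorm (q * x - r) \<le> supnorm q powr (- \<tau>)}"
  then have fin: "finite ((\<lambda>(q, r). gnorm q) ` P)" by (simp add: P_def)
  define m where "m = Max ((\<lambda>(q, r). gnorm q) ` P \<union> {0})"
  obtain j where j: "j \<ge> m" "x \<in> approx_set \<tau> j" using x by blast
  then obtain q r where q: "q \<in> gprimes j" and r: "r \<in> gaussian_ints"
    and qr: "supnorm (q * x - r) \<le> sqrt (2 * 2 ^ j) powr (- \<tau>)" by (auto simp: approx_set_def)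
  have qG: "q \<in> gaussian_ints" and qn: "2 ^ j < gnorm q" "gnorm q \<le> 2 * 2 ^ j" using q by (auto simp: gprimes_def girred_def)
  have q0: "q \<noteq> 0" using qn gnorm_eq_0_iff[OF qG] by auto
  have "real (gnorm q) \<le> real (2 * 2 ^ j)" using qn(2) by (simp only: of_nat_le_iff)
  then have "(cmod q)\<^sup>2 \<le> 2 * 2 ^ j" by (simp add: of_nat_gnorm[OF qG])
  then have "cmod q \<le> sqrt (2 * 2 ^ j)" by (rule real_le_rsqrt)
  then have "supnorm q \<le> sqrt (2 * 2 ^ j)" using supnorm_le_cmod order_trans by blast
  moreover have "supnorm q > 0" using q0 by (auto simp: supnorm_def complex_eq_iff less_max_iff_disj)
  ultimately have "sqrt (2 * 2 ^ j) powr (- \<tau>) \<le> supnorm q powr (- \<tau>)"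
    using \<tau> by (intro powr_mono2') auto
  then have "(q, r) \<in> P" using qr qG r q0 by (auto simp: P_def)
  then have "gnorm q \<le> m" unfolding m_def using fin by (intro Max_ge) force+
  also have "m \<le> j" by fact
  also have "j < 2 ^ j" by (rule less_exp)
  finally show False using qn by simp
qed

text \<open>The invariant of the iteration. The constant \<open>K\<close> depends on the measure,
  with no uniformity over the iterates. Order 6 is the 4 of \<open>lattice_sum_bound\<close> plus
  the 2 of \<open>profile_convolution\<close>.\<close>

definition fourier_decay :: "complex measure \<Rightarrow> bool" where
  "fourier_decay lam \<longleftrightarrow> (\<exists>K. \<forall>\<xi>. cmod (fourier_measure lam \<xi>) \<le> K / (1 + cmod \<xi>) ^ 6)"

lemma fourier_measure_0: "prob_space lam \<Longrightarrow> fourier_measure lam 0 = 1"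
  unfolding fourier_measure_def using prob_space.prob_space[of lam] by (simp add: cis_zero)

text \<open>The same sums over \<open>l\<close> are estimated twice: \<open>close\<close> exploits
  the spare \<open>1 / j\<close> to come below any \<open>\<epsilon>\<close> relative to the
  profile, and \<open>crude\<close> recovers order 6 with a constant depending on
  \<open>j\<close>.\<close>

lemma kaufman_density:
  assumes \<tau>: "\<tau> > 0" and lam: "prob_space lam" "sets lam = sets borel" and dec: "fourier_decay lam"
    and \<epsilon>: "\<epsilon> > 0"
  defines "s \<equiv> 2 / (1 + \<tau>)"
  shows "\<exists>j F B. j \<ge> j0 \<and> F \<in> borel_measurable borel \<and> (\<forall>x. 0 \<le> F x \<and> F x \<le> B) \<and> (\<forall>x. F x \<noteq> 0 \<longrightarrow> x \<in> approx_set \<tau> j) \<and>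
    (\<forall>\<xi>. cmod ((\<integral>x. of_real (F x) * cis (- 2 * pi * (\<xi> \<bullet> x)) \<partial>lam) - fourier_measure lam \<xi>) \<le> \<epsilon> * profile s (max 1 (cmod \<xi>))) \<and>
    (\<exists>K. \<forall>\<xi>. cmod (\<integral>x. of_real (F x) * cis (- 2 * pi * (\<xi> \<bullet> x)) \<partial>lam) \<le> K / (1 + cmod \<xi>) ^ 6)"
proof -
  obtain K where K: "\<And>\<xi>. cmod (fourier_measure lam \<xi>) \<le> K / (1 + cmod \<xi>) ^ 6"
    using dec unfolding fourier_decay_def by blast
  have K0: "K \<ge> 0" using order_trans[OF norm_ge_zero K[of 0]] by simp
  have s: "0 < s" "s \<le> 2" using \<tau> by (auto simp: s_def field_simps)
  obtain C where C: "C \<ge> 0" "\<And>\<xi> A. A \<subseteq> gaussian_ints \<Longrightarrow> finite A \<Longrightarrow> (\<Sum>l\<in>A. 1 / (1 + cmod (\<xi> - l)) ^ 4) \<le> C"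
    using lattice_sum_bound by blast
  obtain C' where C': "C' \<ge> 0" "\<And>\<xi> A. A \<subseteq> gaussian_ints \<Longrightarrow> finite A \<Longrightarrow>
     (\<Sum>l\<in>A. 1 / (1 + cmod l) ^ 6 * (1 / (1 + cmod (\<xi> - l)) ^ 6)) \<le> C' / (1 + cmod \<xi>) ^ 6"
    using inverse_power_convolution by blast
  \<comment> \<open>Collects every constant that is fixed before \<open>j\<close>, including the
    decay constant \<open>K\<close> of \<open>lam\<close>; then
    \<open>j \<ge> M / \<epsilon>\<close> is imposed.\<close>
  define M where "M = 864 * 28 ^ 7 * ((2 powr s + 4) * (1 + 3 / s) ^ 3) * K * C"
  have M0: "M \<ge> 0" using K0 C s by (simp add: M_def)
  obtain j where j: "j \<ge> max (max j0 1) (nat \<lceil>M / \<epsilon>\<rceil>)" "2 ^ j / (real (Suc j))\<^sup>2 \<le> real (card (gprimes j))"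
    using many_gprimes by blast
  have j1: "j \<ge> j0" "j \<ge> 1" using j by auto
  have "M / \<epsilon> \<le> real j" using j(1) by linarith
  then have Mj: "M / real j \<le> \<epsilon>" using \<epsilon> j1 by (simp add: field_simps)
  have card0: "real (card (gprimes j)) > 0" using j(2) by (rule less_le_trans[rotated]) simp
  then have Qne: "gprimes j \<noteq> {}" by auto
  define \<delta> where "\<delta> = sqrt (2 * 2 ^ j) powr (- \<tau>)"
  have \<delta>: "\<delta> > 0" by (simp add: \<delta>_def)
  define T where "T = sqrt (2 * 2 ^ j) / \<delta>"
  have seven: "(2::nat) \<le> 7" by simp
  obtain \<Phi> :: "complex \<Rightarrow> real" and w :: "complex \<Rightarrow> real" and B where
    \<Phi>m: "\<Phi> \<in> borel_measurable borel" and \<Phi>b: "\<And>y. 0 \<le> \<Phi> y" "\<And>y. \<Phi> y \<le> B"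
    and \<Phi>s: "\<And>y. \<Phi> y \<noteq> 0 \<Longrightarrow> \<exists>r\<in>gaussian_ints. supnorm (y - r) \<le> \<delta>"
    and w0: "w 0 = 1" and wd: "\<And>k. k \<in> gaussian_ints \<Longrightarrow> \<bar>w k\<bar> \<le> (4 * real 7 / (1 + \<delta> * cmod k)) ^ 7"
    and part: "\<And>N y. cmod (\<Sum>k\<in>gbox N. of_real (w k) * cis (2 * pi * (k \<bullet> y))) \<le> B"
    and lim: "\<And>y. (\<lambda>N. \<Sum>k\<in>gbox N. of_real (w k) * cis (2 * pi * (k \<bullet> y))) \<longlonglongrightarrow> complex_of_real (\<Phi> y)"
    using kernel_2d[OF \<delta> seven] by blast
  have wd': "\<bar>w k\<bar> \<le> (28 / (1 + \<delta> * cmod k)) ^ 7" if "k \<in> gaussian_ints" for k using wd[OF that] by simp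
  define F where "F x = (\<Sum>q\<in>gprimes j. \<Phi> (q * x)) / real (card (gprimes j))" for x
  have Fm: "F \<in> borel_measurable borel"
    unfolding F_def by (intro borel_measurable_divide borel_measurable_sum measurable_compose[OF _ \<Phi>m]) auto
  have F0: "0 \<le> F x" for x unfolding F_def by (intro divide_nonneg_nonneg sum_nonneg \<Phi>b) auto
  have FB: "F x \<le> B" for x
  proof -
    have "(\<Sum>q\<in>gprimes j. \<Phi> (q * x)) \<le> real (card (gprimes j)) * B" by (intro sum_bounded_above \<Phi>b)
    then show ?thesis using card0 by (simp add: F_def divide_le_eq mult.commute)
  qed
  have Fs: "x \<in> approx_set \<tau> j" if Fx: "F x \<noteq> 0" for x
  proof -
    have "(\<Sum>q\<in>gprimes j. \<Phi> (q * x)) \<noteq> 0" using Fx by (auto simp: F_def)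
    then obtain q where "q \<in> gprimes j" "\<Phi> (q * x) \<noteq> 0" by (meson sum.neutral)
    then show ?thesis using \<Phi>s unfolding approx_set_def \<delta>_def by blast
  qed
  define H where "H \<xi> = (\<integral>x. of_real (F x) * cis (- 2 * pi * (\<xi> \<bullet> x)) \<partial>lam)" for \<xi>
  define D where "D N \<xi> = (\<Sum>q\<in>gprimes j. \<Sum>k\<in>gbox N. of_real (w k) * fourier_measure lam (\<xi> - cnj q * k)) / of_nat (card (gprimes j))" for N \<xi>
  have Dlim: "(\<lambda>N. D N \<xi>) \<longlonglongrightarrow> H \<xi>" for \<xi>
    unfolding D_def H_def F_def by (rule fourier_kernel_average[OF lam \<Phi>m \<Phi>b part lim])
  \<comment> \<open>Bounds on the partial averages that are uniform in \<open>N\<close> pass to the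
    limit.\<close>
  have to_H: "cmod (H \<xi> - fourier_measure lam \<xi>) \<le> b" if "\<And>N. cmod (D N \<xi> - fourier_measure lam \<xi>) \<le> b" for \<xi> b
    using that by (intro LIMSEQ_le_const2[OF tendsto_norm[OF tendsto_diff[OF Dlim tendsto_const]]]) auto
  define coef where "coef l = 8 * ln (cmod l) / (ln (2 ^ j) * real (card (gprimes j))) * (28 / (1 + cmod l / T)) ^ 7" for l
  have disc: "\<exists>L. finite L \<and> L \<subseteq> gaussian_ints \<and> (\<forall>l\<in>L. (cmod l)\<^sup>2 > 2 ^ j \<and> cmod l \<ge> 1) \<and>
      cmod (D N \<xi> - fourier_measure lam \<xi>) \<le>
      (\<Sum>l\<in>L. coef l *
          (K / (1 + cmod (\<xi> - l)) ^ 6))" for N \<xi>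
  proof -
    obtain L where L: "finite L" "L \<subseteq> {l \<in> gaussian_ints. (cmod l)\<^sup>2 > 2 ^ j}"
      "cmod (D N \<xi> - fourier_measure lam \<xi>) \<le>
      (\<Sum>l\<in>L. coef l *
          cmod (fourier_measure lam (\<xi> - l)))"
      using discrepancy_bound[OF j1(2) Qne \<delta> w0 wd', where N = N and f = "fourier_measure lam" and \<xi> = \<xi>] unfolding D_def T_def coef_def by auto
    have l1: "cmod l \<ge> 1" if "l \<in> L" for l
    proof (rule gaussian_norm_ge_1)
      show "l \<noteq> 0"
      proof
        assume "l = 0"
        then have "(2::real) ^ j < 0" using L(2) that by auto
        then show False by (simp add: not_less[symmetric])
      qed
    qed (use L that in auto)
    have "(\<Sum>l\<in>L. coef l * cmod (fourier_measure lam (\<xi> - l)))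
      \<le> (\<Sum>l\<in>L. coef l * (K / (1 + cmod (\<xi> - l)) ^ 6))"
      using l1 \<delta> by (intro sum_mono mult_left_mono K mult_nonneg_nonneg divide_nonneg_nonneg zero_le_power) (auto simp: T_def coef_def)
    then show ?thesis using L l1 by (intro exI[of _ L]) auto
  qed
  have close: "cmod (D N \<xi> - fourier_measure lam \<xi>) \<le> \<epsilon> * profile s (max 1 (cmod \<xi>))" for N \<xi>
  proof -
    define p where "p = profile s (max 1 (cmod \<xi>))"
    have p0: "p \<ge> 0" unfolding p_def by (intro profile_nonneg) auto
    define E where "E = (2 powr s + 4) * (1 + 3 / s) ^ 3 * p"
    have E0: "E \<ge> 0" using p0 s by (simp add: E_def)
    obtain L where L0: "finite L" "L \<subseteq> gaussian_ints" "\<forall>l\<in>L. (cmod l)\<^sup>2 > 2 ^ j \<and> cmod l \<ge> 1"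
      and le: "cmod (D N \<xi> - fourier_measure lam \<xi>) \<le>
      (\<Sum>l\<in>L. coef l * (K / (1 + cmod (\<xi> - l)) ^ 6))"
      using disc[of N \<xi>] by (elim exE conjE) (rule that)
    have L: "finite L" "L \<subseteq> gaussian_ints" "\<And>l. l \<in> L \<Longrightarrow> (cmod l)\<^sup>2 > 2 ^ j" "\<And>l. l \<in> L \<Longrightarrow> cmod l \<ge> 1"
      using L0 by auto
    have "cmod (D N \<xi> - fourier_measure lam \<xi>) \<le> (\<Sum>l\<in>L. coef l * (K / (1 + cmod (\<xi> - l)) ^ 6))" by (rule le)
    also have "\<dots> \<le> (\<Sum>l\<in>L. (864 * 28 ^ 7 / real j * E * K) * (1 / (1 + cmod (\<xi> - l)) ^ 4))"
    proof (rule sum_mono)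
      fix l assume l: "l \<in> L"
      define d where "d = 1 + cmod (\<xi> - l)"
      have d: "d > 0" by (simp add: d_def add_pos_nonneg)
      have "coef l * (K / d ^ 6)
        \<le> 864 * 28 ^ 7 / real j * (ln (cmod l) ^ 3 * cmod l powr (- s)) * (K / d ^ 6)"
        unfolding coef_def T_def \<delta>_def s_def using L(3,4)[OF l] K0 d
        by (intro mult_right_mono coefficient_bound[OF \<tau> j1(2) j(2)]) auto
      \<comment> \<open>The six powers are split: two go into \<open>profile_convolution\<close>,
        four remain for the sum over the lattice.\<close>
      also have "\<dots> = 864 * 28 ^ 7 / real j * (ln (cmod l) ^ 3 * cmod l powr (- s) / d\<^sup>2) * (K * (1 / d ^ 4))"
        using power_add[of d 2 4] by simp
      also have "\<dots> \<le> 864 * 28 ^ 7 / real j * E * (K * (1 / d ^ 4))"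
        unfolding E_def p_def d_def using K0 L(4)[OF l]
        by (intro mult_right_mono mult_left_mono profile_convolution s) auto
      finally show "coef l * (K / (1 + cmod (\<xi> - l)) ^ 6)
        \<le> (864 * 28 ^ 7 / real j * E * K) * (1 / (1 + cmod (\<xi> - l)) ^ 4)" by (simp add: d_def mult.assoc)
    qed
    also have "\<dots> = (864 * 28 ^ 7 / real j * E * K) * (\<Sum>l\<in>L. 1 / (1 + cmod (\<xi> - l)) ^ 4)"
      by (rule sum_distrib_left[symmetric])
    also have "\<dots> \<le> (864 * 28 ^ 7 / real j * E * K) * C"
      using C(2)[OF L(2,1)] E0 K0 by (intro mult_left_mono) auto
    also have "\<dots> = M / real j * p" by (simp add: M_def E_def)
    also have "\<dots> \<le> \<epsilon> * p" by (rule mult_right_mono[OF Mj p0])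
    finally show ?thesis by (simp add: p_def)
  qed
  define A where "A = 8 * (28 * T) ^ 7 / (ln (2 ^ j) * real (card (gprimes j)))"
  have T1: "T \<ge> 1"
  proof -
    have R: "sqrt (2 * 2 ^ j) \<ge> 1" by (simp add: order_trans[OF one_le_power[of 2 j]])
    then have "\<delta> \<le> 1" unfolding \<delta>_def using powr_mono[OF _ R, of "- \<tau>" 0] \<tau> by simp
    then show ?thesis unfolding T_def using order_trans[OF _ R] by (subst le_divide_eq_1_pos[OF \<delta>])
  qed
  have A0: "A \<ge> 0" unfolding A_def using T1 by (intro divide_nonneg_nonneg mult_nonneg_nonneg zero_le_power) (auto simp: ln_realpow)
  have crude: "cmod (D N \<xi> - fourier_measure lam \<xi>) \<le> A * K * C' / (1 + cmod \<xi>) ^ 6" for N \<xi>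
  proof -
    obtain L where L0: "finite L" "L \<subseteq> gaussian_ints" "\<forall>l\<in>L. (cmod l)\<^sup>2 > 2 ^ j \<and> cmod l \<ge> 1"
      and le: "cmod (D N \<xi> - fourier_measure lam \<xi>) \<le>
      (\<Sum>l\<in>L. coef l * (K / (1 + cmod (\<xi> - l)) ^ 6))"
      using disc[of N \<xi>] by (elim exE conjE) (rule that)
    have L: "finite L" "L \<subseteq> gaussian_ints" "\<And>l. l \<in> L \<Longrightarrow> cmod l \<ge> 1"
      using L0 by auto
    have "cmod (D N \<xi> - fourier_measure lam \<xi>) \<le> (\<Sum>l\<in>L. coef l * (K / (1 + cmod (\<xi> - l)) ^ 6))" by (rule le)
    also have "\<dots> \<le> (\<Sum>l\<in>L. A * (1 / (1 + cmod l) ^ 6) * (K / (1 + cmod (\<xi> - l)) ^ 6))"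
      unfolding A_def coef_def using L(3) K0 card0 T1
      by (intro sum_mono mult_right_mono coefficient_decay j1) auto
    also have "\<dots> = (A * K) * (\<Sum>l\<in>L. 1 / (1 + cmod l) ^ 6 * (1 / (1 + cmod (\<xi> - l)) ^ 6))"
      unfolding sum_distrib_left by (intro sum.cong refl) simp
    also have "\<dots> \<le> (A * K) * (C' / (1 + cmod \<xi>) ^ 6)"
      using A0 K0 by (intro mult_left_mono C' L) auto
    finally show ?thesis by simp
  qed
  have "cmod (H \<xi>) \<le> (A * K * C' + K) / (1 + cmod \<xi>) ^ 6" for \<xi>
  proof -
    have "cmod (H \<xi>) \<le> cmod (H \<xi> - fourier_measure lam \<xi>) + cmod (fourier_measure lam \<xi>)"
      by (metis diff_add_cancel norm_triangle_ineq)
    then show ?thesis using to_H[OF crude, of \<xi>] K[of \<xi>] by (simp add: add_divide_distrib)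
  qed
  then show ?thesis
    using j1 Fm F0 FB Fs to_H[OF close] unfolding H_def
    by - (rule exI[of _ j], rule exI[of _ F], rule exI[of _ B], intro conjI, blast+)
qed

subsection \<open>The limit measure\<close>

text \<open>The product of two copies of \<open>smooth_law\<close>, translated to \<open>c\<close>.
  As in \<open>kernel_2d\<close>, the larger coordinate of \<open>\<xi>\<close> provides all the
  decay.\<close>

lemma base_measure:
  fixes c :: complex
  assumes \<rho>: "\<rho> > 0" and n: "n > 0"
  shows "\<exists>lam K. prob_space lam \<and> sets lam = sets borel \<and>
    (AE x in lam. \<bar>Re (x - c)\<bar> < \<rho> \<and> \<bar>Im (x - c)\<bar> < \<rho>) \<and>
    (\<forall>\<xi>. cmod (fourier_measure lam \<xi>) \<le> K / (1 + cmod \<xi>) ^ n)"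
proof -
  \<comment> \<open>Halving turns the closed support condition into the strict one that
    \<open>weak_limit_bounded\<close> asks for.\<close>
  define \<delta> where "\<delta> = \<rho> / 2"
  have \<delta>: "\<delta> > 0" "\<delta> < \<rho>" using \<rho> by (auto simp: \<delta>_def)
  obtain \<nu> \<phi> where \<nu>: "real_distribution \<nu>" "AE x in \<nu>. \<bar>x\<bar> \<le> \<delta>"
    and char: "\<And>t. char \<nu> t = complex_of_real (\<phi> t)"
    and decay: "\<And>t. \<bar>\<phi> t\<bar> \<le> (2 * real n / (1 + \<delta> * \<bar>t\<bar>)) ^ n"
    using smooth_law[OF \<delta>(1) n] by blast
  interpret \<nu>: real_distribution \<nu> by fact
  interpret P: pair_prob_space \<nu> \<nu> by unfold_locales
  define h where "h z = c + Complex (fst z) (snd z)" for z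
  have "h \<in> borel_measurable (borel \<Otimes>\<^sub>M borel)"
  proof -
    have "h = (\<lambda>z. c + (complex_of_real (fst z) + \<i> * complex_of_real (snd z)))"
      by (simp add: h_def fun_eq_iff complex_eq_iff)
    then show ?thesis by simp
  qed
  then have hm: "h \<in> borel_measurable (\<nu> \<Otimes>\<^sub>M \<nu>)"
    by (subst measurable_cong_sets[OF sets_pair_measure_cong[OF \<nu>.events_eq_borel \<nu>.events_eq_borel] refl])
  define lam where "lam = distr (\<nu> \<Otimes>\<^sub>M \<nu>) borel h"
  have prob: "prob_space lam" unfolding lam_def by (rule P.prob_space_distr[OF hm])
  have sets: "sets lam = sets borel" by (simp add: lam_def)
  have "AE x in \<nu>. AE y in \<nu>. \<bar>x\<bar> < \<rho> \<and> \<bar>y\<bar> < \<rho>"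
    using \<nu>(2)
  proof eventually_elim
    fix x assume "\<bar>x\<bar> \<le> \<delta>"
    then show "AE y in \<nu>. \<bar>x\<bar> < \<rho> \<and> \<bar>y\<bar> < \<rho>"
      using \<nu>(2) \<delta> by (auto elim!: eventually_mono)
  qed
  then have "AE z in \<nu> \<Otimes>\<^sub>M \<nu>. \<bar>fst z\<bar> < \<rho> \<and> \<bar>snd z\<bar> < \<rho>"
  proof (intro P.AE_pair_measure)
    have S: "{w. \<bar>Re (w - c)\<bar> < \<rho> \<and> \<bar>Im (w - c)\<bar> < \<rho>} \<in> sets borel"
      by (intro borel_open open_Collect_conj open_Collect_less continuous_intros)
    have "{z \<in> space (\<nu> \<Otimes>\<^sub>M \<nu>). \<bar>fst z\<bar> < \<rho> \<and> \<bar>snd z\<bar> < \<rho>} =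
        h -` {w. \<bar>Re (w - c)\<bar> < \<rho> \<and> \<bar>Im (w - c)\<bar> < \<rho>} \<inter> space (\<nu> \<Otimes>\<^sub>M \<nu>)"
      by (auto simp: h_def)
    also have "\<dots> \<in> sets (\<nu> \<Otimes>\<^sub>M \<nu>)" by (rule measurable_sets[OF hm S])
    finally show "{z \<in> space (\<nu> \<Otimes>\<^sub>M \<nu>). \<bar>fst z\<bar> < \<rho> \<and> \<bar>snd z\<bar> < \<rho>} \<in> sets (\<nu> \<Otimes>\<^sub>M \<nu>)" .
  qed simp
  then have ae: "AE x in lam. \<bar>Re (x - c)\<bar> < \<rho> \<and> \<bar>Im (x - c)\<bar> < \<rho>"
    unfolding lam_def by (subst AE_distr_iff[OF hm]) (auto simp: h_def)
  have ft: "cmod (fourier_measure lam \<xi>) = \<bar>\<phi> (- 2 * pi * Re \<xi>)\<bar> * \<bar>\<phi> (- 2 * pi * Im \<xi>)\<bar>" for \<xi>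
  proof -
    have cm: "(\<lambda>x. cis (- 2 * pi * (\<xi> \<bullet> x))) \<in> borel_measurable borel"
      by (intro borel_measurable_continuous_onI continuous_intros)
    have "fourier_measure lam \<xi> = (\<integral>z. cis (- 2 * pi * (\<xi> \<bullet> h z)) \<partial>(\<nu> \<Otimes>\<^sub>M \<nu>))"
      unfolding fourier_measure_def lam_def by (rule integral_distr[OF hm cm])
    also have "\<dots> = (\<integral>z. (cis (- 2 * pi * (\<xi> \<bullet> c)) * iexp ((- 2 * pi * Re \<xi>) * fst z)) * iexp ((- 2 * pi * Im \<xi>) * snd z) \<partial>(\<nu> \<Otimes>\<^sub>M \<nu>))"
    proof (intro Bochner_Integration.integral_cong refl)
      fix z :: "real \<times> real"
      have "- 2 * pi * (\<xi> \<bullet> h z) = - 2 * pi * (\<xi> \<bullet> c) + (- 2 * pi * Re \<xi>) * fst z + (- 2 * pi * Im \<xi>) * snd z"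
        by (simp add: h_def inner_complex_def algebra_simps)
      then show "cis (- 2 * pi * (\<xi> \<bullet> h z)) = (cis (- 2 * pi * (\<xi> \<bullet> c)) * iexp ((- 2 * pi * Re \<xi>) * fst z)) * iexp ((- 2 * pi * Im \<xi>) * snd z)"
        by (simp only: cis_conv_exp[symmetric] cis_mult)
    qed
    also have "\<dots> = (\<integral>x. cis (- 2 * pi * (\<xi> \<bullet> c)) * iexp ((- 2 * pi * Re \<xi>) * x) \<partial>\<nu>) * (\<integral>y. iexp ((- 2 * pi * Im \<xi>) * y) \<partial>\<nu>)"
      by (rule integral_prod_mult[where A = 1 and B = 1, OF \<nu>.prob_space_axioms \<nu>.prob_space_axioms])
        (simp_all add: norm_mult)
    also have "\<dots> = cis (- 2 * pi * (\<xi> \<bullet> c)) * char \<nu> (- 2 * pi * Re \<xi>) * char \<nu> (- 2 * pi * Im \<xi>)"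
      unfolding char_def by (subst integral_mult_right_zero) simp
    finally show ?thesis by (simp add: char norm_mult)
  qed
  define K where "K = (2 * real n * (1 + 2 / \<delta>)) ^ n"
  have \<phi>1: "\<bar>\<phi> t\<bar> \<le> 1" for t using \<nu>.cmod_char_le_1[of t] by (simp add: char)
  have "cmod (fourier_measure lam \<xi>) \<le> K / (1 + cmod \<xi>) ^ n" for \<xi>
  proof -
    define m where "m = (if \<bar>Re \<xi>\<bar> \<ge> \<bar>Im \<xi>\<bar> then Re \<xi> else Im \<xi>)"
    have "cmod \<xi> \<le> \<bar>Re \<xi>\<bar> + \<bar>Im \<xi>\<bar>" by (rule cmod_le)
    also have "\<dots> \<le> 2 * \<bar>m\<bar>" by (auto simp: m_def)
    finally have \<xi>m: "cmod \<xi> \<le> 2 * \<bar>m\<bar>" .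
    have "1 * \<bar>m\<bar> \<le> \<bar>- 2 * pi * m\<bar>" unfolding abs_mult using pi_gt3 by (intro mult_right_mono) auto
    then have m2: "\<delta> * \<bar>m\<bar> \<le> \<delta> * \<bar>- 2 * pi * m\<bar>" using \<delta> by (intro mult_left_mono) auto
    have "1 + cmod \<xi> \<le> 1 + 2 * \<bar>m\<bar> + \<delta> * \<bar>m\<bar> + 2 / \<delta>" 
    proof -
      have "0 \<le> \<delta> * \<bar>m\<bar>" "0 \<le> 2 / \<delta>" using \<delta> by auto
      then show ?thesis using \<xi>m by linarith
    qed
    also have "\<dots> = (1 + 2 / \<delta>) * (1 + \<delta> * \<bar>m\<bar>)" using \<delta> by (simp add: field_simps)
    finally have le: "1 + cmod \<xi> \<le> (1 + 2 / \<delta>) * (1 + \<delta> * \<bar>m\<bar>)" .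
    have "cmod (fourier_measure lam \<xi>) \<le> \<bar>\<phi> (- 2 * pi * m)\<bar>"
      unfolding ft m_def using \<phi>1[of "- 2 * pi * Re \<xi>"] \<phi>1[of "- 2 * pi * Im \<xi>"]
      by (auto simp: mult_left_le mult_left_le_one_le)
    also have "\<dots> \<le> (2 * real n / (1 + \<delta> * \<bar>- 2 * pi * m\<bar>)) ^ n" by (rule decay)
    also have "\<dots> \<le> (2 * real n / (1 + \<delta> * \<bar>m\<bar>)) ^ n"
      using m2 \<delta> by (intro power_mono divide_left_mono mult_pos_pos add_pos_nonneg) auto
    also have "\<dots> \<le> (2 * real n * (1 + 2 / \<delta>) / (1 + cmod \<xi>)) ^ n"
    proof (rule power_mono)
      have p: "0 < 1 + cmod \<xi>" "0 < 1 + \<delta> * \<bar>m\<bar>" using \<delta> by (auto intro: add_pos_nonneg)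
      have "2 * real n * (1 + cmod \<xi>) \<le> 2 * real n * ((1 + 2 / \<delta>) * (1 + \<delta> * \<bar>m\<bar>))"
        using le by (intro mult_left_mono) auto
      then show "2 * real n / (1 + \<delta> * \<bar>m\<bar>) \<le> 2 * real n * (1 + 2 / \<delta>) / (1 + cmod \<xi>)"
        using p by (simp add: pos_divide_le_eq pos_le_divide_eq mult_ac)
    qed (use \<delta> in auto)
    also have "\<dots> = K / (1 + cmod \<xi>) ^ n" by (simp add: K_def power_divide)
    finally show ?thesis .
  qed
  with prob sets ae show ?thesis by blast
qed

lemma profile_ge:
  assumes "0 < s" "s \<le> 2"
  shows "1 / (1 + cmod \<xi>) ^ 6 \<le> profile s (max 1 (cmod \<xi>))"
proof -
  define u where "u = max 1 (cmod \<xi>)"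
  have u: "u \<ge> 1" "u \<le> 1 + cmod \<xi>" by (auto simp: u_def)
  have "1 / (1 + cmod \<xi>) ^ 6 \<le> 1 / u ^ 6" using u by (intro divide_left_mono power_mono) auto
  also have "\<dots> = u powr (- 6)" using u by (simp add: powr_minus_divide powr_numeral)
  also have "\<dots> \<le> u powr (- s)" using u assms by (intro powr_mono) auto
  also have "\<dots> = u powr (- s) * 1" by simp
  also have "\<dots> \<le> profile s u" unfolding profile_def using u by (intro mult_left_mono) (auto simp: one_le_power)
  finally show ?thesis by (simp add: u_def)
qed

text \<open>Normalize the density \<open>F\<close> to mass 1. Absolute continuity preserves every
  almost-sure property, so constraints from earlier shells are inherited.\<close>

lemma kaufman_step:
  assumes \<tau>: "\<tau> > 0" and lam: "prob_space lam" "sets lam = sets borel" and dec: "fourier_decay lam"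
    and \<epsilon>: "\<epsilon> > 0"
  defines "s \<equiv> 2 / (1 + \<tau>)"
  shows "\<exists>lam' j. j \<ge> j0 \<and> prob_space lam' \<and> sets lam' = sets borel \<and> fourier_decay lam' \<and>
    (\<forall>P. (AE x in lam. P x) \<longrightarrow> (AE x in lam'. P x)) \<and> (AE x in lam'. x \<in> approx_set \<tau> j) \<and>
    (\<forall>\<xi>. cmod (fourier_measure lam' \<xi> - fourier_measure lam \<xi>) \<le> \<epsilon> * profile s (max 1 (cmod \<xi>)))"
proof -
  interpret prob_space lam by fact
  obtain K where K: "\<And>\<xi>. cmod (fourier_measure lam \<xi>) \<le> K / (1 + cmod \<xi>) ^ 6"
    using dec unfolding fourier_decay_def by blast
  have K0: "K \<ge> 0" using order_trans[OF norm_ge_zero K[of 0]] by simp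
  have s: "0 < s" "s \<le> 2" using \<tau> by (auto simp: s_def field_simps)
  \<comment> \<open>The 1/2 keeps the mass \<open>m\<close> at least 1/2; the other term makes the
    total error factor \<open>2 * e * (1 + K)\<close> at most \<open>\<epsilon>\<close>.\<close>
  define e where "e = min (1/2) (\<epsilon> / (2 * (1 + K)))"
  have e: "e > 0" "e \<le> 1/2" "2 * e * (1 + K) \<le> \<epsilon>"
  proof -
    show "e > 0" using \<epsilon> K0 by (simp add: e_def)
    show "e \<le> 1/2" unfolding e_def by (rule min.cobounded1)
    have "e \<le> \<epsilon> / (2 * (1 + K))" by (simp add: e_def)
    then show "2 * e * (1 + K) \<le> \<epsilon>" using K0 by (simp add: le_divide_eq mult_ac)
  qed
  obtain j F B K' where j: "j \<ge> j0" and Fm: "F \<in> borel_measurable borel" and F0: "\<And>x. 0 \<le> F x" and FB: "\<And>x. F x \<le> B"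
    and Fs: "\<And>x. F x \<noteq> 0 \<Longrightarrow> x \<in> approx_set \<tau> j"
    and close: "\<And>\<xi>. cmod ((\<integral>x. of_real (F x) * cis (- 2 * pi * (\<xi> \<bullet> x)) \<partial>lam) - fourier_measure lam \<xi>) \<le> e * profile s (max 1 (cmod \<xi>))"
    and dec': "\<And>\<xi>. cmod (\<integral>x. of_real (F x) * cis (- 2 * pi * (\<xi> \<bullet> x)) \<partial>lam) \<le> K' / (1 + cmod \<xi>) ^ 6"
    using kaufman_density[OF \<tau> lam dec e(1), of j0] unfolding s_def[symmetric] by blast
  define H where "H \<xi> = (\<integral>x. of_real (F x) * cis (- 2 * pi * (\<xi> \<bullet> x)) \<partial>lam)" for \<xi>
  define m where "m = (\<integral>x. F x \<partial>lam)"
  have Fm': "F \<in> borel_measurable lam" using Fm unfolding measurable_cong_sets[OF lam(2) refl] .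
  have "H 0 = complex_of_real m" unfolding H_def m_def by (simp add: cis_zero)
  \<comment> \<open>At frequency 0 the transforms are total masses and the profile equals 1.\<close>
  then have "cmod (complex_of_real m - 1) \<le> e"
    using close[of 0] fourier_measure_0[OF lam(1)] by (simp add: H_def profile_def)
  moreover have "complex_of_real m - 1 = complex_of_real (m - 1)" by simp
  ultimately have m1: "\<bar>m - 1\<bar> \<le> e" by (simp only: norm_of_real)
  then have m: "m \<ge> 1/2" using e by linarith
  define lam' where "lam' = density lam (\<lambda>x. ennreal (F x / m))"
  have Fi: "integrable lam F" by (rule integrable_const_bound[where B = B]) (use F0 FB Fm' in auto)
  have dm: "(\<lambda>x. ennreal (F x / m)) \<in> borel_measurable lam" using Fm' by measurable
  have "emeasure lam' (space lam') = (\<integral>\<^sup>+x. ennreal (F x / m) \<partial>lam)"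
    unfolding lam'_def by (subst emeasure_density[OF dm]) (auto intro!: nn_integral_cong)
  also have "\<dots> = ennreal (\<integral>x. F x / m \<partial>lam)"
    using Fi F0 m by (intro nn_integral_eq_integral) auto
  also have "\<dots> = 1" using m by (simp add: m_def[symmetric])
  finally have prob: "prob_space lam'" by (rule prob_spaceI)
  have sets: "sets lam' = sets borel" by (simp add: lam'_def lam)
  have trans: "AE x in lam'. P x" if "AE x in lam. P x" for P
    unfolding lam'_def using that by (subst AE_density[OF dm]) auto
  have appr: "AE x in lam'. x \<in> approx_set \<tau> j"
    unfolding lam'_def using Fs by (subst AE_density[OF dm]) (auto intro!: AE_I2 Fs)
  have ft: "fourier_measure lam' \<xi> = H \<xi> / of_real m" for \<xi>
  proof -
    have cm: "(\<lambda>x. cis (- 2 * pi * (\<xi> \<bullet> x))) \<in> borel_measurable lam"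
      unfolding measurable_cong_sets[OF lam(2) refl] by (intro borel_measurable_continuous_onI continuous_intros)
    have "fourier_measure lam' \<xi> = (\<integral>x. (F x / m) *\<^sub>R cis (- 2 * pi * (\<xi> \<bullet> x)) \<partial>lam)"
      unfolding fourier_measure_def lam'_def using Fm' F0 m by (intro integral_density cm) auto
    also have "\<dots> = (\<integral>x. (of_real (F x) * cis (- 2 * pi * (\<xi> \<bullet> x))) / of_real m \<partial>lam)"
      by (simp add: scaleR_conv_of_real)
    also have "\<dots> = H \<xi> / of_real m" unfolding H_def by (rule integral_divide_zero)
    finally show ?thesis .
  qed
  have "cmod (fourier_measure lam' \<xi>) \<le> (2 * K') / (1 + cmod \<xi>) ^ 6" for \<xi>
  proof -
    have "cmod (fourier_measure lam' \<xi>) = cmod (H \<xi>) / m" using m by (simp add: ft norm_divide)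
    also have "\<dots> \<le> cmod (H \<xi>) / (1/2)" using m by (intro divide_left_mono) auto
    also have "\<dots> \<le> 2 * (K' / (1 + cmod \<xi>) ^ 6)" using dec'[of \<xi>] by (simp add: H_def)
    finally show ?thesis by simp
  qed
  then have dec2: "fourier_decay lam'" unfolding fourier_decay_def by blast
  have "cmod (fourier_measure lam' \<xi> - fourier_measure lam \<xi>) \<le> \<epsilon> * profile s (max 1 (cmod \<xi>))" for \<xi>
  proof -
    define p where "p = profile s (max 1 (cmod \<xi>))"
    define L where "L = fourier_measure lam \<xi>"
    have p0: "p \<ge> 0" unfolding p_def by (intro profile_nonneg) auto
    have "K * (1 / (1 + cmod \<xi>) ^ 6) \<le> K * p" unfolding p_def using K0 by (intro mult_left_mono profile_ge s)
    then have L: "cmod L \<le> K * p" using K[of \<xi>] by (simp add: L_def)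
    \<comment> \<open>Separates the error of the density from the error of normalization; the latter
      is at most \<open>e\<close> times \<open>cmod L\<close>, and \<open>L\<close> is itself below
      \<open>K\<close> times the profile.\<close>
    have "fourier_measure lam' \<xi> - L = ((H \<xi> - L) - of_real (m - 1) * L) / of_real m"
      using m by (simp add: ft field_simps)
    then have "cmod (fourier_measure lam' \<xi> - L) = cmod ((H \<xi> - L) - of_real (m - 1) * L) / m"
      using m by (simp add: norm_divide)
    also have "\<dots> \<le> cmod ((H \<xi> - L) - of_real (m - 1) * L) / (1/2)" using m by (intro divide_left_mono) auto
    also have "\<dots> \<le> (cmod (H \<xi> - L) + \<bar>m - 1\<bar> * cmod L) / (1/2)"
      using norm_triangle_ineq4[of "H \<xi> - L" "of_real (m - 1) * L"]
      by (intro divide_right_mono) (auto simp: norm_mult simp flip: of_real_diff)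
    also have "\<dots> \<le> (e * p + e * (K * p)) / (1/2)"
      using close[of \<xi>] m1 L e by (intro divide_right_mono add_mono mult_mono) (auto simp: H_def L_def p_def)
    also have "\<dots> = (2 * e * (1 + K)) * p" by (simp add: algebra_simps)
    also have "\<dots> \<le> \<epsilon> * p" using e(3) p0 by (rule mult_right_mono)
    finally show ?thesis by (simp add: p_def L_def)
  qed
  with j prob sets trans appr dec2 show ?thesis by blast
qed

lemma AE_support_closed:
  fixes \<mu> :: "complex measure"
  assumes "prob_space \<mu>" "sets \<mu> = sets borel" "closed A" "AE x in \<mu>. x \<in> A"
  shows "measure_support \<mu> \<subseteq> A"
  by (rule AE_weak_limit_closed[of \<mu> "\<lambda>_. \<mu>" A 0]) (use assms in auto)

section \<open>Nonpositive \<open>\<tau>\<close>, and comparison of logarithms with the exponential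
  factor\<close>

lemma E_star_nonpos:
  assumes "\<tau> \<le> 0" shows "E_star \<tau> = UNIV"
proof -
  have "infinite {(q, r). q \<in> gaussian_ints \<and> r \<in> gaussian_ints \<and> q \<noteq> 0 \<and> supnorm (q * x - r) \<le> supnorm q powr (- \<tau>)}"
    (is "infinite ?P") for x
  proof
    assume fin: "finite ?P"
    have "of_nat (Suc n) \<in> fst ` ?P" for n
    proof -
      obtain r where r: "r \<in> gaussian_ints" "\<bar>Re (of_nat (Suc n) * x - r)\<bar> \<le> 1/2" "\<bar>Im (of_nat (Suc n) * x - r)\<bar> \<le> 1/2"
        using gaussian_round by blast
      have q: "(of_nat (Suc n) :: complex) \<in> gaussian_ints" "supnorm (of_nat (Suc n)) = real (Suc n)"
        by (auto simp: gaussian_ints_def supnorm_def)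
      \<comment> \<open>The allowed error is at least 1 for every positive integer denominator,
        while rounding achieves 1/2.\<close>
      have "1 \<le> real (Suc n) powr (- \<tau>)" using assms by (intro ge_one_powr_ge_zero) auto
      then have "supnorm (of_nat (Suc n) * x - r) \<le> supnorm (of_nat (Suc n)) powr (- \<tau>)"
        unfolding q(2) using r(2,3) by (simp add: supnorm_def)
      moreover have "(of_nat (Suc n) :: complex) \<noteq> 0" by (simp only: of_nat_eq_0_iff)
      ultimately have "(of_nat (Suc n), r) \<in> ?P" using q(1) r(1) by simp
      then show ?thesis by force
    qed
    then have "range (\<lambda>n. of_nat (Suc n) :: complex) \<subseteq> fst ` ?P" by blast
    then have "finite (range (\<lambda>n. of_nat (Suc n) :: complex))" using fin finite_subset by blast
    moreover have "inj (\<lambda>n. of_nat (Suc n) :: complex)" by (auto simp: inj_def)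
    ultimately show False using finite_imageD infinite_UNIV_nat by blast
  qed
  then show ?thesis unfolding E_star_def by auto
qed

text \<open>With \<open>y = ln L\<close> the claim is \<open>3 * y \<le> 243 + exp y / y\<close>. Up
  to \<open>y = 81\<close> the constant \<open>243 = 3 * 81\<close> suffices; beyond,
  \<open>exp y \<ge> (y / 3) ^ 3 \<ge> 3 * y ^ 2\<close>.\<close>

lemma cube_le_exp_over_log:
  fixes L :: real
  assumes "L > 1" shows "L ^ 3 \<le> exp 243 * exp (L / ln L)"
proof -
  define y where "y = ln L"
  have y: "y > 0" "L = exp y" using assms by (simp_all add: y_def ln_gt_zero)
  have "3 * (y * y) \<le> 243 * y + L"
  proof (cases "y \<le> 81")
    case True
    then have "y * y \<le> 81 * y" using y by (intro mult_right_mono) auto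
    then show ?thesis using assms by simp
  next
    case False
    have "exp (y / 3) ^ 3 = exp (3 * (y / 3))" by (metis exp_of_nat_mult of_nat_numeral)
    then have L: "L = exp (y / 3) ^ 3" using y by simp
    have "y / 3 \<le> exp (y / 3)" using exp_ge_add_one_self[of "y / 3"] by linarith
    then have "(y / 3) ^ 3 \<le> L" unfolding L using y by (intro power_mono) auto
    moreover have "81 * (y * y) \<le> y * (y * y)" using False y by (intro mult_right_mono) auto
    ultimately have "3 * (y * y) \<le> L" by (simp add: power3_eq_cube)
    then show ?thesis using y by simp
  qed
  then have "3 * y \<le> 243 + L / y" using y by (simp add: field_simps)
  then have "exp (3 * y) \<le> exp (243 + L / y)" by simp
  moreover have "exp (3 * y) = L ^ 3" unfolding y(2) by (metis exp_of_nat_mult of_nat_numeral)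
  ultimately show ?thesis by (simp add: exp_add y_def)
qed

lemma cmod_le_2_supnorm: "cmod z \<le> 2 * supnorm z"
  using cmod_le[of z] unfolding supnorm_def by linarith

lemma profile_le_exp_over_log:
  assumes s: "s > 0" and u: "supnorm \<xi> > exp 1"
  shows "profile s (max 1 (cmod \<xi>)) \<le> 27 * exp 243 * (supnorm \<xi> powr (- s) * exp (ln (supnorm \<xi>) / ln (ln (supnorm \<xi>))))"
proof -
  define u where "u = supnorm \<xi>"
  have "exp 1 > (1::real)" by simp
  then have u1: "u > 1" using u unfolding u_def by linarith
  have "ln (exp 1) < ln u" using u u1 unfolding u_def by (subst ln_less_cancel_iff) auto
  then have L: "ln u > 1" by simp
  have t: "u \<le> cmod \<xi>" "cmod \<xi> \<le> 2 * u" unfolding u_def by (rule supnorm_le_cmod cmod_le_2_supnorm)+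
  have "ln (cmod \<xi>) \<le> ln (2 * u)" using t u1 by (subst ln_le_cancel_iff) auto
  also have "\<dots> = ln 2 + ln u" using u1 by (simp add: ln_mult)
  also have "\<dots> \<le> 1 + ln u" using ln_le_minus_one[of "2::real"] by simp
  \<comment> \<open>The hypothesis \<open>supnorm \<xi> > exp 1\<close> gives
    \<open>ln u > 1\<close>, which absorbs the 2; the cube of 3 is the later 27.\<close>
  finally have "1 + ln (cmod \<xi>) \<le> 3 * ln u" using L by simp
  then have "(1 + ln (cmod \<xi>)) ^ 3 \<le> (3 * ln u) ^ 3" using t u1 by (intro power_mono) auto
  also have "\<dots> = 27 * ln u ^ 3" by (simp add: power_mult_distrib)
  also have "\<dots> \<le> 27 * (exp 243 * exp (ln u / ln (ln u)))" using cube_le_exp_over_log[OF L] by simp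
  finally have a: "(1 + ln (cmod \<xi>)) ^ 3 \<le> 27 * (exp 243 * exp (ln u / ln (ln u)))" .
  have "cmod \<xi> powr (- s) \<le> u powr (- s)" using t u1 s by (intro powr_mono2') auto
  then have "cmod \<xi> powr (- s) * (1 + ln (cmod \<xi>)) ^ 3 \<le> u powr (- s) * (27 * (exp 243 * exp (ln u / ln (ln u))))"
    using a t u1 by (intro mult_mono) auto
  moreover have "max 1 (cmod \<xi>) = cmod \<xi>" using t u1 by simp
  ultimately show ?thesis unfolding profile_def u_def by (simp add: mult_ac)
qed

lemma exists_measure_nonpos:
  fixes c :: complex
  assumes \<tau>: "\<tau> \<noteq> -1" "\<tau> \<le> 0" and \<rho>: "\<rho> > 0"
  shows "\<exists>\<mu> C. prob_space \<mu> \<and> sets \<mu> = sets borel \<and>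
           measure_support \<mu> \<subseteq> E_star \<tau> \<inter> cball c \<rho> \<and> C > 0 \<and>
           (\<forall>\<xi>. supnorm \<xi> > exp 1 \<longrightarrow>
              cmod (fourier_measure \<mu> \<xi>) \<le>
                C * supnorm \<xi> powr (- 2 / (1 + \<tau>)) * exp (ln (supnorm \<xi>) / ln (ln (supnorm \<xi>))))"
proof -
  \<comment> \<open>The required order grows without bound as \<open>\<tau>\<close> decreases to -1,
    so it is chosen from \<open>\<tau>\<close>. For \<open>\<tau> < -1\<close> the quotient is
    negative, \<open>nat\<close> returns 0, and order 1 is enough.\<close>
  define n where "n = Suc (nat \<lceil>2 / (1 + \<tau>)\<rceil>)"
  have n: "n > 0" "2 / (1 + \<tau>) \<le> real n" unfolding n_def by linarith+
  obtain \<mu> K where \<mu>: "prob_space \<mu>" "sets \<mu> = sets borel"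
    "AE x in \<mu>. \<bar>Re (x - c)\<bar> < \<rho> / 2 \<and> \<bar>Im (x - c)\<bar> < \<rho> / 2"
    and K: "\<And>\<xi>. cmod (fourier_measure \<mu> \<xi>) \<le> K / (1 + cmod \<xi>) ^ n"
    using base_measure[of "\<rho> / 2" n c] \<rho> n by auto
  have "AE x in \<mu>. x \<in> cball c \<rho>"
    using \<mu>(3)
  proof eventually_elim
    fix x assume "\<bar>Re (x - c)\<bar> < \<rho> / 2 \<and> \<bar>Im (x - c)\<bar> < \<rho> / 2"
    then have "cmod (x - c) \<le> \<rho>" using cmod_le[of "x - c"] by linarith
    then show "x \<in> cball c \<rho>" by (simp add: dist_norm norm_minus_commute)
  qed
  then have supp: "measure_support \<mu> \<subseteq> cball c \<rho>" by (intro AE_support_closed \<mu>) auto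
  have K0: "K \<ge> 0" using order_trans[OF norm_ge_zero K[of 0]] by simp
  have "cmod (fourier_measure \<mu> \<xi>) \<le> (K + 1) * supnorm \<xi> powr (- 2 / (1 + \<tau>)) * exp (ln (supnorm \<xi>) / ln (ln (supnorm \<xi>)))"
    if \<xi>: "supnorm \<xi> > exp 1" for \<xi>
  proof -
    define u where "u = supnorm \<xi>"
    have "exp 1 > (1::real)" by simp
    then have u1: "u > 1" using \<xi> unfolding u_def by linarith
    have "ln (exp 1) < ln u" using \<xi> u1 unfolding u_def by (subst ln_less_cancel_iff) auto
    then have L: "ln u > 1" by simp
    have "cmod (fourier_measure \<mu> \<xi>) \<le> K / (1 + cmod \<xi>) ^ n" by (rule K)
    also have "\<dots> \<le> (K + 1) / u ^ n"
      using K0 u1 supnorm_le_cmod[of \<xi>] by (intro frac_le power_mono) (auto simp: u_def)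
    also have "\<dots> = (K + 1) * u powr (- real n)" using u1 by (simp add: powr_minus_divide powr_realpow)
    also have "\<dots> \<le> (K + 1) * u powr (- 2 / (1 + \<tau>))" using K0 u1 n by (intro mult_left_mono powr_mono) auto
    also have "\<dots> = (K + 1) * u powr (- 2 / (1 + \<tau>)) * 1" by simp
    also have "\<dots> \<le> (K + 1) * u powr (- 2 / (1 + \<tau>)) * exp (ln u / ln (ln u))"
      using K0 L by (intro mult_left_mono) auto
    finally show ?thesis by (simp add: u_def)
  qed
  then show ?thesis using \<mu> supp K0 E_star_nonpos[OF \<tau>(2)] by (intro exI[of _ \<mu>] exI[of _ "K + 1"]) auto
qed

text \<open>Iterate \<open>kaufman_step\<close> with errors \<open>(1/2) ^ Suc n\<close> and shell
  indices at least \<open>n\<close>. Summable errors keep a common Fourier bound, and closedness of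
  the sets \<open>approx_set\<close> carries all approximation conditions to a weak limit.\<close>

lemma exists_measure_pos:
  fixes c :: complex
  assumes \<tau>: "\<tau> > 0" and \<rho>: "\<rho> > 0"
  shows "\<exists>\<mu> C. prob_space \<mu> \<and> sets \<mu> = sets borel \<and>
           measure_support \<mu> \<subseteq> E_star \<tau> \<inter> cball c \<rho> \<and> C > 0 \<and>
           (\<forall>\<xi>. supnorm \<xi> > exp 1 \<longrightarrow>
              cmod (fourier_measure \<mu> \<xi>) \<le>
                C * supnorm \<xi> powr (- 2 / (1 + \<tau>)) * exp (ln (supnorm \<xi>) / ln (ln (supnorm \<xi>))))"
proof -
  define s where "s = 2 / (1 + \<tau>)"
  have s: "0 < s" "s \<le> 2" using \<tau> by (auto simp: s_def field_simps)
  define p where "p \<xi> = profile s (max 1 (cmod \<xi>))" for \<xi>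
  have p0: "p \<xi> \<ge> 0" for \<xi> unfolding p_def by (intro profile_nonneg) auto
  obtain lam0 K where lam0: "prob_space lam0" "sets lam0 = sets borel"
    "AE x in lam0. \<bar>Re (x - c)\<bar> < \<rho> / 2 \<and> \<bar>Im (x - c)\<bar> < \<rho> / 2"
    and K: "\<And>\<xi>. cmod (fourier_measure lam0 \<xi>) \<le> K / (1 + cmod \<xi>) ^ 6"
    using base_measure[of "\<rho> / 2" 6 c] \<rho> by auto
  have K0: "K \<ge> 0" using order_trans[OF norm_ge_zero K[of 0]] by simp
  \<comment> \<open>The last conjunct pins the chosen sequence to start at \<open>lam0\<close>,
    whose support and decay are needed later.\<close>
  define P where "P n z \<longleftrightarrow> prob_space (fst z) \<and> sets (fst z) = sets borel \<and> fourier_decay (fst z) \<and> (n = 0 \<longrightarrow> fst z = lam0)"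
    for n :: nat and z :: "complex measure \<times> nat"
  define Q where "Q n z z' \<longleftrightarrow> snd z' \<ge> n \<and> (\<forall>R. (AE x in fst z. R x) \<longrightarrow> (AE x in fst z'. R x)) \<and>
      (AE x in fst z'. x \<in> approx_set \<tau> (snd z')) \<and>
      (\<forall>\<xi>. cmod (fourier_measure (fst z') \<xi> - fourier_measure (fst z) \<xi>) \<le> (1/2) ^ Suc n * p \<xi>)"
    for n :: nat and z z' :: "complex measure \<times> nat"
  have "\<exists>f. \<forall>n. P n (f n) \<and> Q n (f n) (f (Suc n))"
  proof (rule dependent_nat_choice)
    show "\<exists>z. P 0 z" using lam0 K by (intro exI[of _ "(lam0, 0)"]) (auto simp: P_def fourier_decay_def)
    fix z n assume "P n z"
    then have z: "prob_space (fst z)" "sets (fst z) = sets borel" "fourier_decay (fst z)" by (auto simp: P_def)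
    obtain lam' j where "j \<ge> n" "prob_space lam'" "sets lam' = sets borel" "fourier_decay lam'"
      "\<forall>R. (AE x in fst z. R x) \<longrightarrow> (AE x in lam'. R x)" "AE x in lam'. x \<in> approx_set \<tau> j"
      "\<forall>\<xi>. cmod (fourier_measure lam' \<xi> - fourier_measure (fst z) \<xi>) \<le> (1/2) ^ Suc n * p \<xi>"
      using kaufman_step[OF \<tau> z, of "(1/2) ^ Suc n" n] unfolding p_def s_def by auto
    then have "P (Suc n) (lam', j)" "Q n z (lam', j)"
      unfolding P_def Q_def fst_conv snd_conv by blast+
    then show "\<exists>z'. P (Suc n) z' \<and> Q n z z'" by blast
  qed
  then obtain f where f: "\<And>n. P n (f n)" "\<And>n. Q n (f n) (f (Suc n))" by blast
  define l where "l n = fst (f n)" for n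
  define J where "J n = snd (f n)" for n
  have lp: "prob_space (l n)" "sets (l n) = sets borel" for n using f(1)[of n] by (auto simp: P_def l_def)
  have l0: "l 0 = lam0" using f(1)[of 0] by (auto simp: P_def l_def)
  have J: "J (Suc n) \<ge> n" for n using f(2)[of n] by (auto simp: Q_def J_def)
  have step: "AE x in l (Suc n). R x" if "AE x in l n. R x" for R n
    using f(2)[of n] that unfolding Q_def l_def by blast
  have mono: "AE x in l m. R x" if "AE x in l n. R x" "n \<le> m" for R n m
    using that(2,1) by (induction rule: dec_induct) (blast intro: step)+
  have box: "AE x in l n. \<bar>Re (x - c)\<bar> < \<rho> / 2 \<and> \<bar>Im (x - c)\<bar> < \<rho> / 2" for n
    by (rule mono[OF lam0(3)[folded l0]]) simp
  \<comment> \<open>A constraint acquired at step \<open>n + 1\<close> holds for all later measures,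
    hence eventually along the subsequence defining \<open>\<mu>\<close>.\<close>
  have appr: "AE x in l m. x \<in> approx_set \<tau> (J (Suc n))" if "m \<ge> Suc n" for m n
    by (rule mono[where n = "Suc n", OF _ that]) (use f(2)[of n] in \<open>unfold Q_def l_def J_def, blast\<close>)
  have bound: "cmod (fourier_measure (l n) \<xi>) \<le> (K + (1 - (1/2) ^ n)) * p \<xi>" for n \<xi>
  proof (induction n)
    case 0
    have "K * (1 / (1 + cmod \<xi>) ^ 6) \<le> K * p \<xi>" unfolding p_def using K0 by (intro mult_left_mono profile_ge s)
    then show ?case using K[of \<xi>] by (simp add: l0)
  next
    case (Suc n)
    have "cmod (fourier_measure (l (Suc n)) \<xi> - fourier_measure (l n) \<xi>) \<le> (1/2) ^ Suc n * p \<xi>"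
      using f(2)[of n] by (simp add: Q_def l_def)
    moreover have "cmod (fourier_measure (l (Suc n)) \<xi>) \<le> cmod (fourier_measure (l (Suc n)) \<xi> - fourier_measure (l n) \<xi>) + cmod (fourier_measure (l n) \<xi>)"
      by (metis diff_add_cancel norm_triangle_ineq)
    ultimately show ?case using Suc by (simp add: algebra_simps)
  qed
  have bound': "cmod (fourier_measure (l n) \<xi>) \<le> (K + 1) * p \<xi>" for n \<xi>
    by (rule order_trans[OF bound mult_right_mono[OF _ p0]]) simp
  have \<rho>2: "\<rho> / 2 > 0" using \<rho> by simp
  obtain r \<mu> where r: "strict_mono (r :: nat \<Rightarrow> nat)" and \<mu>: "prob_space \<mu>" "sets \<mu> = sets borel"
    and conv: "\<And>(g :: complex \<Rightarrow> complex) B. continuous_on UNIV g \<Longrightarrow> (\<And>x. cmod (g x) \<le> B) \<Longrightarrow>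
        (\<lambda>n. \<integral>x. g x \<partial>l (r n)) \<longlonglongrightarrow> (\<integral>x. g x \<partial>\<mu>)"
    using weak_limit_bounded[of l "\<rho> / 2" c, OF lp \<rho>2 box] by blast
  have ft: "cmod (fourier_measure \<mu> \<xi>) \<le> (K + 1) * p \<xi>" for \<xi>
  proof -
    have "(\<lambda>n. fourier_measure (l (r n)) \<xi>) \<longlonglongrightarrow> fourier_measure \<mu> \<xi>"
      unfolding fourier_measure_def by (rule conv[of _ 1]) (auto intro!: continuous_intros)
    then show ?thesis using bound' by (intro LIMSEQ_le_const2[OF tendsto_norm]) auto
  qed
  have closed_supp: "measure_support \<mu> \<subseteq> A" if "closed A" "\<And>n. n \<ge> n0 \<Longrightarrow> AE x in l n. x \<in> A" for A n0
  proof (rule AE_weak_limit_closed[OF \<mu>, of "\<lambda>n. l (r n)" A n0])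
    show "AE x in l (r n). x \<in> A" if "n \<ge> n0" for n
      using seq_suble[OF r, of n] that by (intro \<open>\<And>n. n \<ge> n0 \<Longrightarrow> AE x in l n. x \<in> A\<close>) simp
  qed (use conv that in auto)
  have "measure_support \<mu> \<subseteq> cball c \<rho>"
  proof (rule closed_supp[of _ 0])
    fix n
    show "AE x in l n. x \<in> cball c \<rho>"
      using box[of n]
    proof eventually_elim
      fix x assume "\<bar>Re (x - c)\<bar> < \<rho> / 2 \<and> \<bar>Im (x - c)\<bar> < \<rho> / 2"
      then have "cmod (x - c) \<le> \<rho>" using cmod_le[of "x - c"] by linarith
      then show "x \<in> cball c \<rho>" by (simp add: dist_norm norm_minus_commute)
    qed
  qed auto
  moreover have "measure_support \<mu> \<subseteq> E_star \<tau>"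
  proof
    fix x assume x: "x \<in> measure_support \<mu>"
    \<comment> \<open>Since \<open>J (Suc n) \<ge> n\<close>, these memberships include arbitrarily
      large shells.\<close>
    have "x \<in> approx_set \<tau> (J (Suc n))" for n
      using closed_supp[OF closed_approx_set appr] x by blast
    then show "x \<in> E_star \<tau>" using J \<tau> by (intro E_star_approx_sets) auto
  qed
  moreover have "cmod (fourier_measure \<mu> \<xi>) \<le> ((K + 1) * (27 * exp 243)) * supnorm \<xi> powr (- 2 / (1 + \<tau>)) * exp (ln (supnorm \<xi>) / ln (ln (supnorm \<xi>)))"
    if "supnorm \<xi> > exp 1" for \<xi>
  proof -
    have "(K + 1) * p \<xi> \<le> (K + 1) * (27 * exp 243 * (supnorm \<xi> powr (- s) * exp (ln (supnorm \<xi>) / ln (ln (supnorm \<xi>)))))"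
      unfolding p_def using K0 by (intro mult_left_mono profile_le_exp_over_log s that) auto
    moreover have "- s = - 2 / (1 + \<tau>)" by (simp add: s_def)
    ultimately show ?thesis using ft[of \<xi>] by (simp add: mult.assoc)
  qed
  ultimately show ?thesis using \<mu> K0 by (intro exI[of _ \<mu>] exI[of _ "(K + 1) * (27 * exp 243)"]) auto
qed

theorem theorem1:
  fixes \<tau> :: real and c :: complex and \<rho> :: real
  assumes "\<tau> \<noteq> -1" and "\<rho> > 0"
  shows "\<exists>\<mu> C. prob_space \<mu> \<and> sets \<mu> = sets borel \<and>
           measure_support \<mu> \<subseteq> E_star \<tau> \<inter> cball c \<rho> \<and> C > 0 \<and>
           (\<forall>\<xi>. supnorm \<xi> > exp 1 \<longrightarrow>
              cmod (fourier_measure \<mu> \<xi>) \<le>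
                C * supnorm \<xi> powr (- 2 / (1 + \<tau>)) * exp (ln (supnorm \<xi>) / ln (ln (supnorm \<xi>))))"
  using exists_measure_pos exists_measure_nonpos assms by (cases "\<tau> > 0") auto

end
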